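(* Let $N$ be a positive integer and $F_1(s),\ldots,F_N(s)$ orthogonal functions satisfying (I) and (II). Then there exists $n_0\geq1$ such that the distribution functions $\boldsymbol\lambda_{\sigma,n;j}$ and $\boldsymbol\lambda_{\sigma,n;j,l;\tau}$ are absolutely continuous with continuous densities $G_{\sigma,n;j}(\mathbf{x})$ and $G_{\sigma,n;j,l;\tau}(\mathbf{x})$ for every $n\geq n_0$, $\sigma\geq1$, $j,l\in\{1,\ldots,N\}$, $j\neq l$, $\tau\in\{\pm1,\pm i\}$; more generally, for every $k\geq0$ there exists $n_k\geq1$ such that $G_{\sigma,n;j},G_{\sigma,n;j,l;\tau}\in\mathcal{C}^k(\mathbb{C}^N)$ for all $n\geq n_k$, $\sigma\geq1$. Moreover, as $n\to\infty$, $\boldsymbol\lambda_{\sigma,n;j}$ and $\boldsymbol\lambda_{\sigma,n;j,l;\tau}$ converge weakly to distribution functions $\boldsymbol\lambda_{\sigma;j}$ and $\boldsymbol\lambda_{\sigma;j,l;\tau}$ which are absolutely continuous with densities $G_{\sigma;j},G_{\sigma;j,l;\tau}\in\mathcal{C}^\infty(\mathbb{C}^N)$ for every $\sigma\geq1$, $j\neq l$, $\tau\in\{\pm1,\pm i\}$; and for every $M>1$ the functions $G_{\sigma,n;j}(\mathbf{x})$, $G_{\sigma,n;j,l;\tau}(\mathbf{x})$ and their partial derivatives converge to $G_{\sigma;j}(\mathbf{x})$, $G_{\sigma;j,l;\tau}(\mathbf{x})$ and their partial derivatives uniformly for $\mathbf{x}\in\mathbb{C}^N$ and $1\leq\sigma\leq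 M$.
   Context: Write $s=\sigma+it$. (I) $F(s)=\sum_{n\geq1}a_F(n)n^{-s}$ is absolutely convergent for $\sigma>1$; (II) $\log F(s)=\sum_p\sum_{k\geq1}b_F(p^k)p^{-ks}$ (over primes) is absolutely convergent for $\sigma>1$, with $|b_F(p^k)|\ll p^{k\theta}$ for some $\theta<\frac12$. $F_1,\ldots,F_N$ are orthogonal if $\sum_{p\leq x}a_{F_i}(p)\overline{a_{F_j}(p)}/p=(m_{i,j}+o(1))\log\log x$, $m_{i,i}>0$, $m_{i,j}=0$ ($i\neq j$). Local factors: $\log F_{j,p}(s)=\sum_{k\geq1}b_{F_j}(p^k)p^{-ks}$, $F_{j,p}=\exp(\log F_{j,p})$. Let $p_m$ be the $m$-th prime. For $\boldsymbol\theta=(\theta_1,\ldots,\theta_n)\in[0,1]^n$ put $s_m=\sigma+i\frac{2\pi\theta_m}{\log p_m}$, $F_{j,n}(\sigma,\boldsymbol\theta)=\prod_{m=1}^nF_{j,p_m}(s_m)$, $\log F_{j,n}(\sigma,\boldsymbol\theta)=\sum_{m=1}^n\log F_{j,p_m}(s_m)$, $\frac{F'_{j,n}}{F_{j,n}}(\sigma,\boldsymbol\theta)=\sum_{m=1}^n\frac{F'_{j,p_m}}{F_{j,p_m}}(s_m)$, and $\mathbf{\log F}_n(\sigma,\boldsymbol\theta)=(\log F_{1,n}(\sigma,\boldsymbol\theta),\ldots,\log F_{N,n}(\sigma,\boldsymbol\theta))\in\mathbb{C}^N$. For a Borel set $\mathbf{E}\subseteq\mathbb{C}^N$ let $W_n(\sigma,\mathbf{E})=\{\boldsymbol\theta\in[0,1)^n:\mathbf{\log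 F}_n(\sigma,\boldsymbol\theta)\in\mathbf{E}\}$ and define $\boldsymbol\lambda_{\sigma,n;j}(\mathbf{E})=\int_{W_n(\sigma,\mathbf{E})}\big|\frac{F'_{j,n}}{F_{j,n}}(\sigma,\boldsymbol\theta)\big|^2d\boldsymbol\theta$ and, for $j\neq l$, $\tau\in\{\pm1,\pm i\}$, $\boldsymbol\lambda_{\sigma,n;j,l;\tau}(\mathbf{E})=\int_{W_n(\sigma,\mathbf{E})}\big|\frac{F'_{j,n}}{F_{j,n}}(\sigma,\boldsymbol\theta)+\tau\frac{F'_{l,n}}{F_{l,n}}(\sigma,\boldsymbol\theta)\big|^2d\boldsymbol\theta$. Absolute continuity is with respect to Lebesgue measure on $\mathbb{C}^N\cong\mathbb{R}^{2N}$, and the density is the Radon–Nikodym derivative. *)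

theory Defs
  imports
    "HOL-Analysis.Analysis"
    "HOL-Library.Landau_Symbols"
    "HOL-Library.Infinite_Set"
    "HOL-Computational_Algebra.Primes"
begin

section \<open>Dirichlet series, Euler products, orthogonality\<close>

definition dirichlet_series :: "(complex \<Rightarrow> complex) \<Rightarrow> (nat \<Rightarrow> complex) \<Rightarrow> bool" where
  "dirichlet_series F a \<longleftrightarrow>
     (\<forall>s. Re s > 1 \<longrightarrow>
        (\<lambda>n. norm (a n * of_nat n powr (- s))) summable_on {1..} \<and>
        ((\<lambda>n. a n * of_nat n powr (- s)) has_sum F s) {1..})"

text \<open>
  The identity \<open>log F(s) = \<Sum>\<^sub>p \<Sum>\<^sub>k b(p\<^sup>k) p\<^sup>-\<^sup>k\<^sup>s\<close> says that the double series is a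
  logarithm of \<open>F(s)\<close>; only the values of \<open>b\<close> at prime powers matter.
\<close>

definition euler_product :: "(complex \<Rightarrow> complex) \<Rightarrow> (nat \<Rightarrow> complex) \<Rightarrow> bool" where
  "euler_product F b \<longleftrightarrow>
     (\<forall>s. Re s > 1 \<longrightarrow>
        (\<lambda>(p, k). norm (b (p ^ k) * of_nat p powr (- (of_nat k * s))))
          summable_on ({p. prime p} \<times> {1..}) \<and>
        F s = exp (\<Sum>\<^sub>\<infinity>(p, k)\<in>{p. prime p} \<times> {1..}.
                     b (p ^ k) * of_nat p powr (- (of_nat k * s)))) \<and>
     (\<exists>\<theta><1/2. \<exists>C::real. \<forall>p k. prime p \<longrightarrow> k \<ge> 1 \<longrightarrow>
        norm (b (p ^ k)) \<le> C * real p powr (real k * \<theta>))"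

definition orthogonal_family :: "('N \<Rightarrow> nat \<Rightarrow> complex) \<Rightarrow> bool" where
  "orthogonal_family a \<longleftrightarrow>
     (\<exists>m :: 'N \<Rightarrow> 'N \<Rightarrow> real.
        (\<forall>i. m i i > 0) \<and> (\<forall>i j. i \<noteq> j \<longrightarrow> m i j = 0) \<and>
        (\<forall>i j. \<exists>\<epsilon> :: real \<Rightarrow> complex. \<epsilon> \<in> o(\<lambda>_. 1) \<and>
           (\<forall>\<^sub>F x in at_top.
              (\<Sum>p | prime p \<and> real p \<le> x. a i p * cnj (a j p) / of_nat p)
                = (of_real (m i j) + \<epsilon> x) * of_real (ln (ln x)))))"

section \<open>Local factors and finite partial products\<close>

definition log_local :: "(nat \<Rightarrow> complex) \<Rightarrow> nat \<Rightarrow> complex \<Rightarrow> complex" where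
  "log_local b p s = (\<Sum>k. b (p ^ Suc k) * of_nat p powr (- (of_nat (Suc k) * s)))"

definition local_factor :: "(nat \<Rightarrow> complex) \<Rightarrow> nat \<Rightarrow> complex \<Rightarrow> complex" where
  "local_factor b p s = exp (log_local b p s)"

text \<open>The primes are numbered from 1, whereas \<^const>\<open>enumerate\<close> starts at 0.\<close>

definition nth_prime :: "nat \<Rightarrow> nat" where
  "nth_prime m = enumerate {p. prime p} (m - 1)"

definition s_point :: "real \<Rightarrow> (nat \<Rightarrow> real) \<Rightarrow> nat \<Rightarrow> complex" where
  "s_point \<sigma> \<theta> m = Complex \<sigma> (2 * pi * \<theta> m / ln (real (nth_prime m)))"

definition log_Fn :: "(nat \<Rightarrow> complex) \<Rightarrow> nat \<Rightarrow> real \<Rightarrow> (nat \<Rightarrow> real) \<Rightarrow> complex" where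
  "log_Fn b n \<sigma> \<theta> = (\<Sum>m=1..n. log_local b (nth_prime m) (s_point \<sigma> \<theta> m))"

definition logderiv_Fn :: "(nat \<Rightarrow> complex) \<Rightarrow> nat \<Rightarrow> real \<Rightarrow> (nat \<Rightarrow> real) \<Rightarrow> complex" where
  "logderiv_Fn b n \<sigma> \<theta> =
     (\<Sum>m=1..n. deriv (local_factor b (nth_prime m)) (s_point \<sigma> \<theta> m)
                / local_factor b (nth_prime m) (s_point \<sigma> \<theta> m))"

definition vec_log_Fn ::
    "('N::finite \<Rightarrow> nat \<Rightarrow> complex) \<Rightarrow> nat \<Rightarrow> real \<Rightarrow> (nat \<Rightarrow> real) \<Rightarrow> complex ^ 'N" where
  "vec_log_Fn b n \<sigma> \<theta> = (\<chi> j. log_Fn (b j) n \<sigma> \<theta>)"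

section \<open>The distribution functions, as Borel measures on \<open>\<complex>\<^sup>N\<close>\<close>

definition W ::
    "('N::finite \<Rightarrow> nat \<Rightarrow> complex) \<Rightarrow> nat \<Rightarrow> real \<Rightarrow> (complex ^ 'N) set \<Rightarrow> (nat \<Rightarrow> real) set" where
  "W b n \<sigma> E = {\<theta> \<in> {1..n} \<rightarrow>\<^sub>E {0..<1}. vec_log_Fn b n \<sigma> \<theta> \<in> E}"

definition weighted_distribution ::
    "('N::finite \<Rightarrow> nat \<Rightarrow> complex) \<Rightarrow> nat \<Rightarrow> real \<Rightarrow> ((nat \<Rightarrow> real) \<Rightarrow> real)
       \<Rightarrow> (complex ^ 'N) measure" where
  "weighted_distribution b n \<sigma> w =
     measure_of UNIV (sets borel)
       (\<lambda>E. \<integral>\<^sup>+\<theta>\<in>W b n \<sigma> E. ennreal (w \<theta>) \<partial>(\<Pi>\<^sub>M m\<in>{1..n}. lborel))"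

definition lambda1 ::
    "('N::finite \<Rightarrow> nat \<Rightarrow> complex) \<Rightarrow> nat \<Rightarrow> real \<Rightarrow> 'N \<Rightarrow> (complex ^ 'N) measure" where
  "lambda1 b n \<sigma> j =
     weighted_distribution b n \<sigma> (\<lambda>\<theta>. (norm (logderiv_Fn (b j) n \<sigma> \<theta>))\<^sup>2)"

definition lambda2 ::
    "('N::finite \<Rightarrow> nat \<Rightarrow> complex) \<Rightarrow> nat \<Rightarrow> real \<Rightarrow> 'N \<Rightarrow> 'N \<Rightarrow> complex
       \<Rightarrow> (complex ^ 'N) measure" where
  "lambda2 b n \<sigma> j l \<tau> =
     weighted_distribution b n \<sigma>
       (\<lambda>\<theta>. (norm (logderiv_Fn (b j) n \<sigma> \<theta> + \<tau> * logderiv_Fn (b l) n \<sigma> \<theta>))\<^sup>2)"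

text \<open>
  The set function defining \<^const>\<open>weighted_distribution\<close> is countably additive as soon as the
  integrands are measurable, so the measure takes the intended values.
\<close>

lemma log_local_measurable [measurable]: "log_local b p \<in> borel_measurable borel"
proof -
  have "(\<lambda>s. of_nat p powr (- (of_nat (Suc k) * s)) :: complex) \<in> borel_measurable borel" for k
  proof (cases "p = 0")
    case False
    then show ?thesis
      by (intro borel_measurable_continuous_onI continuous_intros) auto
  qed simp
  then show ?thesis
    unfolding log_local_def by measurable
qed

lemma vec_log_Fn_measurable [measurable]:
  "vec_log_Fn b n \<sigma> \<in> (\<Pi>\<^sub>M m\<in>{1..n}. lborel) \<rightarrow>\<^sub>M borel"
proof -
  have 1: "(\<lambda>\<theta>. s_point \<sigma> \<theta> m) \<in> (\<Pi>\<^sub>M m\<in>{1..n}. lborel) \<rightarrow>\<^sub>M borel" if "m \<in> {1..n}" for m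
  proof -
    have "(\<lambda>\<theta>. \<theta> m) \<in> (\<Pi>\<^sub>M m\<in>{1..n}. lborel) \<rightarrow>\<^sub>M (lborel :: real measure)"
      using that by measurable
    then have [measurable]: "(\<lambda>\<theta>. \<theta> m) \<in> borel_measurable (\<Pi>\<^sub>M m\<in>{1..n}. (lborel :: real measure))"
      by simp
    show ?thesis
      unfolding s_point_def Complex_eq by measurable
  qed
  have 2: "(\<lambda>\<theta>. log_Fn (b j) n \<sigma> \<theta>) \<in> (\<Pi>\<^sub>M m\<in>{1..n}. lborel) \<rightarrow>\<^sub>M borel" for j
    unfolding log_Fn_def
    by (intro borel_measurable_sum measurable_compose[OF 1 log_local_measurable])
  have "vec_log_Fn b n \<sigma> \<theta> = (\<Sum>j\<in>UNIV. axis j (log_Fn (b j) n \<sigma> \<theta>))" for \<theta>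
    by (simp add: vec_log_Fn_def vec_eq_iff axis_def if_distrib cong: if_cong)
  moreover have "(\<lambda>\<theta>. axis j (log_Fn (b j) n \<sigma> \<theta>)) \<in> (\<Pi>\<^sub>M m\<in>{1..n}. lborel) \<rightarrow>\<^sub>M borel" for j
  proof -
    have "continuous_on UNIV (\<lambda>z::complex. axis j z :: complex ^ 'a)"
      unfolding axis_def
    proof (intro continuous_on_vec_lambda)
      fix i show "continuous_on UNIV (\<lambda>z::complex. if i = j then z else 0)"
        by (cases "i = j") auto
    qed
    from measurable_compose[OF 2 borel_measurable_continuous_onI[OF this]] show ?thesis .
  qed
  ultimately show ?thesis
    by (subst measurable_cong[where g = "\<lambda>\<theta>. \<Sum>j\<in>UNIV. axis j (log_Fn (b j) n \<sigma> \<theta>)"]) auto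
qed

lemma emeasure_weighted_distribution:
  fixes b :: "'N::finite \<Rightarrow> nat \<Rightarrow> complex"
  assumes w: "w \<in> borel_measurable (\<Pi>\<^sub>M m\<in>{1..n}. lborel)"
    and E: "E \<in> sets borel"
  shows "emeasure (weighted_distribution b n \<sigma> w) E =
           (\<integral>\<^sup>+\<theta>\<in>W b n \<sigma> E. ennreal (w \<theta>) \<partial>(\<Pi>\<^sub>M m\<in>{1..n}. lborel))"
proof -
  let ?P = "\<Pi>\<^sub>M m\<in>{1..n}. lborel :: real measure"
  let ?Q = "{1..n} \<rightarrow>\<^sub>E {0..<1::real}"
  let ?M = "distr (density ?P (\<lambda>\<theta>. ennreal (w \<theta>) * indicator ?Q \<theta>)) borel (vec_log_Fn b n \<sigma>)"
  have [measurable]: "?Q \<in> sets ?P"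
    by (intro sets_PiM_I_finite) auto
  note w [measurable]
  have eq: "emeasure ?M A = (\<integral>\<^sup>+\<theta>\<in>W b n \<sigma> A. ennreal (w \<theta>) \<partial>?P)" if A: "A \<in> sets borel" for A
  proof -
    have w': "(\<lambda>\<theta>. ennreal (w \<theta>) * indicator ?Q \<theta>) \<in> borel_measurable ?P"
      by measurable
    have pre: "vec_log_Fn b n \<sigma> -` A \<inter> space ?P \<in> sets ?P"
      using A by (intro measurable_sets[OF vec_log_Fn_measurable])
    have "emeasure ?M A = emeasure (density ?P (\<lambda>\<theta>. ennreal (w \<theta>) * indicator ?Q \<theta>))
                            (vec_log_Fn b n \<sigma> -` A \<inter> space ?P)"
      using A vec_log_Fn_measurable[of b n \<sigma>] by (subst emeasure_distr) auto
    also have "\<dots> = (\<integral>\<^sup>+\<theta>. ennreal (w \<theta>) * indicator ?Q \<theta> *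
                     indicator (vec_log_Fn b n \<sigma> -` A \<inter> space ?P) \<theta> \<partial>?P)"
      by (rule emeasure_density[OF w' pre])
    also have "\<dots> = (\<integral>\<^sup>+\<theta>\<in>W b n \<sigma> A. ennreal (w \<theta>) \<partial>?P)"
      by (intro nn_integral_cong) (auto simp: W_def indicator_def)
    finally show ?thesis .
  qed
  have ss: "sigma_sets UNIV (sets borel) = sets (borel :: (complex ^ 'N) measure)"
    using sets.sigma_sets_eq[of "borel :: (complex ^ 'N) measure"] by simp
  have "weighted_distribution b n \<sigma> w = measure_of (space ?M) (sets ?M) (emeasure ?M)"
    unfolding weighted_distribution_def space_distr sets_distr space_borel
    by (rule measure_of_eq) (simp_all only: ss eq subset_UNIV Pow_UNIV)
  then show ?thesis
    by (simp only: measure_of_of_measure eq[OF E])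
qed

section \<open>Densities, weak convergence, smoothness\<close>

text \<open>Nonnegativity is needed because \<^const>\<open>ennreal\<close> truncates negative values to 0.\<close>

definition has_density :: "'a::euclidean_space measure \<Rightarrow> ('a \<Rightarrow> real) \<Rightarrow> bool" where
  "has_density \<mu> g \<longleftrightarrow>
     absolutely_continuous lborel \<mu> \<and>
     g \<in> borel_measurable borel \<and> (\<forall>x. g x \<ge> 0) \<and>
     \<mu> = density lborel (\<lambda>x. ennreal (g x))"

definition finite_borel_measure :: "'a::topological_space measure \<Rightarrow> bool" where
  "finite_borel_measure \<mu> \<longleftrightarrow> finite_measure \<mu> \<and> sets \<mu> = sets borel"

definition converges_weakly ::
    "(nat \<Rightarrow> 'a::topological_space measure) \<Rightarrow> 'a measure \<Rightarrow> bool" where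
  "converges_weakly \<mu>s \<mu> \<longleftrightarrow>
     (\<forall>n. finite_borel_measure (\<mu>s n)) \<and> finite_borel_measure \<mu> \<and>
     (\<forall>f :: 'a \<Rightarrow> real. continuous_on UNIV f \<and> bounded (range f) \<longrightarrow>
        (\<lambda>n. integral\<^sup>L (\<mu>s n) f) \<longlonglongrightarrow> integral\<^sup>L \<mu> f)"

definition partial_deriv :: "'a::euclidean_space \<Rightarrow> ('a \<Rightarrow> real) \<Rightarrow> 'a \<Rightarrow> real" where
  "partial_deriv v f x = deriv (\<lambda>t::real. f (x + t *\<^sub>R v)) 0"

abbreviation iter_partial :: "'a::euclidean_space list \<Rightarrow> ('a \<Rightarrow> real) \<Rightarrow> 'a \<Rightarrow> real" where
  "iter_partial vs f \<equiv> foldr partial_deriv vs f"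

text \<open>
  Differentiability is in the real sense: for \<open>'a = complex ^ 'N\<close> the set \<^const>\<open>Basis\<close>
  consists of the vectors \<open>axis j 1\<close> and \<open>axis j \<i>\<close>, so that the partial derivatives
  are those in the \<open>2N\<close> real coordinates.
\<close>

primrec C_diff :: "nat \<Rightarrow> ('a::euclidean_space \<Rightarrow> real) \<Rightarrow> bool" where
  "C_diff 0 f \<longleftrightarrow> continuous_on UNIV f"
| "C_diff (Suc k) f \<longleftrightarrow> continuous_on UNIV f \<and>
     (\<forall>v\<in>Basis. (\<forall>x. (\<lambda>t::real. f (x + t *\<^sub>R v)) field_differentiable at 0) \<and>
                C_diff k (partial_deriv v f))"

end

theory Submission
  imports "HOL-Probability.Probability" "HOL-Real_Asymp.Real_Asymp" Defs
begin

text \<open>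
  The Fourier transform of \<open>\<lambda>\<^bsub>\<sigma>,n;j\<^esub>\<close> is an integral over the cube in which the coordinates are
  independent: the phase is a sum of terms, one per prime, and so is the factor inside the square. It
  therefore expands into products of one-dimensional integrals, of which all but at most two are
  oscillatory integrals of pure phase. By a van der Corput estimate such an integral at \<open>p\<close> is
  \<open>O(\<bar>y\<bar> powr (-1/2))\<close> as soon as \<open>\<bar>\<Sum>\<^sub>j a\<^sub>j(p) cnj y\<^sub>j\<bar> \<ge> c \<bar>y\<bar>\<close> and \<open>p\<close> is large, because then the first Fourier
  coefficient dominates uniformly in \<open>\<sigma> \<ge> 1\<close>. Orthogonality and the upper bound for \<open>\<Sum> 1/p\<close> provide
  infinitely many such primes in every direction, and compactness of the sphere puts any prescribed
  number of them below a bound that does not depend on \<open>y\<close>. Hence the Fourier transforms decay faster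
  than any given power once \<open>n\<close> is large. As all terms have mean zero, passing from \<open>n\<close> to \<open>n + 1\<close>
  changes the Fourier transform only by a summable amount, and Fourier inversion turns this into
  uniform convergence of the densities and their derivatives. Weak convergence follows by Scheffe's lemma, since
  the limit density keeps the full mass. The orthogonality relation concerns \<open>a\<close> and the
  local factors \<open>b\<close>; that \<open>a(p) = b(p)\<close> follows from comparing mean values on a vertical line.
\<close>


section \<open>Fourier inversion on Euclidean spaces\<close>

text \<open>Both kinds of distribution are treated as one family: the weight is the squared modulus
  of a linear combination of the logarithmic derivatives with coefficients \<open>w j\<close> of
  modulus at most 2, so \<open>lambda1\<close> and \<open>lambda2\<close> differ only in the choice
  of \<open>w\<close>. The order of the quantifiers shapes the decay estimate. The index from which
  the densities are \<open>k\<close> times differentiable must serve all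
  \<open>\<sigma> \<ge> 1\<close>, although at a given prime \<open>p\<close> the first Fourier
  coefficient shrinks like \<open>p powr (- \<sigma>)\<close>. The primes are therefore selected
  through the ratio of the later coefficients to the first, which does not deteriorate as
  \<open>\<sigma>\<close> grows, and only the constant of the decay depends on the upper bound
  \<open>M\<close> for \<open>\<sigma>\<close>. No limit measure is available in advance: its
  density is built from the limit of the Fourier transforms, and the total mass is computed by
  inversion at the origin. The identity \<open>a p = b p\<close> cannot be read off from a
  logarithm, since \<open>euler_product\<close> fixes only the exponential of the double series;
  hence \<open>F\<close> is compared with that exponential.\<close>

lemma borel_measurable_cis [measurable]: "cis \<in> borel_measurable borel"
  by (intro borel_measurable_continuous_onI continuous_intros)

text \<open>The parameter multiplies the variable: \<open>gauss e\<close> tends to 1 as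
  \<open>e\<close> tends to 0 and serves as a summability factor on the Fourier side, while
  \<open>gauss (1 / e)\<close> is the concentrated Gaussian dual to it.\<close>

definition gauss :: "real \<Rightarrow> 'a::euclidean_space \<Rightarrow> real" where
  "gauss e x = exp (- (e\<^sup>2 * (x \<bullet> x)) / 2)"

lemma gauss_measurable [measurable]: "gauss e \<in> borel_measurable borel"
  unfolding gauss_def by (intro borel_measurable_continuous_onI continuous_intros) auto

lemma gauss_pos: "gauss e x > 0" and gauss_le_1: "gauss e x \<le> 1"
  by (auto simp: gauss_def)

text \<open>This is the characteristic function of the standard normal distribution at
  \<open>s / e\<close>, transported by the substitution \<open>u = e * x\<close>.\<close>

lemma gauss_fourier_real:
  fixes e s :: real
  assumes "e > 0"
  shows "integrable lborel (\<lambda>x. cis (x * s) * gauss e x)"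
    and "(LINT x|lborel. cis (x * s) * gauss e x) = sqrt (2 * pi) / e * gauss (1 / e) s"
proof -
  have d: "std_normal_density u = exp (- u\<^sup>2 / 2) / sqrt (2 * pi)" for u
    by (simp add: std_normal_density_def)
  have i0: "integrable lborel std_normal_density"
    by (rule integrable_normal_density) simp
  have i1: "integrable lborel (\<lambda>u. std_normal_density u *\<^sub>R cis (u * (s / e)))"
    by (rule Bochner_Integration.integrable_bound[OF i0]) (auto simp: )
  have "(LINT u|lborel. std_normal_density u *\<^sub>R cis (u * (s / e)))
        = char std_normal_distribution (s / e)"
    unfolding char_def
    by (subst integral_density) (auto simp: cis_conv_exp mult_ac)
  also have "\<dots> = complex_of_real (exp (- (s / e)\<^sup>2 / 2))"
    by (simp add: char_std_normal_distribution)
  finally have v1: "has_bochner_integral lborel (\<lambda>u. std_normal_density u *\<^sub>R cis (u * (s / e)))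
      (complex_of_real (exp (- (s / e)\<^sup>2 / 2)))"
    using i1 by (simp add: has_bochner_integral_iff)
  have "has_bochner_integral lborel (\<lambda>x. std_normal_density (0 + e * x) *\<^sub>R cis ((0 + e * x) * (s / e)))
      (complex_of_real (exp (- (s / e)\<^sup>2 / 2)) /\<^sub>R \<bar>e\<bar>)"
    by (rule iffD1[OF lborel_has_bochner_integral_real_affine_iff v1]) (use assms in simp)
  then have "has_bochner_integral lborel (\<lambda>x. sqrt (2 * pi) *\<^sub>R (std_normal_density (e * x) *\<^sub>R cis (x * s)))
      (sqrt (2 * pi) *\<^sub>R (complex_of_real (exp (- (s / e)\<^sup>2 / 2)) /\<^sub>R e))"
    using assms by (intro has_bochner_integral_scaleR_right) (simp_all add: mult_ac)
  moreover have "(\<lambda>x. sqrt (2 * pi) *\<^sub>R (std_normal_density (e * x) *\<^sub>R cis (x * s)))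
     = (\<lambda>x. cis (x * s) * gauss e x)"
    by (auto simp: d gauss_def fun_eq_iff scaleR_conv_of_real power2_eq_square mult_ac)
  moreover have "sqrt (2 * pi) *\<^sub>R (complex_of_real (exp (- (s / e)\<^sup>2 / 2)) /\<^sub>R e)
     = sqrt (2 * pi) / e * gauss (1 / e) s"
    using assms by (simp add: gauss_def scaleR_conv_of_real power2_eq_square field_simps)
  ultimately show "integrable lborel (\<lambda>x. cis (x * s) * gauss e x)"
    and "(LINT x|lborel. cis (x * s) * gauss e x) = sqrt (2 * pi) / e * gauss (1 / e) s"
    by (auto simp: has_bochner_integral_iff)
qed

text \<open>\<open>lborel\<close> is the image of the product of one-dimensional Lebesgue measures
  under the coordinate map, so Fubini for product measures applies.\<close>

lemma
  fixes f :: "'a::euclidean_space \<Rightarrow> real \<Rightarrow> 'b::{real_normed_field,banach,second_countable_topology}"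
  assumes "\<And>b. b \<in> Basis \<Longrightarrow> integrable lborel (f b)"
  shows integrable_lborel_prod: "integrable lborel (\<lambda>x. \<Prod>b\<in>Basis. f b (x \<bullet> b))"
    and integral_lborel_prod:
      "(LINT x|lborel. (\<Prod>b\<in>Basis. f b (x \<bullet> b))) = (\<Prod>b\<in>Basis. LINT x|lborel. f b x)"
proof -
  interpret product_sigma_finite "\<lambda>_::'a. lborel :: real measure" ..
  have m [measurable]: "\<And>b. b \<in> Basis \<Longrightarrow> f b \<in> borel_measurable borel"
    using assms by (simp add: integrable_iff_bounded)
  have mp: "(\<lambda>x. \<Prod>b\<in>Basis. f b (x \<bullet> b)) \<in> borel_measurable borel"
    by measurable
  have eq: "(\<Prod>b\<in>Basis. f b ((\<Sum>i\<in>Basis. g i *\<^sub>R i) \<bullet> b)) = (\<Prod>b\<in>Basis. f b (g b))" for g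
    by (intro prod.cong refl) simp
  show "integrable lborel (\<lambda>x. \<Prod>b\<in>Basis. f b (x \<bullet> b))"
    by (subst lborel_eq, subst integrable_distr_eq[OF _ mp])
       (use product_integrable_prod[of Basis f] assms in \<open>simp_all add: eq\<close>)
  show "(LINT x|lborel. (\<Prod>b\<in>Basis. f b (x \<bullet> b))) = (\<Prod>b\<in>Basis. LINT x|lborel. f b x)"
    by (subst lborel_eq, subst integral_distr[OF _ mp])
       (use product_integral_prod[of Basis f] assms in \<open>simp_all add: eq\<close>)
qed

lemma cis_sum: "cis (sum f A) = (\<Prod>i\<in>A. cis (f i))"
  by (induction A rule: infinite_finite_induct) (auto simp: cis_mult[symmetric])

lemma gauss_fourier:
  fixes t :: "'a::euclidean_space"
  assumes "e > 0"
  shows "integrable lborel (\<lambda>x. cis (x \<bullet> t) * gauss e x)"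
    and "(LINT x|lborel. cis (x \<bullet> t) * gauss e x) = (sqrt (2 * pi) / e) ^ DIM('a) * gauss (1 / e) t"
proof -
  have g: "gauss e x = (\<Prod>b\<in>Basis. gauss e (x \<bullet> b))" for e and x :: 'a
    by (simp add: gauss_def exp_sum[symmetric] sum_negf[symmetric] sum_distrib_left sum_divide_distrib
        euclidean_inner[of x x])
  have c: "cis (x \<bullet> t) = (\<Prod>b\<in>Basis. cis ((x \<bullet> b) * (t \<bullet> b)))" for x
    by (simp add: cis_sum[symmetric] euclidean_inner[of x t])
  have eq: "(\<lambda>x. cis (x \<bullet> t) * gauss e x)
     = (\<lambda>x. \<Prod>b\<in>Basis. cis ((x \<bullet> b) * (t \<bullet> b)) * gauss e (x \<bullet> b))"
    by (simp add: fun_eq_iff g c prod.distrib)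
  show "integrable lborel (\<lambda>x. cis (x \<bullet> t) * gauss e x)"
    unfolding eq by (rule integrable_lborel_prod) (rule gauss_fourier_real[OF assms])
  show "(LINT x|lborel. cis (x \<bullet> t) * gauss e x) = (sqrt (2 * pi) / e) ^ DIM('a) * gauss (1 / e) t"
    unfolding eq
    by (subst integral_lborel_prod)
       (simp_all add: gauss_fourier_real assms prod.distrib g[of _ t] power_divide prod_dividef)
qed

lemma integrable_gauss: "e > 0 \<Longrightarrow> integrable lborel (gauss e :: 'a::euclidean_space \<Rightarrow> real)"
proof -
  assume "e > 0"
  from gauss_fourier(1)[OF this, where t = "0::'a"]
  have "integrable lborel (\<lambda>x::'a. complex_of_real (gauss e x))" by simp
  then show ?thesis by (simp only: complex_of_real_integrable_eq)
qed

text \<open>The normal density with variance \<open>e\<^sup>2\<close> in every coordinate; it arises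
  as the normalised Fourier transform of \<open>gauss e\<close>, see
  \<open>integral_gauss_kernel\<close>.\<close>

definition mollifier :: "real \<Rightarrow> 'a::euclidean_space \<Rightarrow> real" where
  "mollifier e x = gauss (1 / e) x / (sqrt (2 * pi) * e) ^ DIM('a)"

lemma mollifier_measurable [measurable]: "mollifier e \<in> borel_measurable borel"
  unfolding mollifier_def by measurable

lemma mollifier_nonneg: "e > 0 \<Longrightarrow> mollifier e x \<ge> 0"
  unfolding mollifier_def using gauss_pos[of "1 / e" x] by simp

lemma mollifier_bound: 
  "e > 0 \<Longrightarrow> norm (mollifier e (x :: 'a::euclidean_space)) \<le> 1 / (sqrt (2 * pi) * e) ^ DIM('a)"
  using mollifier_nonneg[of e x] gauss_le_1[of "1/e" x] gauss_pos[of "1/e" x]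
  by (auto simp: mollifier_def intro!: divide_right_mono)

lemma integral_mollifier:
  assumes "e > 0"
  shows "integrable lborel (mollifier e :: 'a::euclidean_space \<Rightarrow> real)"
    and "(LINT x|lborel. mollifier e (x :: 'a)) = 1"
proof -
  have i: "integrable lborel (gauss (1 / e) :: 'a \<Rightarrow> real)"
    by (rule integrable_gauss) (use assms in simp)
  then show "integrable lborel (mollifier e :: 'a::euclidean_space \<Rightarrow> real)"
    unfolding mollifier_def by simp
  have "complex_of_real (LINT x|lborel. gauss (1 / e) (x :: 'a)) = (sqrt (2 * pi) * e) ^ DIM('a)"
    using gauss_fourier(2)[of "1 / e" "0::'a"] assms by (simp add: gauss_def[of _ 0])
  then have "(LINT x|lborel. gauss (1 / e) (x :: 'a)) = (sqrt (2 * pi) * e) ^ DIM('a)"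
    by (simp only: of_real_eq_iff)
  then show "(LINT x|lborel. mollifier e (x :: 'a)) = 1"
    unfolding mollifier_def using assms by simp
qed

text \<open>Scaling turns the average of \<open>f\<close> against the mollifier into an average against a fixed Gaussian.\<close>

lemma mollifier_tendsto:
  fixes f :: "'a::euclidean_space \<Rightarrow> 'b::{banach,second_countable_topology}"
  assumes f: "continuous_on UNIV f" and B: "\<And>x. norm (f x) \<le> B"
    and e: "\<And>n. e n > 0" "e \<longlonglongrightarrow> 0"
  shows "(\<lambda>n. LINT x|lborel. mollifier (e n) (t - x) *\<^sub>R f x) \<longlonglongrightarrow> f t"
proof -
  have [measurable]: "f \<in> borel_measurable borel"
    using f by (rule borel_measurable_continuous_onI)
  have sc: "(LINT x|lborel. mollifier (e n) (t - x) *\<^sub>R f x)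
     = (LINT u|lborel. mollifier 1 u *\<^sub>R f (t + e n *\<^sub>R u))" (is "?l = ?r") for n
  proof -
    have "?l = integral\<^sup>L (density (distr lborel borel (\<lambda>u. t + e n *\<^sub>R u)) (\<lambda>_. ennreal (\<bar>e n\<bar> ^ DIM('a))))
       (\<lambda>x. mollifier (e n) (t - x) *\<^sub>R f x)"
      using e(1)[of n] by (subst lborel_affine[of "e n" t]) (simp_all add: ennreal_power)
    also have "\<dots> = (LINT u|lborel. \<bar>e n\<bar> ^ DIM('a) *\<^sub>R (mollifier (e n) (- (e n *\<^sub>R u)) *\<^sub>R f (t + e n *\<^sub>R u)))"
      by (subst integral_density, simp, simp, simp, subst integral_distr) auto
    also have "\<dots> = ?r"
    proof (intro Bochner_Integration.integral_cong refl)
      fix u :: 'a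
      \<comment> \<open>The Jacobian of the scaling cancels against the power of \<open>e n\<close>
        in the normalisation of the mollifier.\<close>
      have "mollifier (e n) (- (e n *\<^sub>R u)) * \<bar>e n\<bar> ^ DIM('a) = mollifier 1 u"
        using e(1)[of n] by (simp add: mollifier_def gauss_def power2_eq_square power_mult_distrib)
      then show "\<bar>e n\<bar> ^ DIM('a) *\<^sub>R mollifier (e n) (- (e n *\<^sub>R u)) *\<^sub>R f (t + e n *\<^sub>R u) = mollifier 1 u *\<^sub>R f (t + e n *\<^sub>R u)"
        by (metis scaleR_scaleR mult.commute)
    qed
    finally show ?thesis .
  qed
  have im: "integrable lborel (\<lambda>u::'a. mollifier 1 u * B)"
    using integral_mollifier(1)[of 1, where 'a='a] by simp
  have "(\<lambda>n. LINT u|lborel. mollifier 1 u *\<^sub>R f (t + e n *\<^sub>R u)) \<longlonglongrightarrow> integral\<^sup>L lborel (\<lambda>u::'a. mollifier 1 u *\<^sub>R f t)"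
  proof (rule integral_dominated_convergence[where w="\<lambda>u::'a. mollifier 1 u * B"])
    show "AE u in lborel. (\<lambda>n. mollifier 1 u *\<^sub>R f (t + e n *\<^sub>R u)) \<longlonglongrightarrow> mollifier 1 u *\<^sub>R f t"
    proof (rule AE_I2)
      fix u
      have "(\<lambda>n. t + e n *\<^sub>R u) \<longlonglongrightarrow> t + 0 *\<^sub>R u"
        by (intro tendsto_intros e)
      then have "(\<lambda>n. f (t + e n *\<^sub>R u)) \<longlonglongrightarrow> f t"
        using f by (intro continuous_on_tendsto_compose[OF f]) auto
      then show "(\<lambda>n. mollifier 1 u *\<^sub>R f (t + e n *\<^sub>R u)) \<longlonglongrightarrow> mollifier 1 u *\<^sub>R f t"
        by (intro tendsto_intros)
    qed
    show "AE u in lborel. norm (mollifier 1 u *\<^sub>R f (t + e n *\<^sub>R u)) \<le> mollifier 1 u * B" for n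
      by (intro AE_I2) (auto simp: mollifier_nonneg intro!: mult_left_mono B)
  qed (use im in auto)
  then show ?thesis
    using integral_mollifier[of 1, where 'a='a] by (simp add: sc)
qed

section \<open>The inversion formula, regularised by Gaussians\<close>

definition inv_fourier :: "('a::euclidean_space \<Rightarrow> complex) \<Rightarrow> 'a \<Rightarrow> complex" where
  "inv_fourier \<Phi> x = (LINT y|lborel. \<Phi> y * cis (- (x \<bullet> y))) / (2 * pi) ^ DIM('a)"

definition char_fun :: "'a::euclidean_space measure \<Rightarrow> 'a \<Rightarrow> complex" where
  "char_fun \<mu> y = (LINT x|\<mu>. cis (x \<bullet> y))"

lemma char_fun_measurable:
  assumes "finite_measure \<mu>" and [measurable_cong]: "sets \<mu> = sets borel"
  shows "char_fun \<mu> \<in> borel_measurable borel"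
proof -
  interpret finite_measure \<mu> by fact
  show ?thesis unfolding char_fun_def by measurable
qed

lemma integral_gauss_kernel:
  fixes w :: "'a::euclidean_space"
  assumes "e > 0"
  shows "(LINT y|lborel. cis (w \<bullet> y) * gauss e y) / (2 * pi) ^ DIM('a) = mollifier e w"
proof -
  have "sqrt (2 * pi) ^ DIM('a) * sqrt (2 * pi) ^ DIM('a) = (2 * pi) ^ DIM('a)"
    unfolding power_mult_distrib[symmetric] by simp
  then have "(sqrt (2 * pi) / e) ^ DIM('a) * gauss (1 / e) w / (2 * pi) ^ DIM('a) = mollifier e w"
    using assms unfolding mollifier_def power_divide power_mult_distrib[of "sqrt (2 * pi)" e]
    by (simp add: field_simps)
  moreover have "(LINT y|lborel. cis (w \<bullet> y) * gauss e y) / (2 * pi) ^ DIM('a)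
     = complex_of_real ((sqrt (2 * pi) / e) ^ DIM('a) * gauss (1 / e) w / (2 * pi) ^ DIM('a))"
    using gauss_fourier(2)[OF assms, of w] by (simp add: inner_commute)
  ultimately show ?thesis by simp
qed

text \<open>The Gaussian factor makes the double integral absolutely convergent even if
  \<open>char_fun \<mu>\<close> is not integrable. Integrating over \<open>y\<close> first leaves
  the mollifier, so the regularised inverse transform is \<open>\<mu>\<close> smoothed at scale
  \<open>e\<close>.\<close>

lemma inv_fourier_char_fun_gauss:
  fixes \<mu> :: "'a::euclidean_space measure"
  assumes "finite_measure \<mu>" and [measurable_cong]: "sets \<mu> = sets borel" and "e > 0"
  shows "inv_fourier (\<lambda>y. char_fun \<mu> y * gauss e y) x = (LINT t|\<mu>. mollifier e (t - x))"
proof -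
  interpret finite_measure \<mu> by fact
  interpret pair_sigma_finite lborel \<mu> ..
  have "integrable (lborel \<Otimes>\<^sub>M \<mu>) (\<lambda>(y, t). cis ((t - x) \<bullet> y) * complex_of_real (gauss e y))"
  proof (rule Fubini_integrable)
    have "integrable lborel (\<lambda>y::'a. measure \<mu> (space \<mu>) * gauss e y)"
      using integrable_gauss[OF \<open>e > 0\<close>] by (rule integrable_mult_right)
    then show "integrable lborel (\<lambda>y. LINT t|\<mu>. norm (case (y, t) of (y, t) \<Rightarrow> cis ((t - x) \<bullet> y) * complex_of_real (gauss e y)))"
      by (simp add: norm_mult gauss_pos[THEN less_imp_le])
  next
    show "AE y in lborel. integrable \<mu> (\<lambda>t. case (y, t) of (y, t) \<Rightarrow> cis ((t - x) \<bullet> y) * complex_of_real (gauss e y))"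
      by (intro AE_I2 integrable_const_bound[where B = 1]) (auto simp: norm_mult gauss_pos[THEN less_imp_le] gauss_le_1)
  qed simp
  then have "(LINT t|\<mu>. LINT y|lborel. cis ((t - x) \<bullet> y) * gauss e y)
    = (LINT y|lborel. LINT t|\<mu>. cis ((t - x) \<bullet> y) * gauss e y)"
    by (rule Fubini_integral)
  also have "\<dots> = (LINT y|lborel. (char_fun \<mu> y * gauss e y) * cis (- (x \<bullet> y)))"
  proof -
    have "cis ((t - x) \<bullet> y) * complex_of_real (gauss e y)
       = cis (t \<bullet> y) * (complex_of_real (gauss e y) * cis (- (x \<bullet> y)))" for t y
      by (simp add: inner_diff_left cis_mult)
    then show ?thesis by (simp only: integral_mult_left_zero char_fun_def mult.assoc)
  qed
  finally have "inv_fourier (\<lambda>y. char_fun \<mu> y * gauss e y) x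
     = (LINT t|\<mu>. (LINT y|lborel. cis ((t - x) \<bullet> y) * gauss e y) / (2 * pi) ^ DIM('a))"
    by (simp add: inv_fourier_def)
  then show ?thesis
    by (simp only: integral_gauss_kernel[OF \<open>e > 0\<close>] integral_complex_of_real)
qed

lemma gauss_tendsto_1: 
  assumes "e \<longlonglongrightarrow> 0"
  shows "(\<lambda>n. gauss (e n) x) \<longlonglongrightarrow> 1"
proof -
  have "(\<lambda>n. exp (- ((e n)\<^sup>2 * (x \<bullet> x)) / 2)) \<longlonglongrightarrow> exp (- (0\<^sup>2 * (x \<bullet> x)) / 2)"
    by (intro tendsto_intros assms) auto
  then show ?thesis by (simp add: gauss_def)
qed

lemma integrable_mult_cis:
  "integrable M f \<Longrightarrow> g \<in> borel_measurable M \<Longrightarrow> integrable M (\<lambda>y. f y * cis (g y))"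
  by (rule Bochner_Integration.integrable_bound[of M f]) (auto simp: norm_mult)

lemma inv_fourier_gauss_tendsto:
  fixes \<Phi> :: "'a::euclidean_space \<Rightarrow> complex"
  assumes "integrable lborel \<Phi>" "e \<longlonglongrightarrow> 0"
  shows "(\<lambda>n. inv_fourier (\<lambda>y. \<Phi> y * gauss (e n) y) x) \<longlonglongrightarrow> inv_fourier \<Phi> x"
proof -
  have [measurable]: "\<Phi> \<in> borel_measurable borel" using assms(1) by auto
  have "(\<lambda>n. LINT y|lborel. \<Phi> y * gauss (e n) y * cis (- (x \<bullet> y))) \<longlonglongrightarrow> (LINT y|lborel. \<Phi> y * cis (- (x \<bullet> y)))"
  proof (rule integral_dominated_convergence[where w = "\<lambda>y. norm (\<Phi> y)"])
    show "AE y in lborel. (\<lambda>n. \<Phi> y * gauss (e n) y * cis (- (x \<bullet> y))) \<longlonglongrightarrow> \<Phi> y * cis (- (x \<bullet> y))"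
    proof (rule AE_I2)
      fix y
      have "(\<lambda>n. \<Phi> y * of_real (gauss (e n) y) * cis (- (x \<bullet> y))) \<longlonglongrightarrow> \<Phi> y * of_real 1 * cis (- (x \<bullet> y))"
        by (intro tendsto_intros gauss_tendsto_1 assms)
      then show "(\<lambda>n. \<Phi> y * gauss (e n) y * cis (- (x \<bullet> y))) \<longlonglongrightarrow> \<Phi> y * cis (- (x \<bullet> y))" by simp
    qed
  qed (use assms(1) in \<open>auto simp: norm_mult gauss_pos[THEN less_imp_le] intro!: mult_left_le gauss_le_1\<close>)
  then show ?thesis
    unfolding inv_fourier_def by (intro tendsto_divide) auto
qed

lemma inv_fourier_norm_le:
  "norm (inv_fourier \<Phi> x) \<le> (LINT y|lborel. norm (\<Phi> y)) / (2 * pi) ^ DIM('a)" for x :: "'a::euclidean_space"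
proof -
  have "norm (LINT y|lborel. \<Phi> y * cis (- (x \<bullet> y))) \<le> (LINT y|lborel. norm (\<Phi> y * cis (- (x \<bullet> y))))"
    by (rule integral_norm_bound)
  then show ?thesis
    by (simp add: inv_fourier_def norm_divide norm_power norm_mult divide_right_mono)
qed

lemma inv_fourier_measurable [measurable]:
  assumes [measurable]: "\<Phi> \<in> borel_measurable borel"
  shows "inv_fourier \<Phi> \<in> borel_measurable borel"
  unfolding inv_fourier_def by measurable

lemma inv_fourier_diff:
  fixes \<Phi> \<Psi> :: "'a::euclidean_space \<Rightarrow> complex"
  assumes "integrable lborel \<Phi>" "integrable lborel \<Psi>"
  shows "inv_fourier \<Phi> x - inv_fourier \<Psi> x = inv_fourier (\<lambda>y. \<Phi> y - \<Psi> y) x"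
  unfolding inv_fourier_def using assms
  by (simp add: integrable_mult_cis left_diff_distrib diff_divide_distrib)

text \<open>Every regularised inverse transform is an average of the real nonnegative mollifier, and
  both properties pass to the limit as the regularisation is removed.\<close>

lemma inv_fourier_char_fun_nonneg:
  fixes \<mu> :: "'a::euclidean_space measure"
  assumes "finite_measure \<mu>" and "sets \<mu> = sets borel" and "integrable lborel (char_fun \<mu>)"
  shows "Re (inv_fourier (char_fun \<mu>) x) \<ge> 0" "Im (inv_fourier (char_fun \<mu>) x) = 0"
proof -
  have e: "(\<lambda>n. 1 / real (Suc n)) \<longlonglongrightarrow> 0"
    by (rule LIMSEQ_inverse_real_of_nat[unfolded inverse_eq_divide])
  have l: "(\<lambda>n. inv_fourier (\<lambda>y. char_fun \<mu> y * gauss (1 / real (Suc n)) y) x) \<longlonglongrightarrow> inv_fourier (char_fun \<mu>) x"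
    by (rule inv_fourier_gauss_tendsto[OF assms(3) e])
  have eq: "inv_fourier (\<lambda>y. char_fun \<mu> y * gauss (1 / real (Suc n)) y) x = (LINT t|\<mu>. mollifier (1 / real (Suc n)) (t - x))" for n
    by (intro inv_fourier_char_fun_gauss assms) auto
  have "(LINT t|\<mu>. mollifier (1 / real (Suc n)) (t - x)) \<ge> 0" for n
    by (intro Bochner_Integration.integral_nonneg mollifier_nonneg) auto
  then show "Re (inv_fourier (char_fun \<mu>) x) \<ge> 0"
    using tendsto_Re[OF l] unfolding eq by (intro tendsto_lowerbound[where f = "\<lambda>n. (LINT t|\<mu>. mollifier (1 / real (Suc n)) (t - x))"]) auto
  show "Im (inv_fourier (char_fun \<mu>) x) = 0"
    using tendsto_Im[OF l] unfolding eq by (simp add: LIMSEQ_const_iff)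
qed

text \<open>For the regularised transform this is Fubini with the mollifier as kernel. In the limit
  the integrability of \<open>f\<close> provides the majorant on the Lebesgue side, whereas on the
  side of \<open>\<mu>\<close> the smoothed \<open>f\<close> stays below \<open>B\<close> and tends
  to \<open>f\<close> by continuity.\<close>

lemma integral_inv_fourier_char_fun:
  fixes \<mu> :: "'a::euclidean_space measure" and f :: "'a \<Rightarrow> real"
  assumes \<mu>: "finite_measure \<mu>" and s [measurable_cong]: "sets \<mu> = sets borel"
    and i: "integrable lborel (char_fun \<mu>)"
    and f: "continuous_on UNIV f" "integrable lborel f" and B: "\<And>x. \<bar>f x\<bar> \<le> B"
  shows "(LINT x|lborel. f x * Re (inv_fourier (char_fun \<mu>) x)) = (LINT x|\<mu>. f x)"
    and "integrable lborel (\<lambda>x. f x * Re (inv_fourier (char_fun \<mu>) x))"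
proof -
  interpret finite_measure \<mu> by fact
  interpret pair_sigma_finite lborel \<mu> ..
  have [measurable]: "f \<in> borel_measurable borel"
    using f(1) by (rule borel_measurable_continuous_onI)
  note char_fun_measurable[OF \<mu> s, measurable]
  define e where "e n = 1 / real (Suc n)" for n
  have e: "e \<longlonglongrightarrow> 0" "\<And>n. e n > 0"
    unfolding e_def using LIMSEQ_inverse_real_of_nat[unfolded inverse_eq_divide] by auto
  define T where "T n x = Re (inv_fourier (\<lambda>y. char_fun \<mu> y * gauss (e n) y) x)" for n x
  define C where "C = (LINT y|lborel. norm (char_fun \<mu> y)) / (2 * pi) ^ DIM('a)"
  have [measurable]: "T n \<in> borel_measurable borel" for n
    unfolding T_def by measurable
  have T: "T n x = (LINT t|\<mu>. mollifier (e n) (t - x))" for n x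
    unfolding T_def by (subst inv_fourier_char_fun_gauss[OF \<mu> s]) (auto simp: e)
  have Tb: "\<bar>T n x\<bar> \<le> C" for n x
  proof -
    have "\<bar>T n x\<bar> \<le> norm (inv_fourier (\<lambda>y. char_fun \<mu> y * gauss (e n) y) x)"
      unfolding T_def by (rule abs_Re_le_cmod)
    also have "\<dots> \<le> (LINT y|lborel. norm (char_fun \<mu> y * gauss (e n) y)) / (2 * pi) ^ DIM('a)"
      by (rule inv_fourier_norm_le)
    also have "\<dots> \<le> C"
      unfolding C_def 
    proof (intro divide_right_mono integral_mono)
      have "integrable lborel (\<lambda>y. char_fun \<mu> y * gauss (e n) y)"
        by (rule Bochner_Integration.integrable_bound[OF i])
          (auto simp: norm_mult gauss_pos[THEN less_imp_le] intro!: mult_left_le gauss_le_1)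
      then show "integrable lborel (\<lambda>y. norm (char_fun \<mu> y * gauss (e n) y))"
        by (rule integrable_norm)
    qed (use i in \<open>auto simp: norm_mult gauss_pos[THEN less_imp_le] intro!: mult_left_le gauss_le_1\<close>)
    finally show ?thesis .
  qed
  have lim: "(\<lambda>n. T n x) \<longlonglongrightarrow> Re (inv_fourier (char_fun \<mu>) x)" for x
    unfolding T_def by (intro tendsto_Re inv_fourier_gauss_tendsto[OF i e(1)])
  have w: "integrable lborel (\<lambda>x. \<bar>f x\<bar> * C)" using f(2) by (intro integrable_mult_left) auto
  have lim2: "AE x in lborel. (\<lambda>n. f x * T n x) \<longlonglongrightarrow> f x * Re (inv_fourier (char_fun \<mu>) x)"
    by (intro AE_I2 tendsto_intros lim)
  have bd: "AE x in lborel. norm (f x * T n x) \<le> \<bar>f x\<bar> * C" for n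
    by (intro AE_I2) (auto simp: abs_mult intro!: mult_left_mono Tb)
  show "integrable lborel (\<lambda>x. f x * Re (inv_fourier (char_fun \<mu>) x))"
    by (rule integrable_dominated_convergence[OF _ _ w lim2 bd]) auto
  have l1: "(\<lambda>n. LINT x|lborel. f x * T n x) \<longlonglongrightarrow> (LINT x|lborel. f x * Re (inv_fourier (char_fun \<mu>) x))"
    by (rule integral_dominated_convergence[OF _ _ w lim2 bd]) auto
  have eq: "(LINT x|lborel. f x * T n x) = (LINT t|\<mu>. LINT x|lborel. mollifier (e n) (t - x) *\<^sub>R f x)" for n
  proof -
    define D where "D = 1 / (sqrt (2 * pi) * e n) ^ DIM('a)"
    have mb: "norm (mollifier (e n) z) \<le> D" for z :: 'a
      unfolding D_def by (rule mollifier_bound[OF e(2)])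
    then have D: "D \<ge> 0" by (meson norm_ge_zero order_trans)
    have bnd: "norm (mollifier (e n) (t - x) * f x) \<le> D * \<bar>f x\<bar>" for t x
      unfolding norm_mult real_norm_def[of "f x"] by (intro mult_right_mono mb) auto
    have mi: "integrable \<mu> (\<lambda>t. mollifier (e n) (t - x) * f x)" for x
      by (rule integrable_const_bound[where B = "D * \<bar>f x\<bar>"]) (use bnd in auto)
    have "integrable (lborel \<Otimes>\<^sub>M \<mu>) (\<lambda>(x, t). mollifier (e n) (t - x) * f x)"
    proof (rule Fubini_integrable)
      have wi: "integrable lborel (\<lambda>x::'a. (D * \<bar>f x\<bar>) * measure \<mu> (space \<mu>))"
        using f(2) by (intro integrable_mult_left integrable_mult_right) auto
      show "integrable lborel (\<lambda>x. LINT t|\<mu>. norm (case (x, t) of (x, t) \<Rightarrow> mollifier (e n) (t - x) * f x))"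
      proof (rule Bochner_Integration.integrable_bound[OF wi], measurable, rule AE_I2)
        fix x
        have "(LINT t|\<mu>. norm (mollifier (e n) (t - x) * f x)) \<le> (LINT t|\<mu>. D * \<bar>f x\<bar>)"
          by (intro integral_mono integrable_norm mi bnd) auto
        moreover have "(LINT t|\<mu>. norm (mollifier (e n) (t - x) * f x)) \<ge> 0" by simp
        ultimately show "norm (LINT t|\<mu>. norm (case (x, t) of (x, t) \<Rightarrow> mollifier (e n) (t - x) * f x)) \<le> norm (D * \<bar>f x\<bar> * measure \<mu> (space \<mu>))"
          by (simp add: abs_mult D mult_ac)
      qed
    qed (use mi in auto)
    then have "(LINT t|\<mu>. LINT x|lborel. mollifier (e n) (t - x) * f x)
      = (LINT x|lborel. LINT t|\<mu>. mollifier (e n) (t - x) * f x)"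
      by (rule Fubini_integral)
    then show ?thesis by (simp add: T mult.commute)
  qed
  have "(\<lambda>n. LINT t|\<mu>. LINT x|lborel. mollifier (e n) (t - x) *\<^sub>R f x) \<longlonglongrightarrow> (LINT t|\<mu>. f t)"
  proof (rule integral_dominated_convergence[where w = "\<lambda>_. B"])
    show "AE t in \<mu>. norm (LINT x|lborel. mollifier (e n) (t - x) *\<^sub>R f x) \<le> B" for n
    proof (rule AE_I2)
      fix t :: 'a
      have r: "integrable lborel (\<lambda>x. mollifier (e n) (t - x))" "(LINT x|lborel. mollifier (e n) (t - x)) = 1"
      proof -
        \<comment> \<open>The mollifier is even, so the reflection disappears and translation
          invariance of \<open>lborel\<close> suffices.\<close>
        have ml: "mollifier (e n) (t - x) = mollifier (e n) (x - t)" for x  :: 'a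
          by (simp add: mollifier_def gauss_def inner_diff inner_commute)
        have "lborel = density (distr lborel borel (\<lambda>u. t + 1 *\<^sub>R u)) (\<lambda>_. ennreal (\<bar>1\<bar> ^ DIM('a)))"
          by (subst lborel_affine[of 1 t]) auto
        then have lb: "lborel = distr lborel borel (\<lambda>u. t + u)"
          by (simp add: density_1)
        show "integrable lborel (\<lambda>x. mollifier (e n) (t - x))"
          unfolding ml by (subst lb, subst integrable_distr_eq) (auto simp: integral_mollifier e)
        show "(LINT x|lborel. mollifier (e n) (t - x)) = 1"
          unfolding ml by (subst lb, subst integral_distr) (auto simp: integral_mollifier e)
      qed
      have "norm (LINT x|lborel. mollifier (e n) (t - x) *\<^sub>R f x) \<le> (LINT x|lborel. norm (mollifier (e n) (t - x) *\<^sub>R f x))"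
        by (rule integral_norm_bound)
      also have "\<dots> \<le> (LINT x|lborel. mollifier (e n) (t - x) * B)"
      proof (rule integral_mono_AE')
        show "integrable lborel (\<lambda>x. mollifier (e n) (t - x) * B)" using r(1) by (rule integrable_mult_left)
        have "B \<ge> 0" using B[of undefined] by linarith
        then show "AE x in lborel. 0 \<le> mollifier (e n) (t - x) * B"
          by (intro AE_I2 mult_nonneg_nonneg mollifier_nonneg e)
      qed (auto simp: abs_mult mollifier_nonneg e intro!: mult_left_mono B)
      also have "\<dots> = B" using r by simp
      finally show "norm (LINT x|lborel. mollifier (e n) (t - x) *\<^sub>R f x) \<le> B" .
    qed
    show "AE t in \<mu>. (\<lambda>n. LINT x|lborel. mollifier (e n) (t - x) *\<^sub>R f x) \<longlonglongrightarrow> f t"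
      by (intro AE_I2 mollifier_tendsto[where B=B] f e) (auto simp: B)
  qed auto
  with l1 show "(LINT x|lborel. f x * Re (inv_fourier (char_fun \<mu>) x)) = (LINT x|\<mu>. f x)"
    unfolding eq by (rule LIMSEQ_unique)
qed

text \<open>Open boxes form a generator of the Borel sets that is stable under intersections, and
  the indicator of a box is the increasing limit of the continuous functions
  \<open>min 1 (k * infdist x (- box a b))\<close>, which vanish off the bounded box and are
  therefore integrable.\<close>

lemma measure_eq_density_if_test_functions:
  fixes \<mu> :: "'a::euclidean_space measure" and g :: "'a \<Rightarrow> real"
  assumes \<mu>: "finite_measure \<mu>" and s [measurable_cong]: "sets \<mu> = sets borel"
    and g [measurable]: "g \<in> borel_measurable borel" and g0: "\<And>x. g x \<ge> 0"
    and eq: "\<And>f :: 'a \<Rightarrow> real. continuous_on UNIV f \<Longrightarrow> integrable lborel f \<Longrightarrow> (\<And>x. 0 \<le> f x \<and> f x \<le> 1) \<Longrightarrow>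
       integrable lborel (\<lambda>x. f x * g x) \<and> (LINT x|lborel. f x * g x) = (LINT x|\<mu>. f x)"
  shows "\<mu> = density lborel (\<lambda>x. ennreal (g x))"
proof -
  interpret finite_measure \<mu> by fact
  have box: "emeasure \<mu> (box a b) = emeasure (density lborel (\<lambda>x. ennreal (g x))) (box a b)" for a b :: 'a
  proof -
    define f where "f k x = min 1 (real k * infdist x (- box a b))" for k x
    have f1: "0 \<le> f k x \<and> f k x \<le> 1" for k x
      by (simp add: f_def infdist_nonneg)
    have f0: "f k x = 0" if "x \<notin> box a b" for k x
      using that by (simp add: f_def infdist_zero)
    have fc: "continuous_on UNIV (f k)" for k
      unfolding f_def by (intro continuous_intros)
    have [measurable]: "f k \<in> borel_measurable borel" for k
      using fc by (rule borel_measurable_continuous_onI)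
    have fi: "integrable lborel (f k)" for k
    proof (rule Bochner_Integration.integrable_bound)
      show "integrable lborel (indicator (box a b) :: 'a \<Rightarrow> real)"
        by (rule integrable_real_indicator) (use emeasure_bounded_finite[OF bounded_box[of a b]] in auto)
      show "AE x in lborel. norm (f k x) \<le> norm (indicator (box a b) x :: real)"
        by (rule AE_I2) (use f0 f1 in \<open>auto simp: indicator_def\<close>)
    qed measurable
    have inc: "incseq f"
      unfolding f_def by (intro incseq_SucI le_funI min.mono mult_right_mono) (auto simp: infdist_nonneg)
    have lim: "(\<lambda>k. f k x) \<longlonglongrightarrow> indicator (box a b) x" for x
    proof (cases "x \<in> box a b")
      case True
      \<comment> \<open>Nonemptiness matters because \<open>infdist\<close> to the empty set is 0 by
        definition, which would make all the test functions vanish.\<close>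
      have "- box a b \<noteq> {}" using bounded_box[of a b] not_bounded_UNIV[where 'a='a] by (metis double_compl compl_bot_eq)
      moreover have "closed (- box a b)" by (intro closed_Compl open_box)
      ultimately have d: "infdist x (- box a b) > 0"
        using True in_closed_iff_infdist_zero[of "- box a b" x] infdist_nonneg[of x "- box a b"] by fastforce
      obtain K where K: "real K * infdist x (- box a b) > 1"
        using reals_Archimedean3[OF d] by blast
      have "f k x = 1" if "k \<ge> K" for k
      proof -
        have "real K * infdist x (- box a b) \<le> real k * infdist x (- box a b)"
          using that d by (intro mult_right_mono) auto
        then show ?thesis using K by (simp add: f_def)
      qed
      then have "eventually (\<lambda>k. f k x = 1) sequentially" by (auto simp: eventually_sequentially)
      then show ?thesis using True by (simp add: tendsto_eventually)
    qed (simp add: f0)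
    have inc': "incseq (\<lambda>k x. ennreal (f k x))"
      using inc by (auto simp: mono_def le_fun_def intro!: ennreal_leI)
    have lim': "(\<lambda>k. ennreal (f k x)) \<longlonglongrightarrow> indicator (box a b) x" for x
      using tendsto_ennrealI[OF lim[of x]] by (simp add: ennreal_indicator)
    have l1: "(\<lambda>k. \<integral>\<^sup>+x. f k x \<partial>\<mu>) \<longlonglongrightarrow> (\<integral>\<^sup>+x. indicator (box a b) x \<partial>\<mu>)"
      by (rule nn_integral_LIMSEQ[OF inc' _ lim']) measurable
    have l2: "(\<lambda>k. \<integral>\<^sup>+x. f k x \<partial>(density lborel g)) \<longlonglongrightarrow> (\<integral>\<^sup>+x. indicator (box a b) x \<partial>(density lborel g))"
      by (rule nn_integral_LIMSEQ[OF inc' _ lim']) measurable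
    have "(\<integral>\<^sup>+x. f k x \<partial>\<mu>) = (\<integral>\<^sup>+x. f k x \<partial>(density lborel g))" for k
    proof -
      note e = eq[OF fc fi f1, of k]
      have "integrable \<mu> (f k)"
        by (rule integrable_const_bound[where B=1]) (use f1 in auto)
      then have "(\<integral>\<^sup>+x. f k x \<partial>\<mu>) = ennreal (LINT x|\<mu>. f k x)"
        using f1 by (intro nn_integral_eq_integral) auto
      also have "\<dots> = ennreal (LINT x|lborel. f k x * g x)"
        using e by simp
      also have "\<dots> = (\<integral>\<^sup>+x. f k x * g x \<partial>lborel)"
        using e f1 g0 by (intro nn_integral_eq_integral[symmetric]) auto
      also have "\<dots> = (\<integral>\<^sup>+x. f k x \<partial>(density lborel g))"
        using f1 g0 by (subst nn_integral_density) (auto simp: ennreal_mult mult.commute intro!: nn_integral_cong)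
      finally show ?thesis .
    qed
    then have "(\<integral>\<^sup>+x. indicator (box a b) x \<partial>\<mu>) = (\<integral>\<^sup>+x. indicator (box a b) x \<partial>(density lborel g))"
      by (intro LIMSEQ_unique[OF l1]) (simp only: l2)
    then show ?thesis by (simp add: s)
  qed
  show ?thesis
  proof (rule measure_eqI_generator_eq)
    let ?E = "range (\<lambda>(a, b). box a b :: 'a set)"
    show "Int_stable ?E"
      by (auto simp: Int_stable_def box_Int_box)
    show "?E \<subseteq> Pow UNIV" "sets \<mu> = sigma_sets UNIV ?E"
      "sets (density lborel (\<lambda>x. ennreal (g x))) = sigma_sets UNIV ?E"
      by (simp_all add: borel_eq_box s)
    let ?A = "\<lambda>n::nat. box (- (real n *\<^sub>R One)) (real n *\<^sub>R One) :: 'a set"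
    show "range ?A \<subseteq> ?E" "(\<Union>i. ?A i) = UNIV"
      unfolding UN_box_eq_UNIV by auto
    show "emeasure \<mu> (?A i) \<noteq> \<infinity>" for i by simp
    show "emeasure \<mu> X = emeasure (density lborel (\<lambda>x. ennreal (g x))) X" if "X \<in> ?E" for X
      using that box by auto
  qed
qed

lemma has_density_inv_fourier:
  fixes \<mu> :: "'a::euclidean_space measure"
  assumes \<mu>: "finite_measure \<mu>" "sets \<mu> = sets borel" and i: "integrable lborel (char_fun \<mu>)"
  shows "has_density \<mu> (\<lambda>x. Re (inv_fourier (char_fun \<mu>) x))"
proof -
  note char_fun_measurable[OF \<mu>, measurable]
  have m: "(\<lambda>x. Re (inv_fourier (char_fun \<mu>) x)) \<in> borel_measurable borel" by measurable
  have nn: "Re (inv_fourier (char_fun \<mu>) x) \<ge> 0" for x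
    by (rule inv_fourier_char_fun_nonneg[OF \<mu> i])
  have eq: "\<mu> = density lborel (\<lambda>x. ennreal (Re (inv_fourier (char_fun \<mu>) x)))"
  proof (rule measure_eq_density_if_test_functions[OF \<mu> m nn])
    fix f :: "'a \<Rightarrow> real"
    assume f: "continuous_on UNIV f" "integrable lborel f" "\<And>x. 0 \<le> f x \<and> f x \<le> 1"
    then have B: "\<And>x. \<bar>f x\<bar> \<le> 1" by auto
    show "integrable lborel (\<lambda>x. f x * Re (inv_fourier (char_fun \<mu>) x)) \<and>
       (LINT x|lborel. f x * Re (inv_fourier (char_fun \<mu>) x)) = (LINT x|\<mu>. f x)"
      using integral_inv_fourier_char_fun[OF \<mu> i f(1,2) B] by auto
  qed
  have "absolutely_continuous lborel (density lborel (\<lambda>x. ennreal (Re (inv_fourier (char_fun \<mu>) x))))"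
    by (rule absolutely_continuousI_density) (use m in measurable)
  with eq have "absolutely_continuous lborel \<mu>" by simp
  with m nn eq show ?thesis unfolding has_density_def by blast
qed

section \<open>Regularity of inverse Fourier transforms\<close>

lemma norm_cis_minus_1_le: "norm (cis b - 1) \<le> \<bar>b\<bar>"
proof -
  have "norm (cis b - 1) = 2 * \<bar>sin (b / 2)\<bar>"
    using dist_exp_i_1[of b] by (simp add: cis_conv_exp)
  also have "\<dots> \<le> \<bar>b\<bar>" using abs_sin_x_le_abs_x[of "b / 2"] by simp
  finally show ?thesis .
qed

lemma continuous_inv_fourier:
  fixes \<Phi> :: "'a::euclidean_space \<Rightarrow> complex"
  assumes "integrable lborel \<Phi>"
  shows "continuous_on UNIV (inv_fourier \<Phi>)"
proof -
  have [measurable]: "\<Phi> \<in> borel_measurable borel" using assms by auto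
  have "(\<lambda>n. inv_fourier \<Phi> (X n)) \<longlonglongrightarrow> inv_fourier \<Phi> x" if X: "X \<longlonglongrightarrow> x" for X x
    unfolding inv_fourier_def
  proof (intro tendsto_divide tendsto_const integral_dominated_convergence[where w = "\<lambda>y. norm (\<Phi> y)"])
    show "AE y in lborel. (\<lambda>n. \<Phi> y * cis (- (X n \<bullet> y))) \<longlonglongrightarrow> \<Phi> y * cis (- (x \<bullet> y))"
      by (intro AE_I2 tendsto_intros X)
  qed (use assms in \<open>auto simp: norm_mult\<close>)
  then show ?thesis
    by (simp add: continuous_on_sequentially o_def)
qed

text \<open>The difference quotient of the phase is bounded by
  \<open>\<bar>v \<bullet> y\<bar>\<close>, so the integrability of the differentiated integrand
  supplies the majorant. The limit is taken along arbitrary null sequences because dominated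
  convergence is sequential.\<close>

lemma DERIV_inv_fourier:
  fixes \<Phi> :: "'a::euclidean_space \<Rightarrow> complex"
  assumes i: "integrable lborel \<Phi>" and i': "integrable lborel (\<lambda>y. - \<i> * (y \<bullet> v) * \<Phi> y)"
  shows "((\<lambda>t. Re (inv_fourier \<Phi> (x + t *\<^sub>R v))) has_field_derivative
     Re (inv_fourier (\<lambda>y. - \<i> * (y \<bullet> v) * \<Phi> y) x)) (at 0)"
proof -
  have [measurable]: "\<Phi> \<in> borel_measurable borel" using assms by auto
  have lim: "(\<lambda>n. (inv_fourier \<Phi> (x + h n *\<^sub>R v) - inv_fourier \<Phi> x) / h n) \<longlonglongrightarrow> inv_fourier (\<lambda>y. - \<i> * (y \<bullet> v) * \<Phi> y) x"
    if h: "h \<longlonglongrightarrow> 0" "\<And>n. h n \<noteq> 0" for h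
  proof -
    define q where "q n y = \<Phi> y * cis (- (x \<bullet> y)) * ((cis (- (h n * (v \<bullet> y))) - 1) / h n)" for n y
    have q: "(\<Phi> y * cis (- ((x + h n *\<^sub>R v) \<bullet> y)) - \<Phi> y * cis (- (x \<bullet> y))) / h n = q n y" for n y
    proof -
      have "cis (- ((x + h n *\<^sub>R v) \<bullet> y)) = cis (- (x \<bullet> y)) * cis (- (h n * (v \<bullet> y)))"
        by (simp add: cis_mult inner_add_left)
      then show ?thesis using h(2)[of n] by (simp add: q_def field_simps)
    qed
    have "(\<lambda>n. LINT y|lborel. q n y) \<longlonglongrightarrow> (LINT y|lborel. (- \<i> * (y \<bullet> v) * \<Phi> y) * cis (- (x \<bullet> y)))"
    proof (rule integral_dominated_convergence[where w = "\<lambda>y. norm (- \<i> * (y \<bullet> v) * \<Phi> y)"])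
      show "AE y in lborel. (\<lambda>n. q n y) \<longlonglongrightarrow> (- \<i> * (y \<bullet> v) * \<Phi> y) * cis (- (x \<bullet> y))"
      proof (rule AE_I2)
        fix y
        define c where "c = - \<i> * complex_of_real (v \<bullet> y)"
        have "((\<lambda>z. exp (z * c)) has_field_derivative c) (at 0)"
          by (auto intro!: derivative_eq_intros)
        then have "((\<lambda>z. (exp (z * c) - 1) / z) \<longlongrightarrow> c) (at 0)"
          by (simp add: DERIV_def)
        moreover have "(\<lambda>n. complex_of_real (h n)) \<longlonglongrightarrow> 0"
          using tendsto_of_real[OF h(1), where 'a = complex] by simp
        ultimately have "(\<lambda>n. (exp (of_real (h n) * c) - 1) / of_real (h n)) \<longlonglongrightarrow> c"
          using h(2) unfolding tendsto_at_iff_sequentially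
          by (auto simp: o_def dest!: spec[of _ "\<lambda>n. complex_of_real (h n)"])
        moreover have "exp (of_real (h n) * c) = cis (- (h n * (v \<bullet> y)))" for n
          by (simp add: cis_conv_exp c_def mult_ac)
        ultimately have "(\<lambda>n. (cis (- (h n * (v \<bullet> y))) - 1) / h n) \<longlonglongrightarrow> c" by simp
        then have "(\<lambda>n. q n y) \<longlonglongrightarrow> \<Phi> y * cis (- (x \<bullet> y)) * c"
          unfolding q_def by (intro tendsto_intros)
        then show "(\<lambda>n. q n y) \<longlonglongrightarrow> (- \<i> * (y \<bullet> v) * \<Phi> y) * cis (- (x \<bullet> y))"
          by (simp add: c_def mult_ac inner_commute)
      qed
      show "AE y in lborel. norm (q n y) \<le> norm (- \<i> * (y \<bullet> v) * \<Phi> y)" for n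
      proof (rule AE_I2)
        fix y
        have "norm ((cis (- (h n * (v \<bullet> y))) - 1) / h n) \<le> \<bar>v \<bullet> y\<bar>"
          using norm_cis_minus_1_le[of "- (h n * (v \<bullet> y))"] h(2)[of n]
          by (simp add: norm_divide divide_simps abs_mult mult.commute)
        then have "norm (\<Phi> y) * norm ((cis (- (h n * (v \<bullet> y))) - 1) / h n) \<le> norm (\<Phi> y) * \<bar>v \<bullet> y\<bar>"
          by (rule mult_left_mono) simp
        then show "norm (q n y) \<le> norm (- \<i> * (y \<bullet> v) * \<Phi> y)"
          by (simp add: q_def norm_mult inner_commute mult.commute flip: times_divide_eq_right)
      qed
    qed (use i' in \<open>auto simp: q_def\<close>)
    then have "(\<lambda>n. (LINT y|lborel. q n y) / (2 * pi) ^ DIM('a)) \<longlonglongrightarrow> inv_fourier (\<lambda>y. - \<i> * (y \<bullet> v) * \<Phi> y) x"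
      unfolding inv_fourier_def by (intro tendsto_intros) auto
    moreover have "(inv_fourier \<Phi> (x + h n *\<^sub>R v) - inv_fourier \<Phi> x) / h n = (LINT y|lborel. q n y) / (2 * pi) ^ DIM('a)" for n
      unfolding q[symmetric] inv_fourier_def using i
      by (simp add: integrable_mult_cis diff_divide_distrib mult.commute)
    ultimately show ?thesis by simp
  qed
  have "(\<lambda>n. Re ((inv_fourier \<Phi> (x + h n *\<^sub>R v) - inv_fourier \<Phi> x) / h n)) \<longlonglongrightarrow> Re (inv_fourier (\<lambda>y. - \<i> * (y \<bullet> v) * \<Phi> y) x)"
    if h: "h \<longlonglongrightarrow> 0" "\<And>n. h n \<noteq> 0" for h
    by (intro tendsto_Re lim h)
  then show ?thesis
    by (auto simp: DERIV_def tendsto_at_iff_sequentially o_def)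
qed

lemma partial_deriv_inv_fourier:
  fixes \<Phi> :: "'a::euclidean_space \<Rightarrow> complex"
  assumes "integrable lborel \<Phi>" and "integrable lborel (\<lambda>y. - \<i> * (y \<bullet> v) * \<Phi> y)"
  shows "partial_deriv v (\<lambda>x. Re (inv_fourier \<Phi> x)) = (\<lambda>x. Re (inv_fourier (\<lambda>y. - \<i> * (y \<bullet> v) * \<Phi> y) x))"
  unfolding partial_deriv_def fun_eq_iff
  using DERIV_imp_deriv[OF DERIV_inv_fourier[OF assms]] by blast

text \<open>\<open>decaying k \<Phi>\<close> makes \<open>k\<close> differentiations under the integral sign legitimate.\<close>

definition decaying :: "nat \<Rightarrow> ('a::euclidean_space \<Rightarrow> complex) \<Rightarrow> bool" where
  "decaying k \<Phi> \<longleftrightarrow> \<Phi> \<in> borel_measurable borel \<and> integrable lborel (\<lambda>y. (1 + norm y) ^ k * norm (\<Phi> y))"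

lemma decaying_integrable:
  assumes "decaying k \<Phi>"
  shows "integrable lborel \<Phi>"
proof (rule Bochner_Integration.integrable_bound)
  show "integrable lborel (\<lambda>y. (1 + norm y) ^ k * norm (\<Phi> y))"
    using assms by (simp add: decaying_def)
  show "AE y in lborel. norm (\<Phi> y) \<le> norm ((1 + norm y) ^ k * norm (\<Phi> y))"
    by (rule AE_I2) (simp add: abs_mult mult_le_cancel_right1 one_le_power)
qed (use assms in \<open>auto simp: decaying_def\<close>)

lemma decaying_deriv:
  assumes "decaying (Suc k) \<Phi>" "v \<in> Basis"
  shows "decaying k (\<lambda>y. - \<i> * (y \<bullet> v) * \<Phi> y)"
  unfolding decaying_def
proof
  have [measurable]: "\<Phi> \<in> borel_measurable borel" using assms by (simp add: decaying_def)
  show "(\<lambda>y. - \<i> * (y \<bullet> v) * \<Phi> y) \<in> borel_measurable borel" by measurable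
  show "integrable lborel (\<lambda>y. (1 + norm y) ^ k * norm (- \<i> * (y \<bullet> v) * \<Phi> y))"
  proof (rule Bochner_Integration.integrable_bound)
    show "integrable lborel (\<lambda>y. (1 + norm y) ^ Suc k * norm (\<Phi> y))"
      using assms by (simp add: decaying_def)
    show "AE y in lborel. norm ((1 + norm y) ^ k * norm (- \<i> * (y \<bullet> v) * \<Phi> y)) \<le> norm ((1 + norm y) ^ Suc k * norm (\<Phi> y))"
    proof (rule AE_I2)
      fix y
      have "\<bar>y \<bullet> v\<bar> \<le> 1 + norm y"
        using Basis_le_norm[OF assms(2), of y] by simp
      then have "(1 + norm y) ^ k * (\<bar>y \<bullet> v\<bar> * norm (\<Phi> y)) \<le> (1 + norm y) ^ k * ((1 + norm y) * norm (\<Phi> y))"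
        by (intro mult_left_mono mult_right_mono) auto
      then show "norm ((1 + norm y) ^ k * norm (- \<i> * (y \<bullet> v) * \<Phi> y)) \<le> norm ((1 + norm y) ^ Suc k * norm (\<Phi> y))"
        by (simp add: norm_mult abs_mult mult_ac)
    qed
  qed measurable
qed

lemma C_diff_inv_fourier:
  "decaying k \<Phi> \<Longrightarrow> C_diff k (\<lambda>x. Re (inv_fourier \<Phi> x))"
proof (induction k arbitrary: \<Phi>)
  case 0
  then show ?case
    using continuous_inv_fourier[OF decaying_integrable[OF 0]] by (auto intro!: continuous_intros)
next
  case (Suc k)
  have "(\<lambda>t. Re (inv_fourier \<Phi> (x + t *\<^sub>R v))) field_differentiable at 0
      \<and> C_diff k (partial_deriv v (\<lambda>x. Re (inv_fourier \<Phi> x)))" if v: "v \<in> Basis" for v x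
  proof -
    note d = decaying_deriv[OF Suc.prems v]
    note i = decaying_integrable[OF Suc.prems] decaying_integrable[OF d]
    show ?thesis
      using DERIV_inv_fourier[OF i] Suc.IH[OF d]
      by (auto simp: partial_deriv_inv_fourier[OF i] field_differentiable_def)
  qed
  then show ?case
    using continuous_inv_fourier[OF decaying_integrable[OF Suc.prems]] by (auto intro!: continuous_intros)
qed

definition deriv_symbol :: "'a::euclidean_space list \<Rightarrow> 'a \<Rightarrow> complex" where
  "deriv_symbol vs y = (\<Prod>v\<leftarrow>vs. - \<i> * (y \<bullet> v))"

text \<open>The head of the list is the derivative taken last. The residual order \<open>k\<close>
  is left general so that the induction hypothesis can be applied with one spare order, which that
  outermost derivative consumes.\<close>

lemma iter_partial_inv_fourier:
  assumes "set vs \<subseteq> Basis" "decaying (k + length vs) \<Phi>"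
  shows "decaying k (\<lambda>y. deriv_symbol vs y * \<Phi> y) \<and>
     iter_partial vs (\<lambda>x. Re (inv_fourier \<Phi> x)) = (\<lambda>x. Re (inv_fourier (\<lambda>y. deriv_symbol vs y * \<Phi> y) x))"
  using assms
proof (induction vs arbitrary: k)
  case Nil
  then show ?case by (simp add: deriv_symbol_def)
next
  case (Cons v vs)
  then have IH: "decaying (Suc k) (\<lambda>y. deriv_symbol vs y * \<Phi> y)"
     "iter_partial vs (\<lambda>x. Re (inv_fourier \<Phi> x)) = (\<lambda>x. Re (inv_fourier (\<lambda>y. deriv_symbol vs y * \<Phi> y) x))"
    using Cons.IH[of "Suc k"] by auto
  have v: "v \<in> Basis" using Cons.prems by simp
  note d = decaying_deriv[OF IH(1) v]
  have eq: "- \<i> * (y \<bullet> v) * (deriv_symbol vs y * \<Phi> y) = deriv_symbol (v # vs) y * \<Phi> y" for y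
    by (simp add: deriv_symbol_def mult.assoc)
  show ?case
    using d partial_deriv_inv_fourier[OF decaying_integrable[OF IH(1)] decaying_integrable[OF d]]
    unfolding eq by (simp add: IH(2))
qed

lemma norm_deriv_symbol_le:
  "set vs \<subseteq> Basis \<Longrightarrow> norm (deriv_symbol vs y) \<le> (1 + norm y) ^ length vs"
proof (induction vs)
  case (Cons v vs)
  have "\<bar>y \<bullet> v\<bar> \<le> 1 + norm y"
    using Basis_le_norm[of v y] Cons.prems by simp
  then show ?case
    using Cons by (auto simp: deriv_symbol_def norm_mult intro!: mult_mono)
qed (simp add: deriv_symbol_def)

text \<open>No coordinate exceeds the norm, so the function is dominated by the product of the
  Cauchy kernels \<open>1 / (1 + t\<^sup>2)\<close> in the coordinates. The exponent is twice the
  dimension because each coordinate takes two powers.\<close>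

lemma integrable_norm_power_inverse:
  "integrable lborel (\<lambda>y::'a::euclidean_space. 1 / (1 + norm y) ^ (2 * DIM('a)))"
proof (rule Bochner_Integration.integrable_bound)
  have "integrable lborel (\<lambda>x::real. inverse (1 + x\<^sup>2))"
    using integrable_inverse_1_plus_square by (simp add: set_integrable_def)
  then show "integrable lborel (\<lambda>y::'a. \<Prod>b\<in>Basis. inverse (1 + (y \<bullet> b)\<^sup>2))"
    by (intro integrable_lborel_prod)
  show "AE y::'a in lborel. norm (1 / (1 + norm y) ^ (2 * DIM('a))) \<le> norm (\<Prod>b\<in>Basis. inverse (1 + (y \<bullet> b)\<^sup>2))"
  proof (rule AE_I2)
    fix y :: 'a
    have "(1 / (1 + norm y)\<^sup>2) \<le> inverse (1 + (y \<bullet> b)\<^sup>2)" if "b \<in> Basis" for b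
    proof -
      have "\<bar>y \<bullet> b\<bar>\<^sup>2 \<le> (norm y)\<^sup>2" using Basis_le_norm[OF that] by (intro power_mono) auto
      then have "(y \<bullet> b)\<^sup>2 \<le> (norm y)\<^sup>2" by simp
      then have "1 + (y \<bullet> b)\<^sup>2 \<le> (1 + norm y)\<^sup>2"
        unfolding power2_sum power_one using norm_ge_zero[of y] by linarith
      then show ?thesis by (simp add: inverse_eq_divide frac_le add_pos_nonneg)
    qed
    then have "(\<Prod>b\<in>(Basis :: 'a set). 1 / (1 + norm y)\<^sup>2) \<le> (\<Prod>b\<in>Basis. inverse (1 + (y \<bullet> b)\<^sup>2))"
      by (intro prod_mono) auto
    moreover have "(\<Prod>b\<in>(Basis :: 'a set). 1 / (1 + norm y)\<^sup>2) = 1 / (1 + norm y) ^ (2 * DIM('a))"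
      by (simp add: power_mult power_one_over)
    ultimately show "norm (1 / (1 + norm y) ^ (2 * DIM('a))) \<le> norm (\<Prod>b\<in>Basis. inverse (1 + (y \<bullet> b)\<^sup>2))"
      by (auto simp: abs_prod)
  qed
qed measurable

lemma decayingI:
  fixes \<Phi> :: "'a::euclidean_space \<Rightarrow> complex"
  assumes [measurable]: "\<Phi> \<in> borel_measurable borel"
    and C: "\<And>y. (1 + norm y) ^ (k + 2 * DIM('a)) * norm (\<Phi> y) \<le> C"
  shows "decaying k \<Phi>"
  unfolding decaying_def
proof
  show "integrable lborel (\<lambda>y. (1 + norm y) ^ k * norm (\<Phi> y))"
  proof (rule Bochner_Integration.integrable_bound)
    show "integrable lborel (\<lambda>y::'a. C * (1 / (1 + norm y) ^ (2 * DIM('a))))"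
      by (intro integrable_mult_right integrable_norm_power_inverse)
    show "AE y in lborel. norm ((1 + norm y) ^ k * norm (\<Phi> y)) \<le> norm (C * (1 / (1 + norm y) ^ (2 * DIM('a))))"
    proof (rule AE_I2)
      fix y :: 'a
      have p: "(1 + norm y) ^ (2 * DIM('a)) > 0" by (simp add: add_pos_nonneg)
      have "(1 + norm y) ^ k * norm (\<Phi> y) \<le> C / (1 + norm y) ^ (2 * DIM('a))"
        using C[of y] p by (simp add: pos_le_divide_eq power_add mult_ac)
      then have le: "(1 + norm y) ^ k * norm (\<Phi> y) \<le> C * (1 / (1 + norm y) ^ (2 * DIM('a)))" by simp
      have "0 \<le> (1 + norm y) ^ k * norm (\<Phi> y)" by simp
      from abs_of_nonneg[OF this] show "norm ((1 + norm y) ^ k * norm (\<Phi> y)) \<le> norm (C * (1 / (1 + norm y) ^ (2 * DIM('a))))"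
        unfolding real_norm_def using order_trans[OF le abs_ge_self] by metis
    qed
  qed measurable
qed fact

section \<open>Total mass and weak convergence\<close>

lemma continuous_char_fun:
  fixes \<mu> :: "'a::euclidean_space measure"
  assumes "finite_borel_measure \<mu>"
  shows "continuous_on UNIV (char_fun \<mu>)"
proof -
  interpret finite_measure \<mu> using assms by (simp add: finite_borel_measure_def)
  have [measurable_cong]: "sets \<mu> = sets borel" using assms by (simp add: finite_borel_measure_def)
  have "(\<lambda>n. char_fun \<mu> (X n)) \<longlonglongrightarrow> char_fun \<mu> x" if X: "X \<longlonglongrightarrow> x" for X x
    unfolding char_fun_def
  proof (rule integral_dominated_convergence[where w = "\<lambda>y. 1"])
    show "AE y in \<mu>. (\<lambda>n. cis (y \<bullet> X n)) \<longlonglongrightarrow> cis (y \<bullet> x)"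
      by (intro AE_I2 tendsto_intros X)
  qed auto
  then show ?thesis
    by (simp add: continuous_on_sequentially o_def)
qed

text \<open>Fubini moves the Gaussian from the density to the transform, where it becomes a
  mollifier around 0. Here \<open>\<Phi>\<close> need not be the transform of a measure, which is
  what the limit of the characteristic functions requires.\<close>

lemma inv_fourier_gauss_integral:
  fixes \<Phi> :: "'a::euclidean_space \<Rightarrow> complex"
  assumes i: "integrable lborel \<Phi>" and "e > 0"
  shows "(LINT x|lborel. Re (inv_fourier \<Phi> x) * gauss e x) = Re (LINT y|lborel. mollifier e y *\<^sub>R \<Phi> y)"
    and "integrable lborel (\<lambda>x. Re (inv_fourier \<Phi> x) * gauss e x)"
proof -
  have [measurable]: "\<Phi> \<in> borel_measurable borel" using i by auto
  have ig: "integrable lborel (gauss e :: 'a \<Rightarrow> real)" by (rule integrable_gauss[OF \<open>e > 0\<close>])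
  have "integrable (lborel \<Otimes>\<^sub>M lborel) (\<lambda>(x, y). \<Phi> y * cis (- (x \<bullet> y)) * complex_of_real (gauss e x))"
  proof (rule lborel_pair.Fubini_integrable)
    have "integrable lborel (\<lambda>x::'a. (LINT y|lborel. norm (\<Phi> y)) * gauss e x)"
      using ig by (rule integrable_mult_right)
    then show "integrable lborel (\<lambda>x. LINT y|lborel. norm (case (x, y) of (x, y) \<Rightarrow> \<Phi> y * cis (- (x \<bullet> y)) * complex_of_real (gauss e x)))"
      by (simp add: norm_mult gauss_pos[THEN less_imp_le])
    show "AE x in lborel. integrable lborel (\<lambda>y. case (x, y) of (x, y) \<Rightarrow> \<Phi> y * cis (- (x \<bullet> y)) * complex_of_real (gauss e x))"
      by (intro AE_I2) (auto intro!: integrable_mult_left integrable_mult_cis i)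
  qed measurable
  then have "(LINT y|lborel. LINT x|lborel. \<Phi> y * cis (- (x \<bullet> y)) * complex_of_real (gauss e x))
    = (LINT x|lborel. LINT y|lborel. \<Phi> y * cis (- (x \<bullet> y)) * complex_of_real (gauss e x))"
    by (rule lborel_pair.Fubini_integral)
  also have "\<dots> = (LINT x|lborel. (LINT y|lborel. \<Phi> y * cis (- (x \<bullet> y))) * complex_of_real (gauss e x))"
    by simp
  finally have F: "(LINT y|lborel. LINT x|lborel. \<Phi> y * cis (- (x \<bullet> y)) * complex_of_real (gauss e x)) / (2 * pi) ^ DIM('a)
      = (LINT x|lborel. inv_fourier \<Phi> x * complex_of_real (gauss e x))"
    by (simp add: inv_fourier_def)
  have "(LINT x|lborel. \<Phi> y * cis (- (x \<bullet> y)) * complex_of_real (gauss e x)) / (2 * pi) ^ DIM('a)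
       = mollifier e y *\<^sub>R \<Phi> y" for y
  proof -
    have "(LINT x|lborel. \<Phi> y * cis (- (x \<bullet> y)) * complex_of_real (gauss e x))
       = \<Phi> y * (LINT x|lborel. cis (- y \<bullet> x) * complex_of_real (gauss e x))"
      by (simp add: mult.assoc inner_commute)
    then have "(LINT x|lborel. \<Phi> y * cis (- (x \<bullet> y)) * complex_of_real (gauss e x)) / (2 * pi) ^ DIM('a)
       = \<Phi> y * ((LINT x|lborel. cis (- y \<bullet> x) * complex_of_real (gauss e x)) / (2 * pi) ^ DIM('a))"
      by simp
    also have "\<dots> = \<Phi> y * mollifier e (- y)"
      by (simp only: integral_gauss_kernel[OF \<open>e > 0\<close>])
    finally show ?thesis
      by (simp add: mollifier_def gauss_def scaleR_conv_of_real mult.commute)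
  qed
  then have "(LINT y|lborel. (LINT x|lborel. \<Phi> y * cis (- (x \<bullet> y)) * complex_of_real (gauss e x)) / (2 * pi) ^ DIM('a))
      = (LINT y|lborel. mollifier e y *\<^sub>R \<Phi> y)"
    by (simp only:)
  with F have eq: "(LINT x|lborel. inv_fourier \<Phi> x * complex_of_real (gauss e x)) = (LINT y|lborel. mollifier e y *\<^sub>R \<Phi> y)"
    by (simp only: integral_divide_zero)
  have ii: "integrable lborel (\<lambda>x. inv_fourier \<Phi> x * complex_of_real (gauss e x))"
  proof (rule Bochner_Integration.integrable_bound)
    define K where "K = (LINT y|lborel. norm (\<Phi> y)) / (2 * pi) ^ DIM('a)"
    have K: "norm (inv_fourier \<Phi> x) \<le> K" for x unfolding K_def by (rule inv_fourier_norm_le)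
    show "integrable lborel (\<lambda>x::'a. K * gauss e x)"
      using ig by (rule integrable_mult_right)
    show "AE x in lborel. norm (inv_fourier \<Phi> x * complex_of_real (gauss e x)) \<le> norm (K * gauss e x)"
      by (intro AE_I2) (auto simp: norm_mult abs_mult gauss_pos[THEN less_imp_le] intro!: mult_right_mono order_trans[OF K])
  qed measurable
  show "(LINT x|lborel. Re (inv_fourier \<Phi> x) * gauss e x) = Re (LINT y|lborel. mollifier e y *\<^sub>R \<Phi> y)"
    using integral_Re[OF ii] eq by simp
  show "integrable lborel (\<lambda>x. Re (inv_fourier \<Phi> x) * gauss e x)"
    using integrable_Re[OF ii] by simp
qed

text \<open>As \<open>e\<close> decreases to 0 the Gaussians increase to 1, so the left side follows
  by monotone convergence without any integrability of the inverse transform; on the right the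
  mollifier concentrates at the origin and picks out the value of the continuous function
  \<open>\<Phi>\<close> there.\<close>

lemma nn_integral_inv_fourier:
  fixes \<Phi> :: "'a::euclidean_space \<Rightarrow> complex"
  assumes i: "integrable lborel \<Phi>" and c: "continuous_on UNIV \<Phi>" and B: "\<And>y. norm (\<Phi> y) \<le> B"
    and nn: "\<And>x. Re (inv_fourier \<Phi> x) \<ge> 0"
  shows "(\<integral>\<^sup>+x. Re (inv_fourier \<Phi> x) \<partial>lborel) = ennreal (Re (\<Phi> 0))"
proof -
  have [measurable]: "\<Phi> \<in> borel_measurable borel" using i by auto
  define e where "e n = 1 / real (Suc n)" for n
  have e: "e \<longlonglongrightarrow> 0" "\<And>n. e n > 0"
    unfolding e_def using LIMSEQ_inverse_real_of_nat[unfolded inverse_eq_divide] by auto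
  have es: "e (Suc n) \<le> e n" for n by (simp add: e_def field_simps)
  have "(\<lambda>n. \<integral>\<^sup>+x. Re (inv_fourier \<Phi> x) * gauss (e n) x \<partial>lborel) \<longlonglongrightarrow> (\<integral>\<^sup>+x. Re (inv_fourier \<Phi> x) \<partial>lborel)"
  proof (rule nn_integral_LIMSEQ)
    show "incseq (\<lambda>n x. ennreal (Re (inv_fourier \<Phi> x) * gauss (e n) x))"
    proof (intro incseq_SucI le_funI ennreal_leI mult_left_mono nn)
      fix n and x :: 'a
      have "(e (Suc n))\<^sup>2 * (x \<bullet> x) \<le> (e n)\<^sup>2 * (x \<bullet> x)"
        using es[of n] e(2)[of "Suc n"] by (intro mult_right_mono power_mono) auto
      then show "gauss (e n) x \<le> gauss (e (Suc n)) x" by (simp add: gauss_def)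
    qed
    show "(\<lambda>n. ennreal (Re (inv_fourier \<Phi> x) * gauss (e n) x)) \<longlonglongrightarrow> ennreal (Re (inv_fourier \<Phi> x))" for x
      using tendsto_mult[OF tendsto_const[of "Re (inv_fourier \<Phi> x)"] gauss_tendsto_1[OF e(1)]]
      by (intro tendsto_ennrealI) simp
  qed measurable
  moreover have "(\<integral>\<^sup>+x. Re (inv_fourier \<Phi> x) * gauss (e n) x \<partial>lborel) = ennreal (Re (LINT y|lborel. mollifier (e n) (0 - y) *\<^sub>R \<Phi> y))" for n
  proof -
    have "(\<integral>\<^sup>+x. Re (inv_fourier \<Phi> x) * gauss (e n) x \<partial>lborel) = ennreal (LINT x|lborel. Re (inv_fourier \<Phi> x) * gauss (e n) x)"
      by (intro nn_integral_eq_integral inv_fourier_gauss_integral i e AE_I2 mult_nonneg_nonneg nn gauss_pos[THEN less_imp_le])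
    moreover have "mollifier (e n) (0 - y) = mollifier (e n) y" for y :: 'a
      by (simp add: mollifier_def gauss_def)
    ultimately show ?thesis by (simp add: inv_fourier_gauss_integral(1)[OF i e(2)])
  qed
  moreover have "(\<lambda>n. ennreal (Re (LINT y|lborel. mollifier (e n) (0 - y) *\<^sub>R \<Phi> y))) \<longlonglongrightarrow> ennreal (Re (\<Phi> 0))"
    by (intro tendsto_ennrealI tendsto_Re mollifier_tendsto[OF c B] e)
  ultimately show ?thesis using LIMSEQ_unique by fastforce
qed

text \<open>Pointwise convergence of the densities and convergence of the masses give convergence in
  \<open>L1\<close>, and a bounded test function multiplies the error by at most its bound.
  Densities are required only from \<open>n0\<close> on, since a measure with few primes need not
  have one.\<close>

lemma converges_weakly_densities:
  fixes \<mu> :: "nat \<Rightarrow> 'a::euclidean_space measure" and g :: "nat \<Rightarrow> 'a \<Rightarrow> real"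
  assumes \<mu>: "\<And>n. finite_borel_measure (\<mu> n)"
    and g: "\<And>n. n \<ge> n0 \<Longrightarrow> has_density (\<mu> n) (g n)"
    and h [measurable]: "h \<in> borel_measurable borel" and h0: "\<And>x. h x \<ge> 0"
    and lim: "\<And>x. (\<lambda>n. g n x) \<longlonglongrightarrow> h x"
    and mass: "(\<lambda>n. emeasure (\<mu> n) UNIV) \<longlonglongrightarrow> (\<integral>\<^sup>+x. h x \<partial>lborel)" and fin: "(\<integral>\<^sup>+x. h x \<partial>lborel) < \<infinity>"
  shows "converges_weakly \<mu> (density lborel (\<lambda>x. ennreal (h x)))"
proof -
  have gm [measurable]: "g (n + n0) \<in> borel_measurable borel" and g0: "g (n + n0) x \<ge> 0"
    and ge: "\<mu> (n + n0) = density lborel (\<lambda>x. ennreal (g (n + n0) x))" for n x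
    using g[of "n + n0"] by (auto simp: has_density_def)
  have ih: "integrable lborel h"
    using fin h0 by (auto simp: integrable_iff_bounded)
  have em: "emeasure (\<mu> (n + n0)) UNIV = (\<integral>\<^sup>+x. g (n + n0) x \<partial>lborel)" for n
    unfolding ge by (subst emeasure_density) auto
  have ig: "integrable lborel (g (n + n0))" for n
  proof -
    have "emeasure (\<mu> (n + n0)) (space (\<mu> (n + n0))) < \<infinity>"
      using \<mu>[of "n + n0"] finite_measure.emeasure_finite[of "\<mu> (n + n0)" "space (\<mu> (n + n0))"]
      by (auto simp: finite_borel_measure_def less_top)
    moreover have "space (\<mu> (n + n0)) = UNIV"
      using \<mu>[of "n + n0"] sets_eq_imp_space_eq by (fastforce simp: finite_borel_measure_def)
    ultimately have "(\<integral>\<^sup>+x. g (n + n0) x \<partial>lborel) < \<infinity>" using em by simp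
    then show ?thesis using g0 by (auto simp: integrable_iff_bounded)
  qed
  have mass': "(\<lambda>n. \<integral>\<^sup>+x. norm (g (n + n0) x) \<partial>lborel) \<longlonglongrightarrow> (\<integral>\<^sup>+x. norm (h x) \<partial>lborel)"
    using LIMSEQ_ignore_initial_segment[OF mass, of n0] g0 h0 by (simp add: em)
  have S: "(\<lambda>n. \<integral>\<^sup>+x. norm (g (n + n0) x - h x) \<partial>lborel) \<longlonglongrightarrow> 0"
  proof (rule Scheffe_lemma1[OF ig ih])
    show "AE x in lborel. (\<lambda>n. g (n + n0) x) \<longlonglongrightarrow> h x"
      by (intro AE_I2 LIMSEQ_ignore_initial_segment lim)
    show "limsup (\<lambda>n. \<integral>\<^sup>+x. norm (g (n + n0) x) \<partial>lborel) \<le> (\<integral>\<^sup>+x. norm (h x) \<partial>lborel)"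
      using lim_imp_Limsup[OF _ mass'] by simp
  qed
  have S': "(\<lambda>n. LINT x|lborel. \<bar>g (n + n0) x - h x\<bar>) \<longlonglongrightarrow> 0"
  proof -
    have "(\<integral>\<^sup>+x. norm (g (n + n0) x - h x) \<partial>lborel) = ennreal (LINT x|lborel. \<bar>g (n + n0) x - h x\<bar>)" for n
      using ig ih by (subst nn_integral_eq_integral[symmetric]) auto
    then have "(\<lambda>n. ennreal (LINT x|lborel. \<bar>g (n + n0) x - h x\<bar>)) \<longlonglongrightarrow> ennreal 0" using S by simp
    then show ?thesis by (rule tendsto_ennrealD) auto
  qed
  have "(\<lambda>n. LINT x|\<mu> n. f x) \<longlonglongrightarrow> (LINT x|density lborel (\<lambda>x. ennreal (h x)). f x)"
    if f: "continuous_on UNIV f" and "bounded (range f)" for f :: "'a \<Rightarrow> real"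
  proof -
    have [measurable]: "f \<in> borel_measurable borel" using f by (rule borel_measurable_continuous_onI)
    obtain B where B: "\<And>x. \<bar>f x\<bar> \<le> B" using \<open>bounded (range f)\<close> by (auto simp: bounded_iff)
    have i1: "integrable lborel (\<lambda>x. f x * u x)" if "integrable lborel u" for u :: "'a \<Rightarrow> real"
    proof (rule Bochner_Integration.integrable_bound)
      show "integrable lborel (\<lambda>x. B * \<bar>u x\<bar>)" using that by (intro integrable_mult_right integrable_abs)
      show "AE x in lborel. norm (f x * u x) \<le> norm (B * \<bar>u x\<bar>)"
        using B by (intro AE_I2) (auto simp: abs_mult intro!: mult_right_mono order_trans[OF B])
    qed (use that in auto)
    have e1: "(LINT x|\<mu> (n + n0). f x) = (LINT x|lborel. f x * g (n + n0) x)" for n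
      unfolding ge using g0 by (subst integral_density) (auto simp: mult.commute)
    have e2: "(LINT x|density lborel (\<lambda>x. ennreal (h x)). f x) = (LINT x|lborel. f x * h x)"
      using h0 by (subst integral_density) (auto simp: mult.commute)
    have b: "norm ((LINT x|lborel. f x * g (n + n0) x) - (LINT x|lborel. f x * h x)) \<le> B * (LINT x|lborel. \<bar>g (n + n0) x - h x\<bar>)" for n
    proof -
      have "(LINT x|lborel. f x * g (n + n0) x) - (LINT x|lborel. f x * h x) = (LINT x|lborel. f x * (g (n + n0) x - h x))"
        using i1[OF ig] i1[OF ih] by (simp add: right_diff_distrib)
      also have "norm \<dots> \<le> (LINT x|lborel. norm (f x * (g (n + n0) x - h x)))" by (rule integral_norm_bound)
      also have "\<dots> \<le> (LINT x|lborel. B * \<bar>g (n + n0) x - h x\<bar>)"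
        using ig ih by (intro integral_mono integrable_norm i1 integrable_mult_right integrable_abs Bochner_Integration.integrable_diff)
           (auto simp: abs_mult intro!: mult_right_mono B)
      finally show ?thesis by simp
    qed
    have "(\<lambda>n. (LINT x|lborel. f x * g (n + n0) x) - (LINT x|lborel. f x * h x)) \<longlonglongrightarrow> 0"
      by (rule Lim_null_comparison[OF always_eventually[OF allI[OF b]]])
         (use tendsto_mult_left[OF S', of B] in simp)
    then have "(\<lambda>n. LINT x|lborel. f x * g (n + n0) x) \<longlonglongrightarrow> (LINT x|lborel. f x * h x)"
      by (simp only: LIM_zero_iff)
    then show ?thesis
      using LIMSEQ_offset[of "\<lambda>n. LINT x|\<mu> n. f x" n0] by (simp add: e1 e2)
  qed
  moreover have "finite_borel_measure (density lborel (\<lambda>x. ennreal (h x)))"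
    unfolding finite_borel_measure_def using fin
    by (auto intro!: finite_measureI simp: emeasure_density)
  ultimately show ?thesis using \<mu> by (auto simp: converges_weakly_def)
qed

section \<open>Families of measures with uniformly decaying Fourier transforms\<close>

text \<open>In \<open>decay\<close> the threshold \<open>n0\<close> depends on the order
  \<open>k\<close> alone, while the constant may depend on \<open>M\<close>; this mirrors the claim,
  in which smoothness holds for all parameters from a common index on. In \<open>step\<close>
  quadratic growth in \<open>y\<close> is harmless, because it is played off against the
  decay.\<close>

locale char_fun_family =
  fixes \<mu> :: "nat \<Rightarrow> 's \<Rightarrow> 'a::euclidean_space measure" and S :: "real \<Rightarrow> 's set" and r :: "nat \<Rightarrow> real"
  assumes fin: "\<And>M s n. s \<in> S M \<Longrightarrow> finite_borel_measure (\<mu> n s)"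
    and decay: "\<And>k. \<exists>n0. \<forall>M. \<exists>C. \<forall>n\<ge>n0. \<forall>s\<in>S M. \<forall>y. (1 + norm y) ^ k * norm (char_fun (\<mu> n s) y) \<le> C"
    and step: "\<And>M s n y. s \<in> S M \<Longrightarrow>
       norm (char_fun (\<mu> (Suc n) s) y - char_fun (\<mu> n s) y) \<le> (1 + norm y)\<^sup>2 * r n"
    and summable_r: "summable r"
    and r_nonneg: "\<And>n. r n \<ge> 0"
begin

definition lim_char :: "'s \<Rightarrow> 'a \<Rightarrow> complex" where
  "lim_char s y = lim (\<lambda>n. char_fun (\<mu> n s) y)"

definition tail :: "nat \<Rightarrow> real" where
  "tail n = (\<Sum>i. r (i + n))"

definition dens :: "nat \<Rightarrow> 's \<Rightarrow> 'a \<Rightarrow> real" where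
  "dens n s x = Re (inv_fourier (char_fun (\<mu> n s)) x)"

definition lim_dens :: "'s \<Rightarrow> 'a \<Rightarrow> real" where
  "lim_dens s x = Re (inv_fourier (lim_char s) x)"

lemma measurable_char [measurable]: "s \<in> S M \<Longrightarrow> char_fun (\<mu> n s) \<in> borel_measurable borel"
  using fin by (intro char_fun_measurable) (auto simp: finite_borel_measure_def)

lemma tail_tendsto: "tail \<longlonglongrightarrow> 0"
proof -
  have "tail = (\<lambda>n. suminf r - sum r {..<n})"
    unfolding tail_def using suminf_minus_initial_segment[OF summable_r] by auto
  moreover have "(\<lambda>n. suminf r - sum r {..<n}) \<longlonglongrightarrow> suminf r - suminf r"
    by (intro tendsto_intros summable_LIMSEQ summable_r)
  ultimately show ?thesis by simp
qed

lemma tail_nonneg: "tail n \<ge> 0"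
  unfolding tail_def by (intro suminf_nonneg) (auto simp: summable_r r_nonneg summable_iff_shift)

lemma
  assumes s: "s \<in> S M"
  shows char_tendsto: "(\<lambda>n. char_fun (\<mu> n s) y) \<longlonglongrightarrow> lim_char s y"
    and char_dist_le: "norm (char_fun (\<mu> n s) y - lim_char s y) \<le> (1 + norm y)\<^sup>2 * tail n"
proof -
  let ?d = "\<lambda>n. char_fun (\<mu> (Suc n) s) y - char_fun (\<mu> n s) y"
  have sm: "summable (\<lambda>n. (1 + norm y)\<^sup>2 * r n)" using summable_r by (rule summable_mult)
  have "summable ?d"
    by (rule summable_comparison_test'[OF sm]) (rule step[OF s])
  then obtain c where "?d sums c" by (auto simp: summable_def)
  then have "(\<lambda>n. \<Sum>i<n. ?d i) \<longlonglongrightarrow> c" by (simp add: sums_def)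
  then have "(\<lambda>n. char_fun (\<mu> n s) y - char_fun (\<mu> 0 s) y) \<longlonglongrightarrow> c"
    by (simp only: sum_lessThan_telescope[of "\<lambda>n. char_fun (\<mu> n s) y"])
  from tendsto_add[OF this tendsto_const[of "char_fun (\<mu> 0 s) y"]]
  have "convergent (\<lambda>n. char_fun (\<mu> n s) y)" by (auto simp: convergent_def)
  then show l: "(\<lambda>n. char_fun (\<mu> n s) y) \<longlonglongrightarrow> lim_char s y"
    by (simp add: lim_char_def convergent_LIMSEQ_iff)
  have t: "(\<lambda>i. ?d (i + n)) sums (lim_char s y - char_fun (\<mu> n s) y)"
    using telescope_sums[OF LIMSEQ_ignore_initial_segment[OF l, of n]] by simp
  have smn: "summable (\<lambda>i. (1 + norm y)\<^sup>2 * r (i + n))"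
    using summable_r by (intro summable_mult) (simp add: summable_iff_shift)
  have "norm (\<Sum>i. ?d (i + n)) \<le> (\<Sum>i. (1 + norm y)\<^sup>2 * r (i + n))"
    by (rule norm_suminf_le[OF step[OF s] smn])
  also have "\<dots> = (1 + norm y)\<^sup>2 * tail n"
    unfolding tail_def using summable_r by (subst suminf_mult) (simp_all add: summable_iff_shift)
  finally show "norm (char_fun (\<mu> n s) y - lim_char s y) \<le> (1 + norm y)\<^sup>2 * tail n"
    using t by (simp add: sums_unique[symmetric] norm_minus_commute)
qed

lemma measurable_lim_char [measurable]: "s \<in> S M \<Longrightarrow> lim_char s \<in> borel_measurable borel"
  by (rule borel_measurable_LIMSEQ_metric[OF measurable_char char_tendsto])

lemma decay_lim:
  obtains n0 where "\<And>M. \<exists>C. \<forall>s\<in>S M. \<forall>y.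
     (\<forall>n\<ge>n0. (1 + norm y) ^ k * norm (char_fun (\<mu> n s) y) \<le> C) \<and> (1 + norm y) ^ k * norm (lim_char s y) \<le> C"
proof -
  obtain n0 where n0: "\<forall>M. \<exists>C. \<forall>n\<ge>n0. \<forall>s\<in>S M. \<forall>y. (1 + norm y) ^ k * norm (char_fun (\<mu> n s) y) \<le> C"
    using decay[of k] by blast
  have "\<exists>C. \<forall>s\<in>S M. \<forall>y.
     (\<forall>n\<ge>n0. (1 + norm y) ^ k * norm (char_fun (\<mu> n s) y) \<le> C) \<and> (1 + norm y) ^ k * norm (lim_char s y) \<le> C" for M
  proof -
    obtain C where C: "\<forall>n\<ge>n0. \<forall>s\<in>S M. \<forall>y. (1 + norm y) ^ k * norm (char_fun (\<mu> n s) y) \<le> C"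
      using n0 by blast
    have "(1 + norm y) ^ k * norm (lim_char s y) \<le> C" if "s \<in> S M" for s y
    proof (rule LIMSEQ_le_const2)
      show "(\<lambda>n. (1 + norm y) ^ k * norm (char_fun (\<mu> n s) y)) \<longlonglongrightarrow> (1 + norm y) ^ k * norm (lim_char s y)"
        by (intro tendsto_intros char_tendsto[OF that])
      show "\<exists>N. \<forall>n\<ge>N. (1 + norm y) ^ k * norm (char_fun (\<mu> n s) y) \<le> C" using C that by blast
    qed
    with C show ?thesis by blast
  qed
  then show ?thesis by (rule that)
qed

lemma decaying_char:
  "\<exists>n0. \<forall>M. \<forall>s\<in>S M. (\<forall>n\<ge>n0. decaying k (char_fun (\<mu> n s))) \<and> decaying k (lim_char s)"
proof -
  obtain n0 where n0: "\<And>M. \<exists>C. \<forall>s\<in>S M. \<forall>y.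
     (\<forall>n\<ge>n0. (1 + norm y) ^ (k + 2 * DIM('a)) * norm (char_fun (\<mu> n s) y) \<le> C) \<and>
     (1 + norm y) ^ (k + 2 * DIM('a)) * norm (lim_char s y) \<le> C"
    using decay_lim[of "k + 2 * DIM('a)"] by blast
  have "decaying k (char_fun (\<mu> n s)) \<and> decaying k (lim_char s)" if "s \<in> S M" "n \<ge> n0" for M s n
  proof -
    obtain C where "\<forall>s\<in>S M. \<forall>y.
     (\<forall>n\<ge>n0. (1 + norm y) ^ (k + 2 * DIM('a)) * norm (char_fun (\<mu> n s) y) \<le> C) \<and>
     (1 + norm y) ^ (k + 2 * DIM('a)) * norm (lim_char s y) \<le> C" using n0[of M] by blast
    with that show ?thesis
      using measurable_char[OF that(1)] measurable_lim_char[OF that(1)] by (auto intro!: decayingI[where C = C])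
  qed
  then show ?thesis by blast
qed

lemma has_density_dens:
  "\<exists>n0\<ge>1. \<forall>n\<ge>n0. \<forall>M. \<forall>s\<in>S M. has_density (\<mu> n s) (dens n s) \<and> continuous_on UNIV (dens n s)"
proof -
  obtain n0 where n0: "\<And>M s n. s \<in> S M \<Longrightarrow> n \<ge> n0 \<Longrightarrow> decaying 0 (char_fun (\<mu> n s))"
    using decaying_char[of 0] by blast
  have "has_density (\<mu> n s) (dens n s) \<and> continuous_on UNIV (dens n s)" if "s \<in> S M" "n \<ge> max 1 n0" for n M s
  proof -
    have d: "decaying 0 (char_fun (\<mu> n s))" using n0[of s M n] that by simp
    show ?thesis
      using has_density_inv_fourier[of "\<mu> n s"] fin[OF that(1)] decaying_integrable[OF d] C_diff_inv_fourier[OF d]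
      by (auto simp: finite_borel_measure_def dens_def[abs_def])
  qed
  then show ?thesis by (intro exI[of _ "max 1 n0"]) auto
qed

lemma C_diff_dens: "\<exists>n0\<ge>1. \<forall>n\<ge>n0. \<forall>M. \<forall>s\<in>S M. C_diff k (dens n s)"
proof -
  obtain n0 where n0: "\<And>M s n. s \<in> S M \<Longrightarrow> n \<ge> n0 \<Longrightarrow> decaying k (char_fun (\<mu> n s))"
    using decaying_char[of k] by blast
  have "C_diff k (dens n s)" if "s \<in> S M" "n \<ge> max 1 n0" for n M s
    using C_diff_inv_fourier[OF n0[OF that(1)], of n] that(2) by (simp add: dens_def[abs_def])
  then show ?thesis by (intro exI[of _ "max 1 n0"]) auto
qed

lemma C_diff_lim_dens: "s \<in> S M \<Longrightarrow> C_diff k (lim_dens s)"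
  unfolding lim_dens_def[abs_def] by (rule C_diff_inv_fourier) (use decaying_char[of k] in blast)

text \<open>The two available bounds complement each other: \<open>char_dist_le\<close> is small for
  large \<open>n\<close> but grows with \<open>y\<close>, and the decay is integrable but not small.
  Their minimum \<open>D n\<close> is dominated and tends to 0 pointwise; it does not involve
  \<open>s\<close>, whence the uniformity.\<close>

lemma weighted_L1_dist_tendsto:
  obtains e n0 where "e \<longlonglongrightarrow> 0"
    "\<And>n s. n \<ge> n0 \<Longrightarrow> s \<in> S M \<Longrightarrow> (LINT y|lborel. (1 + norm y) ^ k * norm (char_fun (\<mu> n s) y - lim_char s y)) \<le> e n"
proof -
  obtain n0 where n0: "\<And>M. \<exists>C. \<forall>s\<in>S M. \<forall>y.
     (\<forall>n\<ge>n0. (1 + norm y) ^ (k + 2 * DIM('a)) * norm (char_fun (\<mu> n s) y) \<le> C) \<and>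
     (1 + norm y) ^ (k + 2 * DIM('a)) * norm (lim_char s y) \<le> C"
    using decay_lim[of "k + 2 * DIM('a)"] by blast
  then obtain C where C: "\<And>s y n. s \<in> S M \<Longrightarrow> n \<ge> n0 \<Longrightarrow> (1 + norm y) ^ (k + 2 * DIM('a)) * norm (char_fun (\<mu> n s) y) \<le> C"
     "\<And>s y. s \<in> S M \<Longrightarrow> (1 + norm y) ^ (k + 2 * DIM('a)) * norm (lim_char s y) \<le> C" using n0[of M] by blast
  define w where "w y = 1 / (1 + norm y) ^ (2 * DIM('a))" for y :: 'a
  define D where "D n y = min ((1 + norm y) ^ k * ((1 + norm y)\<^sup>2 * tail n)) (2 * \<bar>C\<bar> * w y)" for n and y :: 'a
  have wp: "w y > 0" for y by (simp add: w_def add_pos_nonneg)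
  have wi: "integrable lborel (\<lambda>y. 2 * \<bar>C\<bar> * w y)"
    unfolding w_def by (intro integrable_mult_right integrable_norm_power_inverse)
  have wm [measurable]: "w \<in> borel_measurable borel" unfolding w_def by measurable
  have D0: "D n y \<ge> 0" for n y
    using wp[of y] tail_nonneg[of n] by (simp add: D_def)
  have Dm [measurable]: "D n \<in> borel_measurable borel" for n unfolding D_def by measurable
  have Dl: "AE y in lborel. (\<lambda>n. D n y) \<longlonglongrightarrow> 0"
  proof (rule AE_I2)
    fix y
    have "(\<lambda>n. min ((1 + norm y) ^ k * ((1 + norm y)\<^sup>2 * tail n)) (2 * \<bar>C\<bar> * w y)) \<longlonglongrightarrow> min ((1 + norm y) ^ k * ((1 + norm y)\<^sup>2 * 0)) (2 * \<bar>C\<bar> * w y)"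
      by (intro tendsto_min tendsto_mult tendsto_const tail_tendsto)
    then show "(\<lambda>n. D n y) \<longlonglongrightarrow> 0" using wp[of y] by (simp add: D_def)
  qed
  have Db: "AE y in lborel. norm (D n y) \<le> 2 * \<bar>C\<bar> * w y" for n
    using D0 by (intro AE_I2) (auto simp: D_def)
  have "(\<lambda>n. LINT y|lborel. D n y) \<longlonglongrightarrow> (LINT y|(lborel :: 'a measure). 0)"
    by (rule integral_dominated_convergence[OF _ _ wi Dl Db]) auto
  moreover have "(LINT y|lborel. (1 + norm y) ^ k * norm (char_fun (\<mu> n s) y - lim_char s y)) \<le> (LINT y|lborel. D n y)"
    if n: "n \<ge> n0" and s: "s \<in> S M" for n s
  proof (rule integral_mono_AE')
    show "integrable lborel (D n)"
      by (rule integrable_dominated_convergence2[OF _ _ wi Dl Db]) auto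
    show "AE y in lborel. (1 + norm y) ^ k * norm (char_fun (\<mu> n s) y - lim_char s y) \<le> D n y"
    proof (rule AE_I2)
      fix y
      have a: "(1 + norm y) ^ k * norm (char_fun (\<mu> n s) y - lim_char s y) \<le> (1 + norm y) ^ k * ((1 + norm y)\<^sup>2 * tail n)"
        by (intro mult_left_mono char_dist_le[OF s]) auto
      have q: "(1 + norm y) ^ (2 * DIM('a)) > 0" by (simp add: add_pos_nonneg)
      have "(1 + norm y) ^ (k + 2 * DIM('a)) * norm (char_fun (\<mu> n s) y - lim_char s y)
          \<le> (1 + norm y) ^ (k + 2 * DIM('a)) * (norm (char_fun (\<mu> n s) y) + norm (lim_char s y))"
        by (intro mult_left_mono norm_triangle_ineq4) auto
      also have "\<dots> \<le> 2 * \<bar>C\<bar>"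
        using C(1)[OF s n, of y] C(2)[OF s, of y] unfolding distrib_left by linarith
      finally have "(1 + norm y) ^ k * norm (char_fun (\<mu> n s) y - lim_char s y) \<le> 2 * \<bar>C\<bar> * w y"
        using q by (simp add: w_def power_add pos_le_divide_eq mult_ac)
      with a show "(1 + norm y) ^ k * norm (char_fun (\<mu> n s) y - lim_char s y) \<le> D n y"
        by (simp add: D_def)
    qed
    show "AE y in lborel. 0 \<le> D n y" using D0 by simp
  qed
  ultimately show ?thesis using that[of "\<lambda>n. LINT y|lborel. D n y" n0] by simp
qed

text \<open>The estimate of an inverse transform by the \<open>L1\<close> norm does not see
  \<open>x\<close>, and the multiplier of the derivatives is at most
  \<open>(1 + norm y) ^ k\<close>, so the weighted \<open>L1\<close> distance controls all points
  and all parameters at once.\<close>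

lemma iter_partial_dens_uniform_limit:
  assumes vs: "set vs \<subseteq> Basis"
  shows "uniform_limit (S M \<times> UNIV) (\<lambda>n (s, x). iter_partial vs (dens n s) x) (\<lambda>(s, x). iter_partial vs (lim_dens s) x) sequentially"
proof -
  define k where "k = length vs"
  obtain n1 where n1: "\<And>M s n. s \<in> S M \<Longrightarrow> n \<ge> n1 \<Longrightarrow> decaying k (char_fun (\<mu> n s))"
    "\<And>M s. s \<in> S M \<Longrightarrow> decaying k (lim_char s)"
    using decaying_char[of k] by blast
  obtain e n0 where e: "e \<longlonglongrightarrow> 0"
    "\<And>n s. n \<ge> n0 \<Longrightarrow> s \<in> S M \<Longrightarrow> (LINT y|lborel. (1 + norm y) ^ k * norm (char_fun (\<mu> n s) y - lim_char s y)) \<le> e n"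
    using weighted_L1_dist_tendsto[of M k] by blast
  have main: "dist (iter_partial vs (dens n s) x) (iter_partial vs (lim_dens s) x) \<le> e n / (2 * pi) ^ DIM('a)"
    if n: "n \<ge> max n0 n1" and s: "s \<in> S M" for n s x
  proof -
    define \<Phi> where "\<Phi> y = deriv_symbol vs y * char_fun (\<mu> n s) y" for y
    define \<Psi> where "\<Psi> y = deriv_symbol vs y * lim_char s y" for y
    have d: "decaying (0 + length vs) (char_fun (\<mu> n s))" "decaying (0 + length vs) (lim_char s)"
      using n1[OF s] n by (auto simp: k_def)
    have i: "integrable lborel \<Phi>" "integrable lborel \<Psi>"
      unfolding \<Phi>_def \<Psi>_def by (rule decaying_integrable[of 0], use iter_partial_inv_fourier[OF vs d(1)] iter_partial_inv_fourier[OF vs d(2)] in blast)+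
    have "iter_partial vs (dens n s) x - iter_partial vs (lim_dens s) x = Re (inv_fourier \<Phi> x - inv_fourier \<Psi> x)"
      unfolding dens_def[abs_def] lim_dens_def[abs_def] \<Phi>_def \<Psi>_def
      using iter_partial_inv_fourier[OF vs d(1)] iter_partial_inv_fourier[OF vs d(2)] by simp
    then have "dist (iter_partial vs (dens n s) x) (iter_partial vs (lim_dens s) x) \<le> norm (inv_fourier \<Phi> x - inv_fourier \<Psi> x)"
      using abs_Re_le_cmod by (simp add: dist_norm del: minus_complex.simps)
    also have "inv_fourier \<Phi> x - inv_fourier \<Psi> x = inv_fourier (\<lambda>y. \<Phi> y - \<Psi> y) x"
      by (rule inv_fourier_diff[OF i])
    also have "norm \<dots> \<le> (LINT y|lborel. norm (\<Phi> y - \<Psi> y)) / (2 * pi) ^ DIM('a)"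
      by (rule inv_fourier_norm_le)
    also have "\<dots> \<le> (LINT y|lborel. (1 + norm y) ^ k * norm (char_fun (\<mu> n s) y - lim_char s y)) / (2 * pi) ^ DIM('a)"
    proof (intro divide_right_mono integral_mono_AE')
      have "integrable lborel (\<lambda>y. (1 + norm y) ^ k * norm (char_fun (\<mu> n s) y) + (1 + norm y) ^ k * norm (lim_char s y))"
        using d by (auto simp: decaying_def k_def)
      then show "integrable lborel (\<lambda>y. (1 + norm y) ^ k * norm (char_fun (\<mu> n s) y - lim_char s y))"
      proof (rule Bochner_Integration.integrable_bound)
        show "AE y in lborel. norm ((1 + norm y) ^ k * norm (char_fun (\<mu> n s) y - lim_char s y)) \<le>
          norm ((1 + norm y) ^ k * norm (char_fun (\<mu> n s) y) + (1 + norm y) ^ k * norm (lim_char s y))"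
          unfolding distrib_left[symmetric] by (intro AE_I2) (auto simp: abs_mult intro!: mult_left_mono norm_triangle_ineq4)
      qed (use s in measurable)
      show "AE y in lborel. norm (\<Phi> y - \<Psi> y) \<le> (1 + norm y) ^ k * norm (char_fun (\<mu> n s) y - lim_char s y)"
        using norm_deriv_symbol_le[OF vs]
        by (intro AE_I2) (auto simp: \<Phi>_def \<Psi>_def k_def norm_mult right_diff_distrib[symmetric] intro!: mult_right_mono)
    qed auto
    also have "\<dots> \<le> e n / (2 * pi) ^ DIM('a)"
      using e(2)[OF _ s] n by (intro divide_right_mono) auto
    finally show ?thesis .
  qed
  have "(\<lambda>n. e n / (2 * pi) ^ DIM('a)) \<longlonglongrightarrow> 0 / (2 * pi) ^ DIM('a)"
    by (intro tendsto_intros e) auto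
  then have lim: "(\<lambda>n. e n / (2 * pi) ^ DIM('a)) \<longlonglongrightarrow> 0" by simp
  show ?thesis
    unfolding uniform_limit_iff
  proof (intro allI impI)
    fix \<epsilon> :: real assume "\<epsilon> > 0"
    from order_tendstoD(2)[OF lim this] eventually_ge_at_top[of "max n0 n1"]
    show "\<forall>\<^sub>F n in sequentially. \<forall>z\<in>S M \<times> UNIV. dist (case z of (s, x) \<Rightarrow> iter_partial vs (dens n s) x) (case z of (s, x) \<Rightarrow> iter_partial vs (lim_dens s) x) < \<epsilon>"
    proof eventually_elim
      case (elim n)
      then show ?case using main[of n] by (auto intro: le_less_trans)
    qed
  qed
qed

lemma dens_tendsto: "s \<in> S M \<Longrightarrow> (\<lambda>n. dens n s x) \<longlonglongrightarrow> lim_dens s x"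
  using tendsto_uniform_limitI[OF iter_partial_dens_uniform_limit[of "[]" M], of "(s, x)"] by simp

lemma lim_dens_nonneg:
  assumes "s \<in> S M" shows "lim_dens s x \<ge> 0"
proof (rule LIMSEQ_le_const[OF dens_tendsto[OF assms]])
  obtain n0 where "\<forall>n\<ge>n0. \<forall>M. \<forall>s\<in>S M. has_density (\<mu> n s) (dens n s) \<and> continuous_on UNIV (dens n s)"
    using has_density_dens by blast
  then show "\<exists>N. \<forall>n\<ge>N. 0 \<le> dens n s x"
    using assms unfolding has_density_def by blast
qed

text \<open>The error bound grows with \<open>y\<close>, so the convergence is uniform only on
  balls, which is enough. Continuity at the origin is what identifies the mass of the limit
  density.\<close>

lemma continuous_lim_char:
  assumes s: "s \<in> S M" shows "continuous_on UNIV (lim_char s)"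
proof -
  have "isCont (lim_char s) x" for x
  proof -
    let ?B = "ball (0::'a) (norm x + 1)"
    have "uniform_limit ?B (\<lambda>n. char_fun (\<mu> n s)) (lim_char s) sequentially"
    proof (rule uniform_limitI)
      fix \<epsilon> :: real assume "\<epsilon> > 0"
      have "(\<lambda>n. (1 + (norm x + 1))\<^sup>2 * tail n) \<longlonglongrightarrow> (1 + (norm x + 1))\<^sup>2 * 0"
        by (intro tendsto_intros tail_tendsto)
      then have "\<forall>\<^sub>F n in sequentially. (1 + (norm x + 1))\<^sup>2 * tail n < \<epsilon>"
        using \<open>\<epsilon> > 0\<close> by (auto dest: order_tendstoD)
      then show "\<forall>\<^sub>F n in sequentially. \<forall>y\<in>?B. dist (char_fun (\<mu> n s) y) (lim_char s y) < \<epsilon>"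
      proof eventually_elim
        case (elim n)
        show ?case
        proof
          fix y assume "y \<in> ?B"
          have "dist (char_fun (\<mu> n s) y) (lim_char s y) \<le> (1 + norm y)\<^sup>2 * tail n"
            unfolding dist_norm by (rule char_dist_le[OF s])
          also have "\<dots> \<le> (1 + (norm x + 1))\<^sup>2 * tail n"
            using \<open>y \<in> ?B\<close> by (intro mult_right_mono power_mono tail_nonneg) auto
          finally show "dist (char_fun (\<mu> n s) y) (lim_char s y) < \<epsilon>" using elim by simp
        qed
      qed
    qed
    then have "continuous_on ?B (lim_char s)"
      using continuous_on_subset[OF continuous_char_fun[OF fin[OF s]]]
      by (intro uniform_limit_theorem[where F = sequentially]) auto
    then show ?thesis by (rule continuous_on_interior) simp
  qed
  then show ?thesis by (simp add: continuous_on_eq_continuous_at)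
qed

text \<open>No mass escapes: the mass of \<open>\<mu> n s\<close> is the value of its transform at
  0, this converges to \<open>lim_char s 0\<close>, and by inversion that value is the integral of
  \<open>lim_dens s\<close>.\<close>

lemma lim_dens_properties:
  assumes s: "s \<in> S M"
  shows "converges_weakly (\<lambda>n. \<mu> n s) (density lborel (\<lambda>x. ennreal (lim_dens s x)))"
    and "has_density (density lborel (\<lambda>x. ennreal (lim_dens s x))) (lim_dens s)"
proof -
  obtain n0 where n0: "\<And>n. n \<ge> n0 \<Longrightarrow> has_density (\<mu> n s) (dens n s)"
    using has_density_dens s by blast
  have [measurable]: "lim_dens s \<in> borel_measurable borel"
    unfolding lim_dens_def[abs_def] using measurable_lim_char[OF s] by measurable
  obtain n1 where n1: "\<And>M. \<exists>C. \<forall>s\<in>S M. \<forall>y. (\<forall>n\<ge>n1. (1 + norm y) ^ 0 * norm (char_fun (\<mu> n s) y) \<le> C) \<and> (1 + norm y) ^ 0 * norm (lim_char s y) \<le> C"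
    using decay_lim[of 0] by blast
  then obtain B where "\<forall>s\<in>S M. \<forall>y. norm (lim_char s y) \<le> B" using n1[of M] unfolding power_0 mult_1 by blast
  then have B: "\<And>y. norm (lim_char s y) \<le> B" using s by blast
  have "decaying 0 (lim_char s)" using decaying_char[of 0] s by blast
  then have i: "integrable lborel (lim_char s)" by (rule decaying_integrable)
  have mass: "(\<integral>\<^sup>+x. lim_dens s x \<partial>lborel) = ennreal (Re (lim_char s 0))"
    unfolding lim_dens_def
    by (rule nn_integral_inv_fourier[OF i continuous_lim_char[OF s] B])
       (use lim_dens_nonneg[OF s] in \<open>simp add: lim_dens_def\<close>)
  have m: "emeasure (\<mu> n s) UNIV = ennreal (Re (char_fun (\<mu> n s) 0))" for n
  proof -
    have f: "finite_measure (\<mu> n s)" and "sets (\<mu> n s) = sets borel"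
      using fin[OF s, of n] by (auto simp: finite_borel_measure_def)
    then have sp: "space (\<mu> n s) = UNIV" by (metis sets_eq_imp_space_eq space_borel)
    show ?thesis
      using finite_measure.emeasure_eq_measure[OF f, of UNIV] by (simp add: char_fun_def sp)
  qed
  show "converges_weakly (\<lambda>n. \<mu> n s) (density lborel (\<lambda>x. ennreal (lim_dens s x)))"
  proof (rule converges_weakly_densities[OF fin[OF s] n0])
    show "(\<lambda>n. emeasure (\<mu> n s) UNIV) \<longlonglongrightarrow> (\<integral>\<^sup>+x. lim_dens s x \<partial>lborel)"
      unfolding mass m by (intro tendsto_ennrealI tendsto_Re char_tendsto[OF s])
  qed (use lim_dens_nonneg[OF s] dens_tendsto[OF s] in \<open>auto simp: mass\<close>)
  have "absolutely_continuous lborel (density lborel (\<lambda>x. ennreal (lim_dens s x)))"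
    by (rule absolutely_continuousI_density) measurable
  then show "has_density (density lborel (\<lambda>x. ennreal (lim_dens s x))) (lim_dens s)"
    using lim_dens_nonneg[OF s] by (auto simp: has_density_def)
qed

end

section \<open>Oscillatory integrals over a period\<close>

text \<open>The half-open interval agrees with the cube in \<open>W\<close>. The endpoint 1 is a
  null set, so the fundamental theorem of calculus on \<open>{0..1}\<close> remains
  applicable.\<close>

definition unit_measure :: "real measure" where
  "unit_measure = density lborel (\<lambda>t. ennreal (indicator {0..<1} t))"

lemma sets_unit_measure [measurable_cong, simp]: "sets unit_measure = sets borel"
  and space_unit_measure [simp]: "space unit_measure = UNIV"
  by (simp_all add: unit_measure_def)

lemma prob_space_unit_measure: "prob_space unit_measure"
proof
  have "emeasure unit_measure (space unit_measure) = (\<integral>\<^sup>+t. indicator {0..<1::real} t \<partial>lborel)"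
    unfolding unit_measure_def by (subst emeasure_density) (auto simp: ennreal_indicator)
  then show "emeasure unit_measure (space unit_measure) = 1" by simp
qed

interpretation unit: prob_space unit_measure by (rule prob_space_unit_measure)

lemma integral_unit_measure:
  fixes f :: "real \<Rightarrow> 'b::{banach,second_countable_topology}"
  assumes [measurable]: "f \<in> borel_measurable borel"
  shows "(LINT t|unit_measure. f t) = (LINT t|lborel. indicator {0..1} t *\<^sub>R f t)"
proof -
  have "(LINT t|unit_measure. f t) = (LINT t|lborel. indicator {0..<1} t *\<^sub>R f t)"
    unfolding unit_measure_def by (subst integral_density) auto
  also have "\<dots> = (LINT t|lborel. indicator {0..1} t *\<^sub>R f t)"
  proof (rule integral_cong_AE)
    show "AE t in lborel. indicator {0..<1} t *\<^sub>R f t = indicator {0..1} t *\<^sub>R f t"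
      using AE_lborel_singleton[of 1] by eventually_elim (auto simp: indicator_def)
  qed auto
  finally show ?thesis .
qed

lemma unit_integral_derivative:
  fixes F f :: "real \<Rightarrow> 'b::euclidean_space"
  assumes F: "\<And>t. (F has_vector_derivative f t) (at t)" and f: "continuous_on UNIV f"
  shows "(LINT t|unit_measure. f t) = F 1 - F 0"
proof -
  have "f \<in> borel_measurable borel" using f by (rule borel_measurable_continuous_onI)
  then have "(LINT t|unit_measure. f t) = (LINT t|lborel. indicator {0..1} t *\<^sub>R f t)"
    by (rule integral_unit_measure)
  also have "\<dots> = F 1 - F 0"
    by (rule integral_FTC_atLeastAtMost)
       (auto intro: has_vector_derivative_at_within[OF F] continuous_on_subset[OF f])
  finally show ?thesis .
qed

lemma unit_integrable_bounded:
  fixes f :: "real \<Rightarrow> 'b::{banach,second_countable_topology}"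
  assumes "f \<in> borel_measurable borel" "\<And>t. norm (f t) \<le> B"
  shows "integrable unit_measure f"
  using assms by (intro unit.integrable_const_bound[where B = B]) auto

lemma unit_integrable_continuous:
  fixes f :: "real \<Rightarrow> 'b::euclidean_space"
  assumes "continuous_on UNIV f"
  shows "integrable unit_measure f"
proof -
  have [measurable]: "f \<in> borel_measurable borel" using assms by (rule borel_measurable_continuous_onI)
  have "compact (f ` {0..1})"
    by (intro compact_continuous_image continuous_on_subset[OF assms]) auto
  then obtain B where B: "\<And>t. t \<in> {0..1} \<Longrightarrow> norm (f t) \<le> B"
    using compact_imp_bounded[of "f ` {0..1}"] unfolding bounded_iff by (metis imageI)
  show ?thesis
  proof (rule unit.integrable_const_bound[where B = B])
    have "AE t in unit_measure. t \<in> {0..<1}"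
      unfolding unit_measure_def by (subst AE_density) (auto simp: indicator_def)
    then show "AE t in unit_measure. norm (f t) \<le> B"
      by eventually_elim (auto intro: B)
  qed measurable
qed

text \<open>The integral of a non-integrable function is 0 by convention, so measurability of
  \<open>f\<close> never has to be checked.\<close>

lemma unit_integral_norm_le:
  fixes f :: "real \<Rightarrow> 'b::{banach,second_countable_topology}"
  assumes "\<And>t. norm (f t) \<le> B"
  shows "norm (LINT t|unit_measure. f t) \<le> B"
proof (cases "integrable unit_measure f")
  case True
  have "norm (LINT t|unit_measure. f t) \<le> (LINT t|unit_measure. norm (f t))" by (rule integral_norm_bound)
  also have "\<dots> \<le> (LINT t|unit_measure. B)"
    using True assms by (intro integral_mono) auto
  finally show ?thesis by (simp add: unit.prob_space[simplified])
next
  case False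
  have "B \<ge> 0" using assms[of 0] norm_ge_zero order_trans by blast
  then show ?thesis using False by (simp add: not_integrable_integral_eq)
qed

text \<open>
  Integrating by parts against the weight \<open>v\<^sup>2 / (v\<^sup>2 + 1/A)\<close> leaves no boundary terms because everything
  is periodic; the exceptional set where \<open>v\<close> is small is controlled by \<open>v'\<close> through
  the derivative of \<open>v' * arctan (v * sqrt A)\<close>.
\<close>

lemma oscillatory_integral_bound:
  fixes \<phi> v v' v'' :: "real \<Rightarrow> real"
  assumes \<phi>: "\<And>t. (\<phi> has_field_derivative v t) (at t)"
    and v: "\<And>t. (v has_field_derivative v' t) (at t)"
    and v': "\<And>t. (v' has_field_derivative v'' t) (at t)"
    and c: "continuous_on UNIV v''"
    and per: "\<phi> 1 = \<phi> 0" "v 1 = v 0" "v' 1 = v' 0"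
    and C1: "\<And>t. \<bar>v' t\<bar> \<le> C1" and C2: "\<And>t. \<bar>v'' t\<bar> \<le> C2"
    and lower: "\<And>t. (v t)\<^sup>2 + (v' t)\<^sup>2 \<ge> 1"
    and A: "A \<ge> 1"
  shows "norm (LINT t|unit_measure. cis (A * \<phi> t)) \<le> (C1 + 1) * (1 + 2 * C2) / sqrt A"
proof -
  \<comment> \<open>\<open>d\<close> is the size below which \<open>v\<close> counts as small.
    Integration by parts costs about \<open>1 / (A * d)\<close>, the exceptional set about
    \<open>d\<close>, and \<open>1 / sqrt A\<close> balances the two.\<close>
  define d where "d = 1 / sqrt A"
  have d: "d > 0" "d\<^sup>2 = 1 / A" using A by (auto simp: d_def power_divide)
  define D where "D t = (v t)\<^sup>2 + d\<^sup>2" for t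
  have D: "D t > 0" for t using d(1) by (auto simp: D_def intro!: add_nonneg_pos)
  have c0: "continuous_on UNIV \<phi>" "continuous_on UNIV v" "continuous_on UNIV v'"
    using DERIV_isCont[OF \<phi>] DERIV_isCont[OF v] DERIV_isCont[OF v'] by (auto intro: continuous_at_imp_continuous_on)
  have cD: "continuous_on UNIV D" unfolding D_def by (intro continuous_intros c0)
  have cA: "continuous_on UNIV (\<lambda>t. arctan (v t / d))" 
    using d by (intro continuous_intros c0) auto
  have Dne: "D t \<noteq> 0" for t using D[of t] by simp
  have C10: "C1 \<ge> 0" "C2 \<ge> 0" using C1[of 0] C2[of 0] by linarith+
  have i1: "integrable unit_measure (\<lambda>t. 1 / D t)"
    by (intro unit_integrable_continuous continuous_intros cD) (use Dne in auto)
  have dD: "(D has_field_derivative 2 * v t * v' t) (at t)" for t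
    unfolding D_def by (auto intro!: derivative_eq_intros v)
  have int1: "(LINT t|unit_measure. 1 / D t) \<le> 1 + 2 * C2 / d"
  proof -
    have der: "((\<lambda>t. v' t * arctan (v t / d) / d) has_vector_derivative
       v'' t * arctan (v t / d) / d + (v' t)\<^sup>2 / D t) (at t)" for t
    proof -
      have "v' t * (v' t / d * inverse (1 + (v t / d)\<^sup>2)) / d = (v' t)\<^sup>2 / D t"
      proof -
        have "1 + (v t / d)\<^sup>2 = D t / d\<^sup>2"
          using d(1) by (simp add: D_def power_divide add_divide_distrib)
        then show ?thesis using d(1) by (simp add: power2_eq_square)
      qed
      moreover have "((\<lambda>t. v' t * arctan (v t / d) / d) has_field_derivative
         (v'' t * arctan (v t / d) + v' t * (v' t / d * inverse (1 + (v t / d)\<^sup>2))) / d) (at t)"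
        using d(1) by (auto intro!: derivative_eq_intros v v' simp: field_simps)
      ultimately show ?thesis
        by (simp add: has_real_derivative_iff_has_vector_derivative[symmetric] add_divide_distrib)
    qed
    have ca: "continuous_on UNIV (\<lambda>t. v'' t * arctan (v t / d) / d)"
      using d by (intro continuous_intros c cA) auto
    have cb: "continuous_on UNIV (\<lambda>t. (v' t)\<^sup>2 / D t)"
      using Dne by (intro continuous_intros c0 cD) auto
    have "(LINT t|unit_measure. v'' t * arctan (v t / d) / d + (v' t)\<^sup>2 / D t) = 0"
      using per by (subst unit_integral_derivative[OF der]) (auto intro: continuous_on_add ca cb)
    then have "(LINT t|unit_measure. (v' t)\<^sup>2 / D t) = - (LINT t|unit_measure. v'' t * arctan (v t / d) / d)"
      using unit_integrable_continuous[OF ca] unit_integrable_continuous[OF cb] by simp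
    also have "\<dots> \<le> norm (LINT t|unit_measure. v'' t * arctan (v t / d) / d)"
      unfolding real_norm_def by (rule abs_ge_minus_self)
    also have "\<dots> \<le> 2 * C2 / d"
    proof (rule unit_integral_norm_le)
      fix t
      have "\<bar>arctan (v t / d)\<bar> \<le> 2"
        using arctan_bounded[of "v t / d"] pi_less_4 by linarith
      then have "\<bar>v'' t\<bar> * \<bar>arctan (v t / d)\<bar> \<le> C2 * 2"
        by (intro mult_mono C2) (use C10 in auto)
      then show "norm (v'' t * arctan (v t / d) / d) \<le> 2 * C2 / d"
        using d(1) by (simp add: abs_mult divide_right_mono)
    qed
    finally have *: "(LINT t|unit_measure. (v' t)\<^sup>2 / D t) \<le> 2 * C2 / d" .
    have "(LINT t|unit_measure. 1 / D t) \<le> (LINT t|unit_measure. 1 + (v' t)\<^sup>2 / D t)"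
    proof (intro integral_mono i1 Bochner_Integration.integrable_add unit_integrable_continuous[OF cb])
      show "1 / D t \<le> 1 + (v' t)\<^sup>2 / D t" for t
      proof -
        \<comment> \<open>By \<open>lower\<close> the two derivatives are not small together, so
          \<open>1 / D\<close> is at most 1 plus the quantity just estimated.\<close>
        have "1 \<le> D t + (v' t)\<^sup>2" using lower[of t] d(2) A unfolding D_def by (smt (verit) zero_le_power2)
        then have "1 / D t \<le> (D t + (v' t)\<^sup>2) / D t" using D[of t] by (intro divide_right_mono) auto
        then show ?thesis using Dne[of t] by (simp add: add_divide_distrib)
      qed
    qed auto
    also have "\<dots> = 1 + (LINT t|unit_measure. (v' t)\<^sup>2 / D t)"
      using unit_integrable_continuous[OF cb] by (simp add: unit.prob_space[simplified])
    finally show ?thesis using * by simp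
  qed
  define E where "E t = cis (A * \<phi> t)" for t
  have cE: "continuous_on UNIV E" unfolding E_def by (intro continuous_intros c0)
  have dE: "(E has_vector_derivative (A * v t) *\<^sub>R (\<i> * E t)) (at t)" for t
    unfolding has_vector_derivative_complex_iff E_def
    by (auto intro!: derivative_eq_intros \<phi>)
  \<comment> \<open>The amplitude \<open>v / D\<close> is chosen so that, multiplied by the
    derivative of \<open>E\<close>, it produces \<open>v\<^sup>2 / D\<close>; \<open>q\<close> is
    its derivative.\<close>
  define q where "q t = v' t * (d\<^sup>2 - (v t)\<^sup>2) / (D t)\<^sup>2" for t
  have dq: "((\<lambda>t. v t / D t) has_field_derivative q t) (at t)" for t
    by (rule derivative_eq_intros v dD Dne refl)+ (use Dne[of t] in \<open>simp add: q_def D_def power2_eq_square field_simps\<close>)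
  have cq: "continuous_on UNIV q"
    unfolding q_def using Dne by (intro continuous_intros c0 cD) auto
  have qb: "\<bar>q t\<bar> \<le> C1 * (1 / D t)" for t
  proof -
    have "\<bar>d\<^sup>2 - (v t)\<^sup>2\<bar> \<le> D t" by (simp add: D_def abs_le_iff)
    then have "\<bar>v' t\<bar> * \<bar>d\<^sup>2 - (v t)\<^sup>2\<bar> \<le> C1 * D t"
      by (intro mult_mono C1) (use C10 in auto)
    then have "\<bar>q t\<bar> \<le> C1 * D t / (D t)\<^sup>2"
      unfolding q_def abs_divide abs_mult by (simp add: divide_right_mono)
    then show ?thesis using Dne[of t] by (simp add: power2_eq_square)
  qed
  have der2: "((\<lambda>t. (v t / D t) *\<^sub>R E t) has_vector_derivative
      (v t / D t) *\<^sub>R ((A * v t) *\<^sub>R (\<i> * E t)) + q t *\<^sub>R E t) (at t)" for t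
    by (rule has_vector_derivative_scaleR[OF dq dE])
  have cs: "continuous_on UNIV (\<lambda>t. (v t / D t) *\<^sub>R ((A * v t) *\<^sub>R (\<i> * E t)))"
    using Dne by (intro continuous_intros c0 cD cE) auto
  have cqE: "continuous_on UNIV (\<lambda>t. q t *\<^sub>R E t)" by (intro continuous_intros cq cE)
  have cdE: "continuous_on UNIV (\<lambda>t. (d\<^sup>2 / D t) *\<^sub>R E t)"
    using Dne by (intro continuous_intros cD cE) auto
  have "(LINT t|unit_measure. (v t / D t) *\<^sub>R ((A * v t) *\<^sub>R (\<i> * E t)) + q t *\<^sub>R E t) = 0"
    unfolding unit_integral_derivative[OF der2 continuous_on_add[OF cs cqE]]
    using per by (simp add: E_def D_def)
  then have I0: "(LINT t|unit_measure. (v t / D t) *\<^sub>R ((A * v t) *\<^sub>R (\<i> * E t))) = - (LINT t|unit_measure. q t *\<^sub>R E t)"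
    using unit_integrable_continuous[OF cs] unit_integrable_continuous[OF cqE] by (simp add: eq_neg_iff_add_eq_0)
  have Eeq: "E t = (1 / (\<i> * A)) * ((v t / D t) *\<^sub>R ((A * v t) *\<^sub>R (\<i> * E t))) + (d\<^sup>2 / D t) *\<^sub>R E t" for t
  proof -
    have "(v t)\<^sup>2 / D t + d\<^sup>2 / D t = 1" using Dne[of t] by (simp add: D_def add_divide_distrib[symmetric])
    then have "((v t)\<^sup>2 / D t) *\<^sub>R E t + (d\<^sup>2 / D t) *\<^sub>R E t = E t" by (metis scaleR_left_distrib scaleR_one)
    moreover have "(1 / (\<i> * A)) * ((v t / D t) *\<^sub>R ((A * v t) *\<^sub>R (\<i> * E t))) = ((v t)\<^sup>2 / D t) *\<^sub>R E t"
      using A by (simp add: scaleR_conv_of_real power2_eq_square mult_ac)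
    ultimately show ?thesis by simp
  qed
  have "(LINT t|unit_measure. E t) = (LINT t|unit_measure. (1 / (\<i> * A)) * ((v t / D t) *\<^sub>R ((A * v t) *\<^sub>R (\<i> * E t))) + (d\<^sup>2 / D t) *\<^sub>R E t)"
    using Eeq by simp
  also have "\<dots> = (1 / (\<i> * A)) * (- (LINT t|unit_measure. q t *\<^sub>R E t)) + (LINT t|unit_measure. (d\<^sup>2 / D t) *\<^sub>R E t)"
    using unit_integrable_continuous[OF cs] unit_integrable_continuous[OF cdE]
    by (subst Bochner_Integration.integral_add) (auto intro!: integrable_mult_right simp only: integral_mult_right_zero I0)
  finally have "norm (LINT t|unit_measure. E t) \<le> norm ((1 / (\<i> * A)) * (- (LINT t|unit_measure. q t *\<^sub>R E t))) + norm (LINT t|unit_measure. (d\<^sup>2 / D t) *\<^sub>R E t)"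
    by (simp only: norm_triangle_ineq)
  also have "norm ((1 / (\<i> * A)) * (- (LINT t|unit_measure. q t *\<^sub>R E t))) = norm (LINT t|unit_measure. q t *\<^sub>R E t) / A"
    using A by (simp add: norm_mult norm_divide)
  also have "norm (LINT t|unit_measure. q t *\<^sub>R E t) \<le> (LINT t|unit_measure. C1 * (1 / D t))"
  proof -
    have "norm (LINT t|unit_measure. q t *\<^sub>R E t) \<le> (LINT t|unit_measure. norm (q t *\<^sub>R E t))"
      by (rule integral_norm_bound)
    also have "\<dots> \<le> (LINT t|unit_measure. C1 * (1 / D t))"
      using qb unit_integrable_continuous[OF cqE] i1
      by (intro integral_mono integrable_norm integrable_mult_right) (auto simp: E_def)
    finally show ?thesis .
  qed
  also have "norm (LINT t|unit_measure. (d\<^sup>2 / D t) *\<^sub>R E t) \<le> (LINT t|unit_measure. d\<^sup>2 * (1 / D t))"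
  proof -
    have "norm (LINT t|unit_measure. (d\<^sup>2 / D t) *\<^sub>R E t) \<le> (LINT t|unit_measure. norm ((d\<^sup>2 / D t) *\<^sub>R E t))"
      by (rule integral_norm_bound)
    also have "\<dots> = (LINT t|unit_measure. d\<^sup>2 * (1 / D t))"
      using D by (intro Bochner_Integration.integral_cong) (auto simp: E_def less_imp_le abs_of_pos)
    finally show ?thesis by simp
  qed
  finally have "norm (LINT t|unit_measure. E t) \<le> C1 * (LINT t|unit_measure. 1 / D t) / A + d\<^sup>2 * (LINT t|unit_measure. 1 / D t)"
    using A by (simp only: integral_mult_right_zero) (simp add: divide_right_mono)
  also have "\<dots> = (C1 + 1) / A * (LINT t|unit_measure. 1 / D t)"
    using A by (simp add: d(2) field_simps)
  also have "\<dots> \<le> (C1 + 1) / A * (1 + 2 * C2 / d)"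
    using int1 C10 A by (intro mult_left_mono) auto
  also have "\<dots> \<le> (C1 + 1) / A * ((1 + 2 * C2) * sqrt A)"
    using C10 A by (intro mult_left_mono) (auto simp: d_def field_simps)
  also have "\<dots> = (C1 + 1) * (1 + 2 * C2) * (sqrt A / A)" by simp
  also have "sqrt A / A = 1 / sqrt A"
    using A real_div_sqrt[of A] by (simp add: field_simps)
  finally show ?thesis by (simp add: E_def)
qed

text \<open>The summation starts at frequency \<open>1\<close>, so that a trigonometric series has mean zero.\<close>

definition trig_series :: "(nat \<Rightarrow> complex) \<Rightarrow> real \<Rightarrow> complex" where
  "trig_series c t = (\<Sum>k. c k * cis (- (2 * pi * real (Suc k) * t)))"

definition trig_deriv :: "(nat \<Rightarrow> complex) \<Rightarrow> nat \<Rightarrow> complex" where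
  "trig_deriv c k = - (2 * pi * real (Suc k)) * \<i> * c k"

lemma norm_trig_deriv: "norm (trig_deriv c k) = 2 * pi * (real (Suc k) * norm (c k))"
  unfolding trig_deriv_def norm_mult by (simp add: norm_mult del: of_nat_Suc)

lemma summable_trig_series: "summable (\<lambda>k. norm (c k)) \<Longrightarrow> summable (\<lambda>k. c k * cis (- (2 * pi * real (Suc k) * t)))"
  by (rule summable_norm_cancel) (simp add: norm_mult)

lemma norm_trig_series_le:
  assumes "summable (\<lambda>k. norm (c k))"
  shows "norm (trig_series c t) \<le> (\<Sum>k. norm (c k))"
  unfolding trig_series_def by (rule norm_suminf_le[OF _ assms]) (simp add: norm_mult)

lemma trig_series_split:
  assumes "summable (\<lambda>k. norm (c k))"
  shows "trig_series c t = c 0 * cis (- (2 * pi * t)) + (\<Sum>k. c (Suc k) * cis (- (2 * pi * real (Suc (Suc k)) * t)))"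
  unfolding trig_series_def using suminf_split_head[OF summable_trig_series[OF assms, of t]] by simp

lemma continuous_trig_series:
  assumes "summable (\<lambda>k. norm (c k))"
  shows "continuous_on UNIV (trig_series c)"
proof (rule uniform_limit_theorem[where F = sequentially])
  show "uniform_limit UNIV (\<lambda>n t. \<Sum>k<n. c k * cis (- (2 * pi * real (Suc k) * t))) (trig_series c) sequentially"
    unfolding trig_series_def by (rule Weierstrass_m_test[OF _ assms]) (simp add: norm_mult)
qed (auto intro!: always_eventually continuous_intros)

lemma trig_series_periodic: "trig_series c 1 = trig_series c 0"
proof -
  have "cis (- (2 * pi * real (Suc k) * 1)) = 1" for k
    using cis_multiple_2pi[of "- real (Suc k)"] by (simp del: of_nat_Suc)
  then show ?thesis by (simp add: trig_series_def del: of_nat_Suc)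
qed

lemma trig_series_has_derivative:
  assumes s: "summable (\<lambda>k. real (Suc k) * norm (c k))"
  shows "(trig_series c has_vector_derivative trig_series (trig_deriv c) t) (at t)"
proof -
  have sd: "summable (\<lambda>k. norm (trig_deriv c k))"
    unfolding norm_trig_deriv using s by (rule summable_mult)
  have sc: "summable (\<lambda>k. norm (c k))"
    by (rule summable_comparison_test'[OF s]) (simp add: distrib_right)
  let ?f = "\<lambda>k t. c k * cis (- (2 * pi * real (Suc k) * t))"
  let ?f' = "\<lambda>k t. trig_deriv c k * cis (- (2 * pi * real (Suc k) * t))"
  have der: "(?f k has_vector_derivative ?f' k t) (at t)" for k t
  proof -
    have "((\<lambda>t. cis (- (2 * pi * real (Suc k) * t))) has_vector_derivative
        - (2 * pi * real (Suc k)) *\<^sub>R (\<i> * cis (- (2 * pi * real (Suc k) * t)))) (at t)"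
      unfolding has_vector_derivative_complex_iff
      by (auto intro!: derivative_eq_intros simp del: of_nat_Suc)
    from has_vector_derivative_mult_right[OF this, of "c k"]
    show ?thesis by (simp add: trig_deriv_def scaleR_conv_of_real mult_ac del: of_nat_Suc)
  qed
  have ul: "uniform_limit UNIV (\<lambda>n t. \<Sum>k<n. ?f' k t) (trig_series (trig_deriv c)) sequentially"
    unfolding trig_series_def by (rule Weierstrass_m_test[OF _ sd]) (simp add: norm_mult)
  have "\<exists>g. \<forall>x\<in>UNIV. (\<lambda>n. ?f n x) sums g x \<and> (g has_derivative (\<lambda>h. h *\<^sub>R trig_series (trig_deriv c) x)) (at x within UNIV)"
  proof (rule has_derivative_series[where f' = "\<lambda>k t h. h *\<^sub>R ?f' k t"])
    show "(?f n has_derivative (\<lambda>h. h *\<^sub>R ?f' n x)) (at x within UNIV)" for n x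
      using der by (simp add: has_vector_derivative_def)
    show "\<forall>\<^sub>F n in sequentially. \<forall>x\<in>UNIV. \<forall>h. norm ((\<Sum>i<n. h *\<^sub>R ?f' i x) - h *\<^sub>R trig_series (trig_deriv c) x) \<le> e * norm h" if "e > 0" for e
      using uniform_limitD[OF ul that]
    proof eventually_elim
      case (elim n)
      show ?case
      proof (intro ballI allI)
        fix x h :: real
        have "(\<Sum>i<n. h *\<^sub>R ?f' i x) - h *\<^sub>R trig_series (trig_deriv c) x = h *\<^sub>R ((\<Sum>i<n. ?f' i x) - trig_series (trig_deriv c) x)"
          by (simp only: scaleR_sum_right[symmetric] scaleR_diff_right)
        also have "norm \<dots> \<le> \<bar>h\<bar> * e"
          unfolding norm_scaleR using elim by (intro mult_left_mono) (auto simp: dist_norm less_imp_le)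
        finally show "norm ((\<Sum>i<n. h *\<^sub>R ?f' i x) - h *\<^sub>R trig_series (trig_deriv c) x) \<le> e * norm h"
          by (simp add: mult.commute)
      qed
    qed
    show "(\<lambda>n. ?f n 0) sums trig_series c 0"
      unfolding trig_series_def by (rule summable_sums[OF summable_trig_series[OF sc]])
  qed auto
  then obtain g where g: "\<And>x. (\<lambda>n. ?f n x) sums g x" "\<And>x. (g has_derivative (\<lambda>h. h *\<^sub>R trig_series (trig_deriv c) x)) (at x)"
    by auto
  have "g = trig_series c"
    using g(1) by (auto simp: trig_series_def fun_eq_iff dest: sums_unique)
  with g(2) show ?thesis by (simp add: has_vector_derivative_def)
qed

text \<open>As frequency 0 is absent, dividing each coefficient by its frequency gives a primitive
  that is again a trigonometric series, hence periodic.\<close>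

lemma unit_integral_trig_series:
  assumes "summable (\<lambda>k. norm (c k))"
  shows "(LINT t|unit_measure. trig_series c t) = 0"
proof -
  define d where "d k = c k / (- (2 * pi * real (Suc k)) * \<i>)" for k
  have dd: "trig_deriv d = c"
    unfolding fun_eq_iff trig_deriv_def d_def by (simp del: of_nat_Suc)
  have "real (Suc k) * norm (d k) = norm (c k) / (2 * pi)" for k
    by (simp add: d_def norm_mult norm_divide del: of_nat_Suc)
  then have "summable (\<lambda>k. real (Suc k) * norm (d k))"
    using summable_divide[OF assms, of "2 * pi"] by simp
  from trig_series_has_derivative[OF this]
  have der: "(trig_series d has_vector_derivative trig_series c t) (at t)" for t by (simp add: dd)
  show ?thesis
    unfolding unit_integral_derivative[OF der continuous_trig_series[OF assms]] by (simp add: trig_series_periodic)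
qed

lemma trig_series_scaleR: "summable (\<lambda>k. norm (c k)) \<Longrightarrow> trig_series (\<lambda>k. a * c k) t = a * trig_series c t"
  unfolding trig_series_def using suminf_mult[OF summable_trig_series, of c a t] by (simp only: mult.assoc[of a])

text \<open>With the first coefficient of modulus 1 and a small tail, the phase is a perturbed
  cosine: its first two derivatives are close to multiples of a sine and a cosine, which never
  vanish together. The cubes are there because three derivatives are needed. The constant 36000 is a
  generous value of \<open>(C1 + 1) * (1 + 2 * C2)\<close> for
  \<open>C1 = 1.1 * (2 * pi)\<^sup>2\<close> and \<open>C2 = 1.1 * (2 * pi) ^ 3\<close>.\<close>

lemma trig_series_oscillation:
  fixes \<beta> :: "nat \<Rightarrow> complex"
  assumes b0: "norm (\<beta> 0) = 1" and s: "summable (\<lambda>k. real (Suc k) ^ 3 * norm (\<beta> k))"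
    and small: "(\<Sum>k. real (Suc (Suc k)) ^ 3 * norm (\<beta> (Suc k))) \<le> 1 / 10" and A: "A \<ge> 1"
  shows "norm (LINT t|unit_measure. cis (A * Re (trig_series \<beta> t))) \<le> 36000 / sqrt A"
proof -
  define c1 where "c1 = trig_deriv \<beta>"
  define c2 where "c2 = trig_deriv c1"
  define c3 where "c3 = trig_deriv c2"
  have sj: "summable (\<lambda>k. real (Suc k) ^ j * norm (\<beta> k))" if "j \<le> 3" for j
  proof (rule summable_comparison_test'[OF s])
    fix k
    have "real (Suc k) ^ j \<le> real (Suc k) ^ 3" using that by (intro power_increasing) auto
    then show "norm (real (Suc k) ^ j * norm (\<beta> k)) \<le> real (Suc k) ^ 3 * norm (\<beta> k)"
      by (simp add: mult_right_mono abs_mult del: of_nat_Suc)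
  qed
  have n1: "norm (c1 k) = 2 * pi * (real (Suc k) ^ 1 * norm (\<beta> k))" for k
    by (simp add: c1_def norm_trig_deriv del: of_nat_Suc)
  have n2: "norm (c2 k) = (2 * pi)\<^sup>2 * (real (Suc k) ^ 2 * norm (\<beta> k))" for k
    by (simp add: c2_def norm_trig_deriv n1 power2_eq_square mult_ac del: of_nat_Suc)
  have n3: "norm (c3 k) = (2 * pi) ^ 3 * (real (Suc k) ^ 3 * norm (\<beta> k))" for k
    by (simp add: c3_def norm_trig_deriv n2 power2_eq_square power3_eq_cube mult_ac del: of_nat_Suc)
  have s0: "summable (\<lambda>k. norm (\<beta> k))" "summable (\<lambda>k. real (Suc k) * norm (\<beta> k))"
    using sj[of 0] sj[of 1] by (simp_all del: of_nat_Suc)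
  have s1: "summable (\<lambda>k. norm (c1 k))" "summable (\<lambda>k. real (Suc k) * norm (c1 k))"
    unfolding n1 using summable_mult[OF sj[of 1], of "2 * pi"] summable_mult[OF sj[of 2], of "2 * pi"]
    by (simp_all add: power2_eq_square mult_ac del: of_nat_Suc)
  have s2: "summable (\<lambda>k. norm (c2 k))" "summable (\<lambda>k. real (Suc k) * norm (c2 k))"
    unfolding n2 using summable_mult[OF sj[of 2], of "(2 * pi)\<^sup>2"] summable_mult[OF sj[of 3], of "(2 * pi)\<^sup>2"]
    by (simp_all add: power2_eq_square power3_eq_cube mult_ac del: of_nat_Suc)
  have s3: "summable (\<lambda>k. norm (c3 k))"
    unfolding n3 by (intro summable_mult s)
  have tail: "(\<Sum>k. real (Suc (Suc k)) ^ j * norm (\<beta> (Suc k))) \<le> 1 / 10" and tails: "summable (\<lambda>k. real (Suc (Suc k)) ^ j * norm (\<beta> (Suc k)))" if "j \<le> 3" for j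
  proof -
    have S: "summable (\<lambda>k. real (Suc (Suc k)) ^ i * norm (\<beta> (Suc k)))" if "i \<le> 3" for i
      using sj[OF that] by (subst (asm) summable_Suc_iff[symmetric])
    show "summable (\<lambda>k. real (Suc (Suc k)) ^ j * norm (\<beta> (Suc k)))" by (rule S[OF that])
    have "(\<Sum>k. real (Suc (Suc k)) ^ j * norm (\<beta> (Suc k))) \<le> (\<Sum>k. real (Suc (Suc k)) ^ 3 * norm (\<beta> (Suc k)))"
      using that by (intro suminf_le S mult_right_mono power_increasing) auto
    with small show "(\<Sum>k. real (Suc (Suc k)) ^ j * norm (\<beta> (Suc k))) \<le> 1 / 10" by simp
  qed
  define w where "w t = \<beta> 0 * cis (- (2 * pi * t))" for t
  have nw: "norm (w t) = 1" for t by (simp add: w_def norm_mult b0)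
  have approx: "norm (trig_series c t - c 0 * cis (- (2 * pi * t))) \<le> K / 10"
    if "summable (\<lambda>k. norm (c k))" "\<And>k. norm (c k) = K * (real (Suc k) ^ j * norm (\<beta> k))" "j \<le> 3" "K \<ge> 0" for c K j t
  proof -
    have "norm (trig_series c t - c 0 * cis (- (2 * pi * t))) = norm (\<Sum>k. c (Suc k) * cis (- (2 * pi * real (Suc (Suc k)) * t)))"
      by (simp add: trig_series_split[OF that(1)])
    also have "\<dots> \<le> (\<Sum>k. K * (real (Suc (Suc k)) ^ j * norm (\<beta> (Suc k))))"
      by (rule norm_suminf_le[OF _ summable_mult[OF tails[OF that(3)]]]) (simp add: norm_mult that(2) del: of_nat_Suc)
    also have "\<dots> = K * (\<Sum>k. real (Suc (Suc k)) ^ j * norm (\<beta> (Suc k)))"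
      by (rule suminf_mult[OF tails[OF that(3)]])
    also have "\<dots> \<le> K * (1 / 10)" by (intro mult_left_mono tail that)
    finally show ?thesis by simp
  qed
  have D: "((\<lambda>t. Re (trig_series c t)) has_field_derivative Re (trig_series (trig_deriv c) t)) (at t)"
    if "summable (\<lambda>k. real (Suc k) * norm (c k))" for c t
    using trig_series_has_derivative[OF that] by (simp add: has_vector_derivative_complex_iff)
  have e1: "norm (trig_series c1 t - (- (2 * pi) * \<i>) * w t) \<le> 2 * pi / 10" for t
  proof -
    have "c1 0 = (- (2 * pi) * \<i>) * \<beta> 0" by (simp add: c1_def trig_deriv_def)
    then show ?thesis using approx[OF s1(1) n1, of t] by (simp add: w_def mult.assoc)
  qed
  have e2: "norm (trig_series c2 t - (- ((2 * pi)\<^sup>2)) * w t) \<le> (2 * pi)\<^sup>2 / 10" for t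
  proof -
    have "c2 0 = (- ((2 * pi)\<^sup>2)) * \<beta> 0"
      by (simp add: c1_def c2_def trig_deriv_def power2_eq_square mult_ac)
    then show ?thesis using approx[OF s2(1) n2, of t] by (simp add: w_def mult.assoc)
  qed
  have e3: "norm (trig_series c3 t) \<le> (2 * pi) ^ 3 * 1.1" for t
  proof -
    have "norm (c3 0 * cis (- (2 * pi * t))) = (2 * pi) ^ 3" by (simp add: norm_mult n3 b0)
    moreover have "norm (trig_series c3 t - c3 0 * cis (- (2 * pi * t))) \<le> (2 * pi) ^ 3 / 10"
      by (rule approx[OF s3 n3]) auto
    ultimately show ?thesis
      using norm_triangle_sub[of "trig_series c3 t" "c3 0 * cis (- (2 * pi * t))"] by simp
  qed
  have p3: "pi > 3" "pi < 3.2" using pi_gt3 pi_approx by simp_all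
  have bound: "norm (LINT t|unit_measure. cis (A * Re (trig_series \<beta> t))) \<le> ((2 * pi)\<^sup>2 * 1.1 + 1) * (1 + 2 * ((2 * pi) ^ 3 * 1.1)) / sqrt A"
  proof (rule oscillatory_integral_bound[where v = "\<lambda>t. Re (trig_series c1 t)" and v' = "\<lambda>t. Re (trig_series c2 t)" and v'' = "\<lambda>t. Re (trig_series c3 t)"])
    show "((\<lambda>t. Re (trig_series \<beta> t)) has_field_derivative Re (trig_series c1 t)) (at t)" for t
      unfolding c1_def by (rule D[OF s0(2)])
    show "((\<lambda>t. Re (trig_series c1 t)) has_field_derivative Re (trig_series c2 t)) (at t)" for t
      unfolding c2_def by (rule D[OF s1(2)])
    show "((\<lambda>t. Re (trig_series c2 t)) has_field_derivative Re (trig_series c3 t)) (at t)" for t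
      unfolding c3_def by (rule D[OF s2(2)])
    show "continuous_on UNIV (\<lambda>t. Re (trig_series c3 t))"
      by (intro continuous_intros continuous_trig_series s3)
    fix t
    show "\<bar>Re (trig_series c2 t)\<bar> \<le> (2 * pi)\<^sup>2 * 1.1"
    proof -
      have "norm ((- ((2 * pi)\<^sup>2)) * w t) = (2 * pi)\<^sup>2" by (simp add: norm_mult nw norm_power)
      then show ?thesis
        using abs_Re_le_cmod[of "trig_series c2 t"] norm_triangle_sub[of "trig_series c2 t" "(- ((2 * pi)\<^sup>2)) * w t"] e2[of t]
        by simp
    qed
    show "\<bar>Re (trig_series c3 t)\<bar> \<le> (2 * pi) ^ 3 * 1.1"
      using abs_Re_le_cmod[of "trig_series c3 t"] e3[of t] by simp
    show "1 \<le> (Re (trig_series c1 t))\<^sup>2 + (Re (trig_series c2 t))\<^sup>2"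
    proof -
      define x where "x = Re (trig_series c1 t) / (2 * pi)"
      define y where "y = Re (trig_series c2 t) / (2 * pi)\<^sup>2"
      have "\<bar>Re (trig_series c1 t) - 2 * pi * Im (w t)\<bar> \<le> 2 * pi / 10"
        using abs_Re_le_cmod[of "trig_series c1 t - (- (2 * pi) * \<i>) * w t"] e1[of t] by simp
      then have x: "\<bar>x - Im (w t)\<bar> \<le> 1 / 10"
        unfolding x_def using p3 by (simp add: field_simps abs_le_iff)
      have "\<bar>Re (trig_series c2 t) + (2 * pi)\<^sup>2 * Re (w t)\<bar> \<le> (2 * pi)\<^sup>2 / 10"
        using abs_Re_le_cmod[of "trig_series c2 t - (- ((2 * pi)\<^sup>2)) * w t"] e2[of t] by (simp add: Re_power2)
      moreover have "Re (trig_series c2 t) = (2 * pi)\<^sup>2 * y" using p3 by (simp add: y_def)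
      ultimately have "\<bar>(2 * pi)\<^sup>2 * (y + Re (w t))\<bar> \<le> (2 * pi)\<^sup>2 / 10" by (simp only: distrib_left)
      then have "(2 * pi)\<^sup>2 * \<bar>y + Re (w t)\<bar> \<le> (2 * pi)\<^sup>2 * (1 / 10)" by (simp only: abs_mult abs_power2)
      then have y: "\<bar>y + Re (w t)\<bar> \<le> 1 / 10"
        using p3 by (subst (asm) mult_le_cancel_left_pos) auto
      have w1: "(Re (w t))\<^sup>2 + (Im (w t))\<^sup>2 = 1" using nw[of t] by (simp add: cmod_def)
      \<comment> \<open>An error of \<open>1 / 10\<close> costs a factor 2 and
        \<open>1 / 100\<close>. After normalisation the two squares thus still add up to at least
        \<open>1 / 2 - 1 / 50\<close>, and undoing the normalisation multiplies each by at least
        36.\<close>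
      have half: "u\<^sup>2 \<ge> z\<^sup>2 / 2 - 1 / 100" if "\<bar>u - z\<bar> \<le> 1 / 10" for u z :: real
      proof -
        have "(u - z)\<^sup>2 \<le> (1 / 10)\<^sup>2" using that by (intro power2_le_iff_abs_le[THEN iffD2]) auto
        moreover have "z\<^sup>2 \<le> 2 * u\<^sup>2 + 2 * (u - z)\<^sup>2"
          using zero_le_power2[of "2 * u - z"] by (simp add: power2_eq_square algebra_simps)
        ultimately show ?thesis by (simp add: power2_eq_square)
      qed
      have "x\<^sup>2 + y\<^sup>2 \<ge> 1 / 4"
        using half[OF x] half[of y "- Re (w t)"] y w1 by simp
      moreover have "x\<^sup>2 \<le> (Re (trig_series c1 t))\<^sup>2 / 36"
      proof -
        have "(Re (trig_series c1 t))\<^sup>2 = (2 * pi)\<^sup>2 * x\<^sup>2" using p3 by (simp add: x_def power_divide)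
        moreover have "(2 * pi)\<^sup>2 * x\<^sup>2 \<ge> 6\<^sup>2 * x\<^sup>2" using p3 by (intro mult_right_mono power_mono) auto
        ultimately show ?thesis by simp
      qed
      moreover have "y\<^sup>2 \<le> (Re (trig_series c2 t))\<^sup>2 / 36"
      proof -
        have "(Re (trig_series c2 t))\<^sup>2 = ((2 * pi)\<^sup>2)\<^sup>2 * y\<^sup>2" using p3 by (simp add: y_def power_divide)
        moreover have "6\<^sup>2 \<le> (2 * pi)\<^sup>2" using p3 by (intro power_mono) auto
        then have "((2 * pi)\<^sup>2)\<^sup>2 * y\<^sup>2 \<ge> 6\<^sup>2 * y\<^sup>2" 
          using self_le_power[of "(2 * pi)\<^sup>2" 2] by (intro mult_right_mono) auto
        ultimately show ?thesis by simp
      qed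
      ultimately show ?thesis by linarith
    qed
  qed (use A trig_series_periodic in auto)
  also have "\<dots> \<le> 36000 / sqrt A"
  proof (intro divide_right_mono)
    have a: "(2 * pi)\<^sup>2 \<le> 6.4\<^sup>2" "(2 * pi) ^ 3 \<le> 6.4 ^ 3"
      using p3 by (intro power_mono; simp)+
    have "((2 * pi)\<^sup>2 * 1.1 + 1) * (1 + 2 * ((2 * pi) ^ 3 * 1.1)) \<le> (6.4\<^sup>2 * 1.1 + 1) * (1 + 2 * (6.4 ^ 3 * 1.1))"
      using a by (intro mult_mono add_mono mult_left_mono mult_right_mono) auto
    also have "\<dots> \<le> 36000" by (simp add: power2_eq_square power3_eq_cube)
    finally show "((2 * pi)\<^sup>2 * 1.1 + 1) * (1 + 2 * ((2 * pi) ^ 3 * 1.1)) \<le> 36000" .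
  qed (use A in auto)
  finally show ?thesis .
qed

section \<open>Moments of sums of independent terms\<close>

interpretation cube: product_sigma_finite "\<lambda>_::nat. unit_measure" ..

abbreviation cube_measure :: "nat set \<Rightarrow> (nat \<Rightarrow> real) measure" where
  "cube_measure I \<equiv> PiM I (\<lambda>_. unit_measure)"

lemma borel_measurable_cnj [measurable]: "cnj \<in> borel_measurable borel"
  by (intro borel_measurable_continuous_onI continuous_intros)

lemma prob_space_cube: "prob_space (cube_measure I)"
  by (rule prob_space_PiM) (rule prob_space_unit_measure)

text \<open>
  Here \<open>x m\<close> and \<open>g m\<close> stand for the contributions of the \<open>m\<close>-th prime to the phase and to the
  logarithmic derivative; \<open>V\<close> bounds all second moments, independently of the number of primes.
\<close>

locale independent_terms =
  fixes x :: "nat \<Rightarrow> real \<Rightarrow> real" and g :: "nat \<Rightarrow> real \<Rightarrow> complex" and X G :: "nat \<Rightarrow> real" and V :: real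
  assumes x_meas [measurable]: "\<And>m. x m \<in> borel_measurable borel"
    and g_meas [measurable]: "\<And>m. g m \<in> borel_measurable borel"
    and x_bound: "\<And>m t. \<bar>x m t\<bar> \<le> X m" and g_bound: "\<And>m t. norm (g m t) \<le> G m"
    and x_mean: "\<And>m. (LINT t|unit_measure. x m t) = 0" and g_mean: "\<And>m. (LINT t|unit_measure. g m t) = 0"
    and V: "\<And>I. finite I \<Longrightarrow> 1 + (\<Sum>m\<in>I. (G m)\<^sup>2) \<le> V"
begin

definition phase :: "nat set \<Rightarrow> (nat \<Rightarrow> real) \<Rightarrow> complex" where
  "phase I \<theta> = cis (\<Sum>m\<in>I. x m (\<theta> m))"

definition amp :: "nat set \<Rightarrow> (nat \<Rightarrow> real) \<Rightarrow> complex" where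
  "amp I \<theta> = (\<Sum>m\<in>I. g m (\<theta> m))"

definition moment0 :: "nat set \<Rightarrow> complex" where
  "moment0 I = (LINT \<theta>|cube_measure I. phase I \<theta>)"
definition moment1 :: "nat set \<Rightarrow> complex" where
  "moment1 I = (LINT \<theta>|cube_measure I. phase I \<theta> * amp I \<theta>)"
definition moment1' :: "nat set \<Rightarrow> complex" where
  "moment1' I = (LINT \<theta>|cube_measure I. phase I \<theta> * cnj (amp I \<theta>))"
definition moment2 :: "nat set \<Rightarrow> complex" where
  "moment2 I = (LINT \<theta>|cube_measure I. phase I \<theta> * (norm (amp I \<theta>))\<^sup>2)"

definition local0 :: "nat \<Rightarrow> complex" where
  "local0 m = (LINT t|unit_measure. cis (x m t))"
definition local1 :: "nat \<Rightarrow> complex" where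
  "local1 m = (LINT t|unit_measure. cis (x m t) * g m t)"
definition local1' :: "nat \<Rightarrow> complex" where
  "local1' m = (LINT t|unit_measure. cis (x m t) * cnj (g m t))"
definition local2 :: "nat \<Rightarrow> complex" where
  "local2 m = (LINT t|unit_measure. cis (x m t) * (norm (g m t))\<^sup>2)"

lemma component_measurable: "m \<in> I \<Longrightarrow> f \<in> borel_measurable borel \<Longrightarrow> (\<lambda>\<theta>. f (\<theta> m)) \<in> borel_measurable (cube_measure I)"
  by (rule measurable_compose[of _ _ unit_measure]) auto

lemma phase_measurable [measurable]: "phase I \<in> borel_measurable (cube_measure I)"
proof -
  have "(\<lambda>\<theta>. \<Sum>m\<in>I. x m (\<theta> m)) \<in> borel_measurable (cube_measure I)"
    by (intro borel_measurable_sum component_measurable[OF _ x_meas])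
  moreover have "cis \<in> borel_measurable borel"
    by (intro borel_measurable_continuous_onI continuous_intros)
  ultimately show ?thesis
    unfolding phase_def[abs_def] by (rule measurable_compose)
qed

lemma amp_measurable [measurable]: "amp I \<in> borel_measurable (cube_measure I)"
  unfolding amp_def by (intro borel_measurable_sum component_measurable[OF _ g_meas])

lemma norm_amp_le: "norm (amp I \<theta>) \<le> (\<Sum>m\<in>I. G m)"
  unfolding amp_def by (rule order_trans[OF norm_sum sum_mono]) (rule g_bound)

lemma norm_phase [simp]: "norm (phase I \<theta>) = 1"
  by (simp add: phase_def)

lemma cube_integrable:
  fixes f :: "(nat \<Rightarrow> real) \<Rightarrow> 'b::{banach,second_countable_topology}"
  assumes "f \<in> borel_measurable (cube_measure I)" "\<And>\<theta>. norm (f \<theta>) \<le> B"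
  shows "integrable (cube_measure I) f"
proof -
  interpret prob_space "cube_measure I" by (rule prob_space_cube)
  show ?thesis using assms by (intro integrable_const_bound[where B = B]) auto
qed

lemma moment_integrable:
  shows "integrable (cube_measure I) (phase I)"
    and "integrable (cube_measure I) (\<lambda>\<theta>. phase I \<theta> * amp I \<theta>)"
    and "integrable (cube_measure I) (\<lambda>\<theta>. phase I \<theta> * cnj (amp I \<theta>))"
    and "integrable (cube_measure I) (\<lambda>\<theta>. phase I \<theta> * (norm (amp I \<theta>))\<^sup>2)"
proof -
  note n = norm_amp_le[of I]
  have sq: "norm (of_real ((norm (amp I \<theta>))\<^sup>2) :: complex) \<le> (\<Sum>m\<in>I. G m)\<^sup>2" for \<theta>
    unfolding norm_of_real using n[of \<theta>] by (simp add: power_mono)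
  show "integrable (cube_measure I) (phase I)"
    by (rule cube_integrable[where B = 1]) auto
  show "integrable (cube_measure I) (\<lambda>\<theta>. phase I \<theta> * amp I \<theta>)"
    by (rule cube_integrable[where B = "\<Sum>m\<in>I. G m"]) (use n in \<open>auto simp: norm_mult\<close>)
  show "integrable (cube_measure I) (\<lambda>\<theta>. phase I \<theta> * cnj (amp I \<theta>))"
    by (rule cube_integrable[where B = "\<Sum>m\<in>I. G m"]) (use n in \<open>auto simp: norm_mult\<close>)
  show "integrable (cube_measure I) (\<lambda>\<theta>. phase I \<theta> * (norm (amp I \<theta>))\<^sup>2)"
    by (rule cube_integrable[where B = "(\<Sum>m\<in>I. G m)\<^sup>2"]) (use sq in \<open>auto simp only: norm_mult norm_phase mult_1\<close>, measurable)
qed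

lemma local_integrable:
  shows "integrable unit_measure (\<lambda>t. cis (x m t))"
    and "integrable unit_measure (\<lambda>t. cis (x m t) * g m t)"
    and "integrable unit_measure (\<lambda>t. cis (x m t) * cnj (g m t))"
    and "integrable unit_measure (\<lambda>t. cis (x m t) * (norm (g m t))\<^sup>2)"
proof -
  have [measurable]: "(\<lambda>t. cis (x m t)) \<in> borel_measurable borel"
    by (rule measurable_compose[OF x_meas]) (intro borel_measurable_continuous_onI continuous_intros)
  have sq: "norm (of_real ((norm (g m t))\<^sup>2) :: complex) \<le> (G m)\<^sup>2" for t
    unfolding norm_of_real using g_bound[of m t] by (simp add: power_mono)
  show "integrable unit_measure (\<lambda>t. cis (x m t))"
    by (rule unit_integrable_bounded[where B = 1]) auto
  show "integrable unit_measure (\<lambda>t. cis (x m t) * g m t)"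
    by (rule unit_integrable_bounded[where B = "G m"]) (use g_bound in \<open>auto simp: norm_mult\<close>)
  show "integrable unit_measure (\<lambda>t. cis (x m t) * cnj (g m t))"
    by (rule unit_integrable_bounded[where B = "G m"]) (use g_bound in \<open>auto simp: norm_mult\<close>)
  show "integrable unit_measure (\<lambda>t. cis (x m t) * (norm (g m t))\<^sup>2)"
    by (rule unit_integrable_bounded[where B = "(G m)\<^sup>2"]) (use sq in \<open>auto simp only: norm_mult norm_cis mult_1\<close>, measurable)
qed

lemma phase_upd: "finite I \<Longrightarrow> i \<notin> I \<Longrightarrow> phase (insert i I) (\<theta>(i := t)) = phase I \<theta> * cis (x i t)"
proof -
  assume a: "finite I" "i \<notin> I"
  then have "(\<Sum>m\<in>I. x m ((\<theta>(i := t)) m)) = (\<Sum>m\<in>I. x m (\<theta> m))"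
    by (intro sum.cong) auto
  with a show ?thesis by (simp add: phase_def cis_mult add.commute)
qed

lemma amp_upd: "finite I \<Longrightarrow> i \<notin> I \<Longrightarrow> amp (insert i I) (\<theta>(i := t)) = amp I \<theta> + g i t"
proof -
  assume a: "finite I" "i \<notin> I"
  then have "(\<Sum>m\<in>I. g m ((\<theta>(i := t)) m)) = (\<Sum>m\<in>I. g m (\<theta> m))"
    by (intro sum.cong) auto
  with a show ?thesis by (simp add: amp_def add.commute)
qed

text \<open>Independence factorises every term after the expansion of
  \<open>\<bar>amp + g\<bar>\<^sup>2\<close>. The cross terms contain both \<open>amp\<close> and
  its conjugate; as the phase is not conjugated, \<open>moment1\<close> and \<open>moment1'\<close>
  are not conjugate to each other and both have to be carried along.\<close>

lemma moment_insert:
  assumes I: "finite I" "i \<notin> I"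
  shows "moment0 (insert i I) = moment0 I * local0 i"
    and "moment1 (insert i I) = moment1 I * local0 i + moment0 I * local1 i"
    and "moment1' (insert i I) = moment1' I * local0 i + moment0 I * local1' i"
    and "moment2 (insert i I) = moment2 I * local0 i + moment1 I * local1' i + moment1' I * local1 i + moment0 I * local2 i"
proof -
  note split = cube.product_integral_insert[OF I]
  note [simp] = phase_upd[OF I] amp_upd[OF I]
  note li = local_integrable[of i]
  note mi = moment_integrable[of I]
  show "moment0 (insert i I) = moment0 I * local0 i"
    unfolding moment0_def by (subst split[OF moment_integrable(1)]) (simp add: local0_def)
  have "moment1 (insert i I) = (LINT \<theta>|cube_measure I. LINT t|unit_measure.
     phase I \<theta> * amp I \<theta> * cis (x i t) + phase I \<theta> * (cis (x i t) * g i t))"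
    unfolding moment1_def by (subst split[OF moment_integrable(2)]) (simp add: algebra_simps)
  also have "\<dots> = moment1 I * local0 i + moment0 I * local1 i"
    using li mi by (simp add: local0_def local1_def moment0_def moment1_def)
  finally show "moment1 (insert i I) = moment1 I * local0 i + moment0 I * local1 i" .
  have "moment1' (insert i I) = (LINT \<theta>|cube_measure I. LINT t|unit_measure.
     phase I \<theta> * cnj (amp I \<theta>) * cis (x i t) + phase I \<theta> * (cis (x i t) * cnj (g i t)))"
    unfolding moment1'_def by (subst split[OF moment_integrable(3)]) (simp add: algebra_simps)
  also have "\<dots> = moment1' I * local0 i + moment0 I * local1' i"
    using li mi by (simp add: local0_def local1'_def moment0_def moment1'_def)
  finally show "moment1' (insert i I) = moment1' I * local0 i + moment0 I * local1' i" .
  have sq: "complex_of_real ((norm (a + b))\<^sup>2) = (norm a)\<^sup>2 + a * cnj b + cnj a * b + (norm b)\<^sup>2" for a b :: complex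
    by (simp only: complex_norm_square) (simp add: algebra_simps)
  have "moment2 (insert i I) = (LINT \<theta>|cube_measure I. LINT t|unit_measure.
     phase I \<theta> * (norm (amp I \<theta>))\<^sup>2 * cis (x i t) + phase I \<theta> * amp I \<theta> * (cis (x i t) * cnj (g i t))
     + phase I \<theta> * cnj (amp I \<theta>) * (cis (x i t) * g i t) + phase I \<theta> * (cis (x i t) * (norm (g i t))\<^sup>2))"
    unfolding moment2_def by (subst split[OF moment_integrable(4)]) (simp only: phase_upd[OF I] amp_upd[OF I] sq, simp add: algebra_simps)
  also have "\<dots> = (LINT \<theta>|cube_measure I. phase I \<theta> * (norm (amp I \<theta>))\<^sup>2 * local0 i + phase I \<theta> * amp I \<theta> * local1' i
     + phase I \<theta> * cnj (amp I \<theta>) * local1 i + phase I \<theta> * local2 i)"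
    using li by (simp add: local0_def local1_def local1'_def local2_def del: of_real_power)
  also have "\<dots> = moment2 I * local0 i + moment1 I * local1' i + moment1' I * local1 i + moment0 I * local2 i"
    using mi by (simp add: moment0_def moment1_def moment1'_def moment2_def del: of_real_power)
  finally show "moment2 (insert i I) = moment2 I * local0 i + moment1 I * local1' i + moment1' I * local1 i + moment0 I * local2 i" .
qed

end

text \<open>With vanishing phase the recursion computes the variance of a sum of independent terms.\<close>

lemma (in independent_terms) second_moment:
  assumes "finite I"
  shows "(LINT \<theta>|cube_measure I. (norm (amp I \<theta>))\<^sup>2) \<le> (\<Sum>m\<in>I. (G m)\<^sup>2)"
proof -
  interpret z: independent_terms "\<lambda>_ _. 0" g "\<lambda>_. 0" G V
    by standard (use g_bound g_mean V in auto)
  have l: "z.local0 i = 1" "z.local1 i = 0" "z.local1' i = 0" for i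
    using g_mean[of i] Bochner_Integration.integral_cnj[of unit_measure "g i"]
    by (simp_all add: z.local0_def z.local1_def z.local1'_def unit.prob_space[simplified])
  have l2: "z.local2 i = of_real (LINT t|unit_measure. (norm (g i t))\<^sup>2)" for i
    by (simp add: z.local2_def flip: of_real_power)
  have m: "z.moment2 I = of_real (LINT \<theta>|cube_measure I. (norm (amp I \<theta>))\<^sup>2)" for I
    by (simp add: z.moment2_def z.phase_def z.amp_def amp_def flip: of_real_power)
  have m0: "z.moment0 I = 1" for I
  proof -
    interpret prob_space "cube_measure I" by (rule prob_space_cube)
    show ?thesis using prob_space by (simp add: z.moment0_def z.phase_def)
  qed
  from assms show ?thesis
  proof (induction I rule: finite_induct)
    case (insert i I)
    have "z.moment2 (insert i I) = z.moment2 I + z.local2 i"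
      using z.moment_insert(4)[OF insert(1,2)] l m0 by simp
    then have "(LINT \<theta>|cube_measure (insert i I). (norm (amp (insert i I) \<theta>))\<^sup>2)
      = (LINT \<theta>|cube_measure I. (norm (amp I \<theta>))\<^sup>2) + (LINT t|unit_measure. (norm (g i t))\<^sup>2)"
      unfolding m l2 of_real_add[symmetric] of_real_eq_iff .
    also have "(LINT t|unit_measure. (norm (g i t))\<^sup>2) \<le> (G i)\<^sup>2"
      using unit_integral_norm_le[of "\<lambda>t. (norm (g i t))\<^sup>2" "(G i)\<^sup>2"] g_bound[of i] by (simp add: power_mono)
    finally show ?case using insert by simp
  qed (simp add: amp_def)
qed

context independent_terms begin

lemma V1: "V \<ge> 1" using V[of "{}"] by simp

lemma G_le_V: "G m \<le> V" "(G m)\<^sup>2 \<le> V"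
proof -
  show "(G m)\<^sup>2 \<le> V" using V[of "{m}"] by simp
  have "2 * G m \<le> 1 + (G m)\<^sup>2" using zero_le_power2[of "G m - 1"] by (simp add: power2_eq_square algebra_simps)
  then show "G m \<le> V" using V[of "{m}"] V1 by simp
qed

text \<open>The variance computation bounds the mean of \<open>1 + \<bar>amp\<bar>\<^sup>2\<close>
  by \<open>V\<close> for every finite index set, so the moments do not grow with the number of
  primes.\<close>

lemma norm_cube_integral_le:
  fixes f :: "(nat \<Rightarrow> real) \<Rightarrow> complex"
  assumes "f \<in> borel_measurable (cube_measure I)" "finite I" "\<And>\<theta>. norm (f \<theta>) \<le> (1 + (norm (amp I \<theta>))\<^sup>2)"
  shows "norm (LINT \<theta>|cube_measure I. f \<theta>) \<le> V"
proof -
  interpret prob_space "cube_measure I" by (rule prob_space_cube)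
  have ia: "integrable (cube_measure I) (\<lambda>\<theta>. (norm (amp I \<theta>))\<^sup>2)"
    using norm_amp_le[of I] by (intro cube_integrable[where B = "(\<Sum>m\<in>I. G m)\<^sup>2"]) (auto intro!: power_mono)
  have "integrable (cube_measure I) f"
    by (rule Bochner_Integration.integrable_bound[of _ "\<lambda>\<theta>. 1 + (norm (amp I \<theta>))\<^sup>2"]) (use ia assms in auto)
  then have "norm (LINT \<theta>|cube_measure I. f \<theta>) \<le> (LINT \<theta>|cube_measure I. 1 + (norm (amp I \<theta>))\<^sup>2)"
    using ia assms(3) by (intro order_trans[OF integral_norm_bound] integral_mono integrable_norm) auto
  also have "\<dots> = 1 + (LINT \<theta>|cube_measure I. (norm (amp I \<theta>))\<^sup>2)"
    using ia prob_space by simp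
  also have "\<dots> \<le> V" using second_moment[OF assms(2)] V[OF assms(2)] by linarith
  finally show ?thesis .
qed

lemma le_one_plus_square: "(r::real) \<le> 1 + r\<^sup>2"
proof -
  have "2 * r \<le> 1 + r\<^sup>2" using zero_le_power2[of "r - 1"] by (simp add: power2_eq_square algebra_simps)
  then show ?thesis using zero_le_power2[of r] by linarith
qed

lemma norm_moment_le:
  assumes "finite I"
  shows "norm (moment0 I) \<le> 1" "norm (moment1 I) \<le> V" "norm (moment1' I) \<le> V" "norm (moment2 I) \<le> V"
proof -
  interpret prob_space "cube_measure I" by (rule prob_space_cube)
  have "norm (moment0 I) \<le> (LINT \<theta>|cube_measure I. norm (phase I \<theta>))"
    unfolding moment0_def by (rule integral_norm_bound)
  then show "norm (moment0 I) \<le> 1" using prob_space by simp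
  show "norm (moment1 I) \<le> V" "norm (moment1' I) \<le> V" "norm (moment2 I) \<le> V"
    unfolding moment1_def moment1'_def moment2_def
    by (rule norm_cube_integral_le[OF _ assms]; auto simp: norm_mult norm_power le_one_plus_square)+
qed

lemma norm_local_le: "norm (local0 m) \<le> 1" "norm (local1 m) \<le> V" "norm (local1' m) \<le> V" "norm (local2 m) \<le> V"
  unfolding local0_def local1_def local1'_def local2_def
  using order_trans[OF g_bound G_le_V(1)] order_trans[OF power_mono[OF g_bound norm_ge_zero] G_le_V(2)]
  by (auto intro!: unit_integral_norm_le simp: norm_mult norm_power)

text \<open>Each new index of \<open>S\<close> contributes a factor \<open>\<kappa>\<close> unless
  the amplitude acts on it. This happens at most once in a first moment and twice in the second,
  which is why \<open>\<kappa>\<close> and \<open>\<kappa>\<^sup>2\<close> stand on the left; the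
  powers of \<open>1 + card S\<close> count the choices. The indices in \<open>J\<close> contribute
  no decay and are covered by the uniform bounds.\<close>

lemma moment_decay:
  assumes J: "finite J" and \<kappa>: "0 < \<kappa>" "\<kappa> \<le> 1"
    and S: "finite S" "J \<inter> S = {}" "\<And>m. m \<in> S \<Longrightarrow> norm (local0 m) \<le> \<kappa>"
  shows "norm (moment0 (J \<union> S)) \<le> \<kappa> ^ card S \<and> \<kappa> * norm (moment1 (J \<union> S)) \<le> \<kappa> ^ card S * ((1 + card S) * V)
     \<and> \<kappa> * norm (moment1' (J \<union> S)) \<le> \<kappa> ^ card S * ((1 + card S) * V)
     \<and> \<kappa>\<^sup>2 * norm (moment2 (J \<union> S)) \<le> \<kappa> ^ card S * ((1 + card S)\<^sup>2 * V\<^sup>2)"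
  using S
  proof (induction S rule: finite_induct)
    case empty
    have "\<kappa> * norm (moment1 J) \<le> 1 * V" "\<kappa> * norm (moment1' J) \<le> 1 * V"
      using \<kappa>(1,2) norm_moment_le[OF J] by (intro mult_mono; simp)+
    moreover have "\<kappa>\<^sup>2 * norm (moment2 J) \<le> 1 * V"
      using \<kappa>(1,2) norm_moment_le[OF J] by (intro mult_mono) (auto simp: power_le_one)
    moreover have "V \<le> V\<^sup>2" using V1 by (simp add: self_le_power)
    ultimately show ?case using norm_moment_le[OF J] by auto
  next
    case (insert i S)
    define k where "k = \<kappa> ^ card S"
    define r where "r = real (card S)"
    have k: "k > 0" using \<kappa>(1) by (simp add: k_def)
    have r: "r \<ge> 0" by (simp add: r_def)
    have IH: "norm (moment0 (J \<union> S)) \<le> k" "\<kappa> * norm (moment1 (J \<union> S)) \<le> k * ((1 + r) * V)"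
      "\<kappa> * norm (moment1' (J \<union> S)) \<le> k * ((1 + r) * V)" "\<kappa>\<^sup>2 * norm (moment2 (J \<union> S)) \<le> k * ((1 + r)\<^sup>2 * V\<^sup>2)"
      using insert by (auto simp: k_def r_def)
    have f: "finite (J \<union> S)" "i \<notin> J \<union> S" using insert J by auto
    have eq: "J \<union> insert i S = insert i (J \<union> S)" by simp
    have li: "norm (local0 i) \<le> \<kappa>" using insert by simp
    note lv = norm_local_le[of i]
    have V0: "V \<ge> 0" using V1 by simp
    have m0: "norm (moment0 (J \<union> insert i S)) \<le> k * \<kappa>"
      unfolding eq moment_insert(1)[OF f] norm_mult using IH(1) li k by (intro mult_mono) auto
    have first: "\<kappa> * norm (a * local0 i + moment0 (J \<union> S) * b) \<le> k * \<kappa> * ((2 + r) * V)"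
      if "\<kappa> * norm a \<le> k * ((1 + r) * V)" "norm b \<le> V" for a b
    proof -
      have "\<kappa> * norm (a * local0 i + moment0 (J \<union> S) * b) \<le> \<kappa> * (norm a * norm (local0 i) + norm (moment0 (J \<union> S)) * norm b)"
        using \<kappa>(1) by (intro mult_left_mono) (auto intro: order_trans[OF norm_triangle_ineq] simp: norm_mult)
      also have "\<dots> = (\<kappa> * norm a) * norm (local0 i) + \<kappa> * (norm (moment0 (J \<union> S)) * norm b)" by (simp add: algebra_simps)
      also have "\<dots> \<le> (k * ((1 + r) * V)) * \<kappa> + \<kappa> * (k * V)"
      proof (intro add_mono)
        show "(\<kappa> * norm a) * norm (local0 i) \<le> (k * ((1 + r) * V)) * \<kappa>"
          by (rule mult_mono[OF that(1) li]) (use k V0 r in auto)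
        show "\<kappa> * (norm (moment0 (J \<union> S)) * norm b) \<le> \<kappa> * (k * V)"
          using that IH(1) \<kappa>(1) k by (intro mult_left_mono mult_mono) auto
      qed
      finally show ?thesis by (simp add: algebra_simps)
    qed
    have m1: "\<kappa> * norm (moment1 (J \<union> insert i S)) \<le> k * \<kappa> * ((2 + r) * V)"
      unfolding eq moment_insert(2)[OF f] by (rule first[OF IH(2) lv(2)])
    have m1': "\<kappa> * norm (moment1' (J \<union> insert i S)) \<le> k * \<kappa> * ((2 + r) * V)"
      unfolding eq moment_insert(3)[OF f] by (rule first[OF IH(3) lv(3)])
    have m2: "\<kappa>\<^sup>2 * norm (moment2 (J \<union> insert i S)) \<le> k * \<kappa> * ((2 + r)\<^sup>2 * V\<^sup>2)"
    proof -
      let ?m2 = "norm (moment2 (J \<union> S))" and ?m1 = "norm (moment1 (J \<union> S))" and ?m1' = "norm (moment1' (J \<union> S))" and ?m0 = "norm (moment0 (J \<union> S))"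
      have "\<kappa>\<^sup>2 * norm (moment2 (J \<union> insert i S)) \<le> \<kappa>\<^sup>2 * (?m2 * norm (local0 i) + ?m1 * norm (local1' i) + ?m1' * norm (local1 i) + ?m0 * norm (local2 i))"
        unfolding eq moment_insert(4)[OF f] norm_mult[symmetric] by (intro mult_left_mono norm_triangle_mono) auto
      also have "\<dots> = (\<kappa>\<^sup>2 * ?m2) * norm (local0 i) + \<kappa> * ((\<kappa> * ?m1) * norm (local1' i)) + \<kappa> * ((\<kappa> * ?m1') * norm (local1 i)) + \<kappa>\<^sup>2 * (?m0 * norm (local2 i))"
        by (simp add: algebra_simps power2_eq_square)
      also have "\<dots> \<le> (k * ((1 + r)\<^sup>2 * V\<^sup>2)) * \<kappa> + \<kappa> * ((k * ((1 + r) * V)) * V) + \<kappa> * ((k * ((1 + r) * V)) * V) + \<kappa> * (k * V\<^sup>2)"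
      proof (intro add_mono)
        show "(\<kappa>\<^sup>2 * ?m2) * norm (local0 i) \<le> (k * ((1 + r)\<^sup>2 * V\<^sup>2)) * \<kappa>"
          by (rule mult_mono[OF IH(4) li]) (use k in auto)
        show "\<kappa> * ((\<kappa> * ?m1) * norm (local1' i)) \<le> \<kappa> * ((k * ((1 + r) * V)) * V)"
          by (rule mult_left_mono[OF mult_mono[OF IH(2) lv(3)]]) (use \<kappa>(1) k r V0 in auto)
        show "\<kappa> * ((\<kappa> * ?m1') * norm (local1 i)) \<le> \<kappa> * ((k * ((1 + r) * V)) * V)"
          by (rule mult_left_mono[OF mult_mono[OF IH(3) lv(2)]]) (use \<kappa>(1) k r V0 in auto)
        have "V \<le> V\<^sup>2" using V1 by (simp add: self_le_power)
        then have "norm (local2 i) \<le> V\<^sup>2" using lv(4) by simp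
        moreover have "\<kappa>\<^sup>2 \<le> \<kappa>" using \<kappa>(1,2) by (simp add: power2_eq_square mult_left_le)
        ultimately show "\<kappa>\<^sup>2 * (?m0 * norm (local2 i)) \<le> \<kappa> * (k * V\<^sup>2)"
          using IH(1) \<kappa>(1) k by (intro mult_mono) auto
      qed
      \<comment> \<open>The numbers of terms add up to a square:
        \<open>(1 + r)\<^sup>2 + 2 * (1 + r) + 1 = (2 + r)\<^sup>2\<close>.\<close>
      also have "\<dots> = k * \<kappa> * ((2 + r)\<^sup>2 * V\<^sup>2)" by (simp add: algebra_simps power2_eq_square)
      finally show ?thesis .
    qed
    have "\<kappa> ^ card (insert i S) = k * \<kappa>" "1 + real (card (insert i S)) = 2 + r"
      using insert(1,2) by (simp_all add: k_def r_def mult.commute)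
    then show ?case using m0 m1 m1' m2 by simp
  qed

text \<open>The mean values being zero, \<open>\<i> * x\<close> can be subtracted from
  \<open>cis x - 1\<close>, and \<open>g\<close> from \<open>cis x * g\<close>, without changing the
  integrals. All linear contributions disappear and the bounds become quadratic in \<open>X\<close>
  and \<open>G\<close>.\<close>

lemma local_small:
  shows "norm (local0 m - 1) \<le> (X m)\<^sup>2" "norm (local1 m) \<le> X m * G m" "norm (local1' m) \<le> X m * G m" "norm (local2 m) \<le> (G m)\<^sup>2"
proof -
  have G0: "G m \<ge> 0" using g_bound[of m 0] norm_ge_zero order_trans by blast
  have X0: "X m \<ge> 0" using x_bound[of m 0] by linarith
  have ix: "integrable unit_measure (x m)" by (rule unit_integrable_bounded[of _ "X m"]) (use x_bound in auto)
  have ig: "integrable unit_measure (g m)" by (rule unit_integrable_bounded[of _ "G m"]) (use g_bound in auto)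
  note li = local_integrable[of m]
  have "local0 m - 1 = (LINT t|unit_measure. cis (x m t) - 1 - \<i> * x m t)"
    using li(1) ix x_mean[of m] by (simp add: local0_def unit.prob_space[simplified])
  also have "norm \<dots> \<le> (X m)\<^sup>2"
  proof (rule unit_integral_norm_le)
    fix t
    have "norm (cis (x m t) - 1 - \<i> * x m t) \<le> \<bar>x m t\<bar>\<^sup>2 / 2"
      using iexp_approx1[of "x m t" 1] by (simp add: cis_conv_exp power2_eq_square diff_diff_eq)
    also have "\<dots> \<le> (X m)\<^sup>2 / 2" by (intro divide_right_mono power_mono x_bound) auto
    finally show "norm (cis (x m t) - 1 - \<i> * x m t) \<le> (X m)\<^sup>2"
      using zero_le_power2[of "X m"] by linarith
  qed
  finally show "norm (local0 m - 1) \<le> (X m)\<^sup>2" .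
  have c: "norm (cis (x m t) - 1) \<le> X m" for t
    using norm_cis_minus_1_le[of "x m t"] x_bound[of m t] by linarith
  have "local1 m = (LINT t|unit_measure. (cis (x m t) - 1) * g m t)"
    using li(2) ig g_mean[of m] by (simp add: local1_def left_diff_distrib)
  also have "norm \<dots> \<le> X m * G m"
    unfolding norm_mult by (intro unit_integral_norm_le) (auto simp: norm_mult intro!: mult_mono c g_bound X0)
  finally show "norm (local1 m) \<le> X m * G m" .
  have "local1' m = (LINT t|unit_measure. (cis (x m t) - 1) * cnj (g m t))"
    using li(3) ig g_mean[of m] by (simp add: local1'_def left_diff_distrib)
  also have "norm \<dots> \<le> X m * G m"
    by (intro unit_integral_norm_le) (auto simp: norm_mult intro!: mult_mono c g_bound X0)
  finally show "norm (local1' m) \<le> X m * G m" .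
  show "norm (local2 m) \<le> (G m)\<^sup>2"
    unfolding local2_def by (intro unit_integral_norm_le) (auto simp: norm_mult norm_power intro!: power_mono g_bound)
qed

text \<open>The four quadratic bounds combine to \<open>X\<^sup>2 + 2 * X * G + G\<^sup>2\<close>.
  Square summability of \<open>X\<close> and \<open>G\<close> therefore makes the increments
  summable.\<close>

lemma moment2_step:
  assumes "finite I" "i \<notin> I"
  shows "norm (moment2 (insert i I) - moment2 I) \<le> V * (X i + G i)\<^sup>2"
proof -
  note ls = local_small[of i] and nm = norm_moment_le[OF assms(1)]
  have X0: "X i \<ge> 0" "G i \<ge> 0" using x_bound[of i 0] g_bound[of i 0] norm_ge_zero order_trans by (linarith, blast)
  have eq: "moment2 (insert i I) - moment2 I = moment2 I * (local0 i - 1) + moment1 I * local1' i + moment1' I * local1 i + moment0 I * local2 i"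
    unfolding moment_insert(4)[OF assms] by (simp add: algebra_simps)
  have "norm (moment2 (insert i I) - moment2 I) \<le> norm (moment2 I) * norm (local0 i - 1) + norm (moment1 I) * norm (local1' i) + norm (moment1' I) * norm (local1 i) + norm (moment0 I) * norm (local2 i)"
    unfolding eq norm_mult[symmetric] by (intro norm_triangle_mono) auto
  also have "\<dots> \<le> V * (X i)\<^sup>2 + V * (X i * G i) + V * (X i * G i) + V * (G i)\<^sup>2"
    using ls nm V1 X0 by (intro add_mono mult_mono) auto
  also have "\<dots> = V * (X i + G i)\<^sup>2" by (simp add: power2_eq_square algebra_simps)
  finally show ?thesis .
qed

end

section \<open>Sums over primes\<close>

text \<open>The integral test in telescoping form: \<open>1 / (n + 1) \<le> ln (1 + 1 / n)\<close>
  bounds each term by \<open>(n powr (- \<delta>) - (n + 1) powr (- \<delta>)) / \<delta>\<close>.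
  The induction carries the subtracted end term, which is dropped afterwards.\<close>

lemma sum_powr_minus_le:
  fixes \<delta> :: real
  assumes "\<delta> > 0"
  shows "(\<Sum>n=1..N. real n powr (- (1 + \<delta>))) \<le> 1 + 1 / \<delta>"
proof -
  have "(\<Sum>n=1..Suc N. real n powr (- (1 + \<delta>))) \<le> 1 + (1 - real (Suc N) powr (- \<delta>)) / \<delta>" for N
  proof (induction N)
    case (Suc N)
    define n where "n = real (Suc N)"
    have n: "n > 0" by (simp add: n_def)
    have "1 / (n + 1) \<le> ln (1 + 1 / n)"
    proof -
      have "ln (n / (n + 1)) \<le> n / (n + 1) - 1"
        using n by (intro ln_le_minus_one) auto
      moreover have "ln (n / (n + 1)) = - ln (1 + 1 / n)"
        using n by (simp add: ln_div add_divide_distrib[symmetric] divide_simps flip: ln_inverse)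
      ultimately show ?thesis using n by (simp add: field_simps)
    qed
    then have "1 + \<delta> / (n + 1) \<le> 1 + \<delta> * ln (1 + 1 / n)"
      using assms by (simp add: mult_left_mono divide_inverse)
    also have "\<dots> \<le> exp (\<delta> * ln (1 + 1 / n))" by (rule exp_ge_add_one_self)
    also have "\<dots> = (1 + 1 / n) powr \<delta>" using n add_pos_pos[of 1 "1 / n"] by (simp add: powr_def less_imp_neq[symmetric])
    finally have "(n + 1) powr (- \<delta>) * (1 + \<delta> / (n + 1)) \<le> (n + 1) powr (- \<delta>) * (1 + 1 / n) powr \<delta>"
      by (rule mult_left_mono) simp
    also have "\<dots> = n powr (- \<delta>)"
    proof -
      have "1 + 1 / n = (n + 1) / n" using n by (simp add: field_simps)
      then show ?thesis using n by (simp add: powr_divide powr_minus field_simps)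
    qed
    finally have h1: "(n + 1) powr (- \<delta>) + \<delta> * ((n + 1) powr (- \<delta>) / (n + 1)) \<le> n powr (- \<delta>)"
      by (simp add: algebra_simps)
    have h2: "(n + 1) powr (- \<delta>) / (n + 1) = (n + 1) powr (- (1 + \<delta>))"
      using n by (simp add: powr_diff powr_minus powr_add divide_inverse)
    have "(n + 1) powr (- (1 + \<delta>)) \<le> (n powr (- \<delta>) - (n + 1) powr (- \<delta>)) / \<delta>"
      unfolding pos_le_divide_eq[OF assms] using h1 unfolding h2 by (simp add: algebra_simps)
    moreover have "real (Suc (Suc N)) = n + 1" by (simp add: n_def)
    ultimately show ?case
      using Suc by (simp add: n_def[symmetric] diff_divide_distrib add.commute)
  qed simp
  moreover have "(1 - real (Suc N) powr (- \<delta>)) / \<delta> \<le> 1 / \<delta>" for N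
    using assms by (intro divide_right_mono) auto
  ultimately have *: "(\<Sum>n=1..Suc N. real n powr (- (1 + \<delta>))) \<le> 1 + 1 / \<delta>" for N
    by (meson add_left_mono order_trans)
  show ?thesis
  proof (cases N)
    case 0
    then show ?thesis using assms by simp
  qed (use * in simp)
qed

text \<open>The set is recovered from its product as the set of prime divisors.\<close>

lemma inj_on_prod_primes:
  fixes P :: "nat set"
  assumes "finite P" "\<And>p. p \<in> P \<Longrightarrow> prime p"
  shows "inj_on (\<lambda>A. \<Prod>p\<in>A. p) (Pow P)"
proof (rule inj_on_inverseI)
  fix A assume "A \<in> Pow P"
  then have f: "finite A" and pr: "\<And>p. p \<in> A \<Longrightarrow> prime p"
    using assms finite_subset by auto
  have "q dvd (\<Prod>p\<in>A. p) \<longleftrightarrow> q \<in> A" if q: "prime q" for q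
  proof
    assume "q dvd (\<Prod>p\<in>A. p)"
    then obtain p where "p \<in> A" "q dvd p" using prime_dvd_prod_iff[OF f, of q "\<lambda>p. p"] q by auto
    then show "q \<in> A" using pr primes_dvd_imp_eq[OF q] by auto
  qed (use f in auto)
  then show "{q. prime q \<and> q dvd (\<Prod>p\<in>A. p)} = A" using pr by auto
qed

text \<open>Compare the truncated Euler product with the Dirichlet series at \<open>s = 1 + 1 / ln x\<close>.\<close>

lemma sum_prime_reciprocals_le:
  fixes x :: real
  assumes x: "x > 0" and "ln x \<ge> 2"
  shows "(\<Sum>p | prime p \<and> real p \<le> x. 1 / real p) \<le> 12 * ln (ln x)"
proof -
  define P where "P = {p::nat. prime p \<and> real p \<le> x}"
  define \<delta> where "\<delta> = 1 / ln x"
  have \<delta>: "\<delta> > 0" unfolding \<delta>_def using assms(2) by (intro divide_pos_pos) linarith+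
  have "P \<subseteq> {..nat \<lfloor>x\<rfloor>}" by (auto simp: P_def le_nat_floor)
  then have fP: "finite P" by (rule finite_subset) simp
  have pr: "prime p" if "p \<in> P" for p using that by (simp add: P_def)
  define N where "N = (\<Prod>p\<in>P. p)"
  have N: "(\<lambda>A. \<Prod>p\<in>A. p) ` Pow P \<subseteq> {1..N}"
  proof
    fix n assume "n \<in> (\<lambda>A. \<Prod>p\<in>A. p) ` Pow P"
    then obtain A where A: "A \<subseteq> P" "n = (\<Prod>p\<in>A. p)" by auto
    have "n dvd N" unfolding A(2) N_def by (rule prod_dvd_prod_subset[OF fP A(1)])
    moreover have "N > 0" unfolding N_def using pr by (intro prod_pos) (auto simp: prime_gt_0_nat)
    ultimately show "n \<in> {1..N}" using dvd_imp_le[of n N] dvd_pos_nat[of N n] by auto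
  qed
  \<comment> \<open>Multiplied out, the product is a sum over squarefree numbers with prime factors
    in \<open>P\<close>; they are distinct and at most \<open>N\<close>.\<close>
  have "(\<Prod>p\<in>P. 1 + real p powr (- (1 + \<delta>))) = (\<Sum>A\<in>Pow P. \<Prod>p\<in>A. real p powr (- (1 + \<delta>)))"
    using prod_add[OF fP, of "\<lambda>p. real p powr (- (1 + \<delta>))" "\<lambda>_. 1"] by (simp add: add.commute)
  also have "\<dots> = (\<Sum>A\<in>Pow P. real (\<Prod>p\<in>A. p) powr (- (1 + \<delta>)))"
    by (intro sum.cong refl) (simp add: prod_powr_distrib)
  also have "\<dots> = (\<Sum>n\<in>(\<lambda>A. \<Prod>p\<in>A. p) ` Pow P. real n powr (- (1 + \<delta>)))"
    using sum.reindex[OF inj_on_prod_primes[OF fP pr], of "\<lambda>n. real n powr (- (1 + \<delta>))"] by (simp add: o_def)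
  also have "\<dots> \<le> (\<Sum>n=1..N. real n powr (- (1 + \<delta>)))"
    by (rule sum_mono2[OF _ N]) auto
  also have "\<dots> \<le> 1 + ln x" using sum_powr_minus_le[OF \<delta>, of N] by (simp add: \<delta>_def)
  finally have prod_le: "(\<Prod>p\<in>P. 1 + real p powr (- (1 + \<delta>))) \<le> 1 + ln x" .
  have pos: "1 + real p powr (- (1 + \<delta>)) > 0" for p by (simp add: add_pos_nonneg)
  have "(\<Sum>p\<in>P. ln (1 + real p powr (- (1 + \<delta>)))) = ln (\<Prod>p\<in>P. 1 + real p powr (- (1 + \<delta>)))"
    using pos by (intro ln_prod[symmetric] fP) (auto simp: less_imp_neq[symmetric])
  also have "\<dots> \<le> ln (1 + ln x)"
    using prod_le pos assms by (intro ln_mono prod_pos) auto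
  finally have L: "(\<Sum>p\<in>P. ln (1 + real p powr (- (1 + \<delta>)))) \<le> ln (1 + ln x)" .
  \<comment> \<open>For \<open>p \<le> x\<close> the shift of the exponent costs at most a factor
    \<open>exp 1 \<le> 3\<close>, and passing from \<open>u\<close> to \<open>ln (1 + u)\<close> a
    factor 2. Another factor 2, from \<open>1 + ln x \<le> (ln x)\<^sup>2\<close>, turns 6 into
    12.\<close>
  have recip: "1 / real p \<le> 6 * ln (1 + real p powr (- (1 + \<delta>)))" if "p \<in> P" for p
  proof -
    have p2: "real p \<ge> 2" and px: "real p \<le> x" using that prime_ge_2_nat by (auto simp: P_def)
    define u where "u = real p powr (- (1 + \<delta>))"
    have "u \<le> real p powr (- 1)" unfolding u_def using p2 \<delta> by (intro powr_mono) auto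
    also have "\<dots> \<le> 1 / 2" using p2 by (simp add: powr_minus field_simps)
    finally have u: "0 \<le> u" "u \<le> 1 / 2" by (auto simp: u_def)
    have "u / 2 \<le> u - u\<^sup>2" using u mult_left_mono[of u "1/2" u] by (simp add: power2_eq_square)
    also have "\<dots> \<le> ln (1 + u)" using u by (intro ln_one_plus_pos_lower_bound) auto
    finally have 1: "u / 2 \<le> ln (1 + u)" .
    have "exp (-1) \<le> exp (- (\<delta> * ln (real p)))"
    proof -
      have "ln (real p) \<le> ln x" using p2 px by simp
      moreover have "ln x > 0" using assms(2) by linarith
      ultimately have "\<delta> * ln (real p) \<le> 1" by (simp add: \<delta>_def del: ln_gt_zero_iff ln_le_cancel_iff)
      then show ?thesis by simp
    qed
    moreover have "(1 / 3 :: real) \<le> exp (-1)"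
      using exp_le by (simp add: exp_minus field_simps)
    ultimately have "1 / 3 \<le> exp (- (\<delta> * ln (real p)))" by linarith
    moreover have "u = exp (- (\<delta> * ln (real p))) / real p"
      using p2 by (simp add: u_def powr_def distrib_right exp_diff exp_minus exp_add exp_ln field_simps)
    ultimately have "1 / real p \<le> 3 * u" using p2 by (simp add: field_simps)
    with 1 show ?thesis by (simp add: u_def)
  qed
  have "(\<Sum>p\<in>P. 1 / real p) \<le> (\<Sum>p\<in>P. 6 * ln (1 + real p powr (- (1 + \<delta>))))"
    by (intro sum_mono recip)
  also have "\<dots> \<le> 6 * ln (1 + ln x)" using L by (simp add: sum_distrib_left[symmetric])
  also have "ln (1 + ln x) \<le> ln ((ln x)\<^sup>2)"
  proof (rule ln_mono)
    have l: "ln x > 0" using assms(2) by linarith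
    have "1 + ln x \<le> ln x + ln x" using assms by simp
    also have "\<dots> \<le> (ln x)\<^sup>2" using mult_right_mono[OF assms(2) less_imp_le[OF l]] by (simp add: power2_eq_square)
    finally show "1 + ln x \<le> (ln x)\<^sup>2" .
  qed (use assms in auto)
  also have "ln ((ln x)\<^sup>2) = 2 * ln (ln x)" using assms by (simp add: ln_realpow)
  finally show ?thesis by (simp add: P_def)
qed

section \<open>Comparison of the coefficients at primes\<close>

text \<open>Uniform limits of Dirichlet polynomials on a vertical line, with frequencies \<open>ln n\<close> for \<open>n \<in> \<Omega>\<close>.\<close>

inductive almost_periodic :: "nat set \<Rightarrow> (real \<Rightarrow> complex) \<Rightarrow> bool" for \<Omega> where
  zero: "almost_periodic \<Omega> (\<lambda>_. 0)"
| base: "n \<in> \<Omega> \<Longrightarrow> almost_periodic \<Omega> (\<lambda>t. c * cis (- (t * ln (real n))))"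
| add: "almost_periodic \<Omega> f \<Longrightarrow> almost_periodic \<Omega> g \<Longrightarrow> almost_periodic \<Omega> (\<lambda>t. f t + g t)"
| lim: "(\<And>\<epsilon>. \<epsilon> > 0 \<Longrightarrow> \<exists>g. almost_periodic \<Omega> g \<and> (\<forall>t. norm (f t - g t) \<le> \<epsilon>)) \<Longrightarrow> almost_periodic \<Omega> f"

lemma almost_periodic_mono:
  assumes "almost_periodic \<Omega> f" "\<Omega> \<subseteq> \<Omega>'"
  shows "almost_periodic \<Omega>' f"
  using assms
proof (induction rule: almost_periodic.induct)
  case (lim f)
  then show ?case by (intro almost_periodic.lim) metis
qed (auto intro: almost_periodic.intros)

lemma almost_periodic_sum:
  "(\<And>i. i \<in> A \<Longrightarrow> almost_periodic \<Omega> (f i)) \<Longrightarrow> almost_periodic \<Omega> (\<lambda>t. \<Sum>i\<in>A. f i t)"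
  by (induction A rule: infinite_finite_induct) (auto intro: almost_periodic.intros)

lemma almost_periodic_bounded:
  assumes "almost_periodic \<Omega> f" shows "\<exists>B. \<forall>t. norm (f t) \<le> B"
  using assms
proof (induction rule: almost_periodic.induct)
  case (base n c)
  then show ?case by (intro exI[of _ "norm c"]) (simp add: norm_mult)
next
  case (add f g)
  then obtain B C where "\<forall>t. norm (f t) \<le> B" "\<forall>t. norm (g t) \<le> C" by blast
  then show ?case by (intro exI[of _ "B + C"]) (auto intro: norm_triangle_mono)
next
  case (lim f)
  then obtain g B where g: "\<forall>t. norm (f t - g t) \<le> 1" "\<forall>t. norm (g t) \<le> B"
    by (meson zero_less_one)
  have "norm (f t) \<le> B + 1" for t
    using g norm_triangle_sub[of "f t" "g t"] by (smt (verit))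
  then show ?case by blast
qed auto

lemma almost_periodic_continuous:
  assumes "almost_periodic \<Omega> f" shows "continuous_on UNIV f"
  using assms
proof (induction rule: almost_periodic.induct)
  case (lim f)
  define g where "g n = (SOME g. almost_periodic \<Omega> g \<and> continuous_on UNIV g \<and> (\<forall>t. norm (f t - g t) \<le> 1 / Suc n))" for n :: nat
  have "\<exists>g. almost_periodic \<Omega> g \<and> continuous_on UNIV g \<and> (\<forall>t. norm (f t - g t) \<le> 1 / Suc n)" for n :: nat
    using lim[of "1 / Suc n"] by auto
  from someI_ex[OF this] have g: "continuous_on UNIV (g n)" "norm (f t - g n t) \<le> 1 / Suc n" for n t
    unfolding g_def by blast+
  show ?case
  proof (rule uniform_limit_theorem[where F = sequentially])
    show "uniform_limit UNIV g f sequentially"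
    proof (rule uniform_limitI)
      fix \<epsilon> :: real assume "\<epsilon> > 0"
      then have "\<forall>\<^sub>F n in sequentially. 1 / Suc n < \<epsilon>"
        using LIMSEQ_inverse_real_of_nat[unfolded inverse_eq_divide] by (auto dest: order_tendstoD)
      then show "\<forall>\<^sub>F n in sequentially. \<forall>t\<in>UNIV. dist (g n t) (f t) < \<epsilon>"
        by eventually_elim (metis dist_norm g(2) dist_commute le_less_trans)
    qed
  qed (use g(1) in auto)
qed (auto intro!: continuous_intros)

text \<open>Nested inductions: first over \<open>g\<close> with a single exponential in place of
  \<open>f\<close>, then over \<open>f\<close>. Bounded factors preserve uniform approximation. The
  number 0 is excluded because frequencies add, \<open>ln (m * n) = ln m + ln n\<close>, only for
  positive arguments.\<close>

lemma almost_periodic_mult: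
  assumes f: "almost_periodic \<Omega>1 f" and g: "almost_periodic \<Omega>2 g"
    and \<Omega>: "\<And>m n. m \<in> \<Omega>1 \<Longrightarrow> n \<in> \<Omega>2 \<Longrightarrow> m * n \<in> \<Omega>" and pos: "0 \<notin> \<Omega>1" "0 \<notin> \<Omega>2"
  shows "almost_periodic \<Omega> (\<lambda>t. f t * g t)"
proof -
  have mono: "almost_periodic \<Omega> (\<lambda>t. c * cis (- (t * ln (real m))) * g t)" if m: "m \<in> \<Omega>1" for c m
    using g
  proof (induction rule: almost_periodic.induct)
    case (base n d)
    have "ln (real (m * n)) = ln (real m) + ln (real n)"
      using m base pos by (cases "m = 0"; cases "n = 0") (auto simp: ln_mult)
    then have "cis (- (t * ln (real (m * n)))) = cis (- (t * ln (real m))) * cis (- (t * ln (real n)))" for t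
      by (simp add: distrib_left cis_mult)
    then have eq: "(c * d) * cis (- (t * ln (real (m * n)))) = c * cis (- (t * ln (real m))) * (d * cis (- (t * ln (real n))))" for t
      by (simp add: mult_ac del: of_nat_mult)
    show ?case
      using almost_periodic.base[OF \<Omega>[OF m base], of "c * d"] unfolding eq .
  next
    case (add f g)
    then show ?case using almost_periodic.add by (simp add: distrib_left)
  next
    case (lim f)
    show ?case
    proof (rule almost_periodic.lim)
      fix \<epsilon> :: real assume "\<epsilon> > 0"
      then have "\<epsilon> / (1 + norm c) > 0" by (simp add: add_pos_nonneg)
      then obtain h where h: "almost_periodic \<Omega> (\<lambda>t. c * cis (- (t * ln (real m))) * h t)" "\<forall>t. norm (f t - h t) \<le> \<epsilon> / (1 + norm c)"
        using lim by blast
      have "norm (c * cis (- (t * ln (real m))) * f t - c * cis (- (t * ln (real m))) * h t) \<le> \<epsilon>" for t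
      proof -
        have "norm (c * cis (- (t * ln (real m))) * f t - c * cis (- (t * ln (real m))) * h t) = norm c * norm (f t - h t)"
          by (simp add: right_diff_distrib[symmetric] norm_mult)
        also have "\<dots> \<le> (1 + norm c) * (\<epsilon> / (1 + norm c))"
          using h(2) by (intro mult_mono) auto
        finally show ?thesis using norm_ge_zero[of c] by (simp add: add_nonneg_eq_0_iff)
      qed
      with h(1) show "\<exists>g. almost_periodic \<Omega> g \<and> (\<forall>t. norm (c * cis (- (t * ln (real m))) * f t - g t) \<le> \<epsilon>)" by blast
    qed
  qed (auto intro: almost_periodic.intros)
  obtain B where B: "\<And>t. norm (g t) \<le> B" using almost_periodic_bounded[OF g] by blast
  have B0: "B \<ge> 0" using B norm_ge_zero order_trans by blast
  from f show ?thesis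
  proof (induction rule: almost_periodic.induct)
    case (base n c)
    then show ?case by (rule mono)
  next
    case (add f g)
    then show ?case using almost_periodic.add by (simp add: distrib_right)
  next
    case (lim f)
    show ?case
    proof (rule almost_periodic.lim)
      fix \<epsilon> :: real assume "\<epsilon> > 0"
      then have "\<epsilon> / (1 + B) > 0" using B0 by simp
      then obtain h where h: "almost_periodic \<Omega> (\<lambda>t. h t * g t)" "\<forall>t. norm (f t - h t) \<le> \<epsilon> / (1 + B)"
        using lim by blast
      have "norm (f t * g t - h t * g t) \<le> \<epsilon>" for t
      proof -
        have "norm (f t * g t - h t * g t) = norm (f t - h t) * norm (g t)"
          by (simp add: left_diff_distrib[symmetric] norm_mult)
        also have "\<dots> \<le> \<epsilon> / (1 + B) * (1 + B)"
          using h(2) B[of t] B0 \<open>\<epsilon> > 0\<close> by (intro mult_mono) auto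
        finally show ?thesis using B0 by simp
      qed
      with h(1) show "\<exists>k. almost_periodic \<Omega> k \<and> (\<forall>t. norm (f t * g t - k t) \<le> \<epsilon>)" by blast
    qed
  qed (auto intro: almost_periodic.intros)
qed

lemma almost_periodic_uminus:
  assumes "almost_periodic \<Omega> f" shows "almost_periodic \<Omega> (\<lambda>t. - f t)"
  using assms
proof (induction rule: almost_periodic.induct)
  case (base n c)
  then show ?case using almost_periodic.base[of n \<Omega> "- c"] by simp
next
  case (add f g)
  then show ?case using almost_periodic.add by fastforce
next
  case (lim f)
  show ?case
  proof (rule almost_periodic.lim)
    fix \<epsilon> :: real assume "\<epsilon> > 0"
    then obtain g where "almost_periodic \<Omega> (\<lambda>t. - g t)" "\<forall>t. norm (f t - g t) \<le> \<epsilon>" using lim by blast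
    then show "\<exists>k. almost_periodic \<Omega> k \<and> (\<forall>t. norm (- f t - k t) \<le> \<epsilon>)"
      by (intro exI[of _ "\<lambda>t. - g t"]) (simp add: norm_minus_commute)
  qed
qed (auto intro: almost_periodic.intros)

lemma almost_periodic_infsum:
  assumes u: "(\<lambda>i. norm (u i)) summable_on I" and q: "\<And>i. i \<in> I \<Longrightarrow> q i \<in> \<Omega>"
  shows "almost_periodic \<Omega> (\<lambda>t. \<Sum>\<^sub>\<infinity>i\<in>I. u i * cis (- (t * ln (real (q i)))))"
proof (rule almost_periodic.lim)
  fix \<epsilon> :: real assume "\<epsilon> > 0"
  then obtain J where J: "finite J" "J \<subseteq> I" "dist (\<Sum>i\<in>J. norm (u i)) (\<Sum>\<^sub>\<infinity>i\<in>I. norm (u i)) \<le> \<epsilon>"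
    using infsum_finite_approximation[OF u] by blast
  have "norm ((\<Sum>\<^sub>\<infinity>i\<in>I. u i * cis (- (t * ln (real (q i))))) - (\<Sum>i\<in>J. u i * cis (- (t * ln (real (q i)))))) \<le> \<epsilon>" for t
  proof -
    let ?f = "\<lambda>i. u i * cis (- (t * ln (real (q i))))"
    have a: "(\<lambda>i. norm (?f i)) summable_on I" using u by (simp add: norm_mult)
    then have s: "?f summable_on I" by (rule abs_summable_summable)
    have sJ: "?f summable_on J" "(\<lambda>i. norm (u i)) summable_on J" using J(1) by simp_all
    have "(\<Sum>\<^sub>\<infinity>i\<in>I - J. ?f i) = (\<Sum>\<^sub>\<infinity>i\<in>I. ?f i) - (\<Sum>i\<in>J. ?f i)"
      using infsum_Diff[OF s sJ(1) J(2)] J(1) by simp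
    moreover have "norm (\<Sum>\<^sub>\<infinity>i\<in>I - J. ?f i) \<le> (\<Sum>\<^sub>\<infinity>i\<in>I - J. norm (?f i))"
      by (rule norm_infsum_bound) (rule summable_on_subset_banach[OF a], auto)
    moreover have "(\<Sum>\<^sub>\<infinity>i\<in>I - J. norm (?f i)) = (\<Sum>\<^sub>\<infinity>i\<in>I. norm (u i)) - (\<Sum>i\<in>J. norm (u i))"
      using infsum_Diff[OF u sJ(2) J(2)] J(1) by (simp add: norm_mult)
    ultimately show ?thesis using J(3) by (simp add: dist_real_def)
  qed
  moreover have "almost_periodic \<Omega> (\<lambda>t. \<Sum>i\<in>J. u i * cis (- (t * ln (real (q i)))))"
    using J(2) q by (intro almost_periodic_sum almost_periodic.base) auto
  ultimately show "\<exists>g. almost_periodic \<Omega> g \<and> (\<forall>t. norm ((\<Sum>\<^sub>\<infinity>i\<in>I. u i * cis (- (t * ln (real (q i))))) - g t) \<le> \<epsilon>)" by blast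
qed

lemma integral_cis:
  assumes "\<omega> \<noteq> 0" "T \<ge> 0"
  shows "norm (integral {0..T} (\<lambda>t. cis (\<omega> * t))) \<le> 2 / \<bar>\<omega>\<bar>"
proof -
  have "((\<lambda>t. cis (\<omega> * t)) has_integral (cis (\<omega> * T) / (\<i> * \<omega>) - cis (\<omega> * 0) / (\<i> * \<omega>))) {0..T}"
  proof (rule fundamental_theorem_of_calculus[OF assms(2)])
    fix t
    have "((\<lambda>t. cis (\<omega> * t)) has_vector_derivative (\<i> * \<omega>) * cis (\<omega> * t)) (at t within {0..T})"
      unfolding has_vector_derivative_complex_iff by (auto intro!: derivative_eq_intros)
    from has_vector_derivative_divide[OF this, of "\<i> * \<omega>"]
    show "((\<lambda>t. cis (\<omega> * t) / (\<i> * \<omega>)) has_vector_derivative cis (\<omega> * t)) (at t within {0..T})"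
      using assms(1) by simp
  qed
  then have "integral {0..T} (\<lambda>t. cis (\<omega> * t)) = (cis (\<omega> * T) - 1) / (\<i> * \<omega>)"
    by (simp add: integral_unique diff_divide_distrib)
  then show ?thesis
    using norm_triangle_ineq4[of "cis (\<omega> * T)" 1] by (simp add: norm_divide norm_mult divide_right_mono)
qed

text \<open>The mean value extracts the coefficient at frequency \<open>ln p\<close>.\<close>

lemma almost_periodic_mean_zero:
  assumes f: "almost_periodic \<Omega> f" and p: "p \<notin> \<Omega>" "p > 0" and "0 \<notin> \<Omega>"
  shows "((\<lambda>T. integral {0..T} (\<lambda>t. f t * cis (t * ln (real p))) / T) \<longlongrightarrow> 0) at_top"
proof -
  have int: "(\<lambda>t. f t * cis (t * ln (real p))) integrable_on {0..T}" if "almost_periodic \<Omega> f" for f T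
    using almost_periodic_continuous[OF that]
    by (intro integrable_continuous_interval continuous_intros) (auto intro: continuous_on_subset)
  from f show ?thesis
  proof (induction rule: almost_periodic.induct)
    case zero
    then show ?case by simp
  next
    case (base n c)
    \<comment> \<open>Different positive integers have different logarithms, so the integral stays
      bounded and its mean tends to 0.\<close>
    define \<omega> where "\<omega> = ln (real p) - ln (real n)"
    have "n > 0" "n \<noteq> p" using base assms by (auto intro: gr0I)
    then have \<omega>: "\<omega> \<noteq> 0" using p by (simp add: \<omega>_def)
    have eq: "c * cis (- (t * ln (real n))) * cis (t * ln (real p)) = c * cis (\<omega> * t)" for t
      by (simp add: cis_mult \<omega>_def algebra_simps)
    show ?case
    proof (rule Lim_null_comparison)
      show "\<forall>\<^sub>F T in at_top. norm (integral {0..T} (\<lambda>t. c * cis (- (t * ln (real n))) * cis (t * ln (real p))) / T) \<le> norm c * (2 / \<bar>\<omega>\<bar>) / T"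
        using eventually_gt_at_top[of 0]
      proof eventually_elim
        case (elim T)
        have "norm (integral {0..T} (\<lambda>t. c * cis (\<omega> * t))) \<le> norm c * (2 / \<bar>\<omega>\<bar>)"
          using mult_left_mono[OF integral_cis[OF \<omega>, of T] norm_ge_zero[of c]] elim by (simp add: norm_mult)
        then have "norm (integral {0..T} (\<lambda>t. c * cis (\<omega> * t))) / T \<le> norm c * (2 / \<bar>\<omega>\<bar>) / T"
          using elim by (intro divide_right_mono) auto
        then show ?case unfolding eq norm_divide using elim by (simp add: abs_of_pos)
      qed
      show "((\<lambda>T. norm c * (2 / \<bar>\<omega>\<bar>) / T) \<longlongrightarrow> 0) at_top"
        by (intro tendsto_divide_0[OF tendsto_const] filterlim_at_top_imp_at_infinity filterlim_ident)
    qed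
  next
    case (add f g)
    have "integral {0..T} (\<lambda>t. (f t + g t) * cis (t * ln (real p))) / T
       = integral {0..T} (\<lambda>t. f t * cis (t * ln (real p))) / T + integral {0..T} (\<lambda>t. g t * cis (t * ln (real p))) / T" for T
      using integral_add[OF int[OF add(1)] int[OF add(2)], of T] by (simp add: distrib_right add_divide_distrib)
    then show ?case using tendsto_add[OF add(3,4)] by simp
  next
    case (lim f)
    have apf: "almost_periodic \<Omega> f" using lim by (intro almost_periodic.lim) blast
    show ?case
    proof (rule tendstoI)
      fix \<epsilon> :: real assume "\<epsilon> > 0"
      then obtain g where g: "almost_periodic \<Omega> g" "\<forall>t. norm (f t - g t) \<le> \<epsilon> / 2"
        "((\<lambda>T. integral {0..T} (\<lambda>t. g t * cis (t * ln (real p))) / T) \<longlongrightarrow> 0) at_top"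
        using lim[of "\<epsilon> / 2"] by auto
      have "\<forall>\<^sub>F T in at_top. norm (integral {0..T} (\<lambda>t. g t * cis (t * ln (real p))) / T) < \<epsilon> / 2"
        using tendstoD[OF g(3), of "\<epsilon> / 2"] \<open>\<epsilon> > 0\<close> by simp
      with eventually_gt_at_top[of 0]
      show "\<forall>\<^sub>F T in at_top. dist (integral {0..T} (\<lambda>t. f t * cis (t * ln (real p))) / T) 0 < \<epsilon>"
      proof eventually_elim
        case (elim T)
        let ?d = "\<lambda>t. f t * cis (t * ln (real p)) - g t * cis (t * ln (real p))"
        have "norm (integral {0..T} ?d) \<le> \<epsilon> / 2 * measure lborel {0..T}"
        proof (rule has_integral_bound_real[where f = ?d])
          show "(?d has_integral integral {0..T} ?d) {0..T}"
            by (intro integrable_integral integrable_diff int apf g)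
          show "norm (?d t) \<le> \<epsilon> / 2" for t
            using g(2) by (simp add: left_diff_distrib[symmetric] norm_mult)
        qed (use \<open>\<epsilon> > 0\<close> in auto)
        then have "norm (integral {0..T} ?d / T) \<le> \<epsilon> / 2"
          using elim by (simp add: norm_divide field_simps)
        moreover have "integral {0..T} ?d / T = integral {0..T} (\<lambda>t. f t * cis (t * ln (real p))) / T - integral {0..T} (\<lambda>t. g t * cis (t * ln (real p))) / T"
          by (simp add: integral_diff[OF int[OF apf] int[OF g(1)]] diff_divide_distrib)
        ultimately show ?case
          using elim(2) norm_triangle_sub[of "integral {0..T} (\<lambda>t. f t * cis (t * ln (real p))) / T" "integral {0..T} (\<lambda>t. g t * cis (t * ln (real p))) / T"]
          by simp
      qed
    qed
  qed
qed

text \<open>The mean value against the opposite exponential is \<open>c\<close> for every positive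
  \<open>T\<close>, but it tends to 0 because the frequency of \<open>p\<close> is missing from
  \<open>\<Omega>\<close>.\<close>

lemma almost_periodic_single_frequency:
  assumes "almost_periodic \<Omega> (\<lambda>t. c * cis (- (t * ln (real p))))" "p \<notin> \<Omega>" "p > 0" "0 \<notin> \<Omega>"
  shows "c = 0"
proof -
  have "((\<lambda>T. integral {0..T} (\<lambda>t. c * cis (- (t * ln (real p))) * cis (t * ln (real p))) / T) \<longlongrightarrow> 0) at_top"
    by (rule almost_periodic_mean_zero[OF assms])
  moreover have "\<forall>\<^sub>F T in at_top. integral {0..T} (\<lambda>t. c * cis (- (t * ln (real p))) * cis (t * ln (real p))) / T = c"
    using eventually_gt_at_top[of 0] by eventually_elim (simp add: mult.assoc cis_mult scaleR_conv_of_real)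
  ultimately have "((\<lambda>T::real. c) \<longlongrightarrow> 0) at_top" by (rule Lim_transform_eventually)
  then show ?thesis by (simp add: tendsto_const_iff)
qed

lemma almost_periodic_scale:
  assumes "almost_periodic \<Omega> f" "0 \<notin> \<Omega>"
  shows "almost_periodic \<Omega> (\<lambda>t. c * f t)"
proof -
  have "almost_periodic {1} (\<lambda>t. c * cis (- (t * ln (real 1))))" by (rule almost_periodic.base) simp
  from almost_periodic_mult[OF this assms(1), of \<Omega>] assms(2) show ?thesis by simp
qed

text \<open>The power law holds here because the logarithm of a positive integer is real, so that no
  change of branch can interfere.\<close>

lemma of_nat_powr_power: "p > 0 \<Longrightarrow> of_nat p powr (- (of_nat k * s)) = (of_nat (p ^ k) powr (- s) :: complex)"
proof -
  assume "p > 0"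
  then have "Ln (of_nat (p ^ k)) = of_real (real k * ln (real p))"
    by (subst Ln_of_nat) (simp_all add: ln_realpow)
  then have "of_nat (p ^ k) powr (- s) = exp (- s * of_real (real k * ln (real p)))"
    using \<open>p > 0\<close> by (simp only: powr_def of_nat_eq_0_iff) simp
  then show ?thesis using \<open>p > 0\<close> by (simp add: powr_def Ln_of_nat mult_ac)
qed

lemma of_nat_powr_vertical_line:
  assumes "n > 0"
  shows "of_nat n powr (- Complex 2 t) = complex_of_real (real n powr - 2) * cis (- (t * ln (real n)))"
proof -
  have "of_nat n powr (- Complex 2 t) = exp (- Complex 2 t * of_real (ln (real n)))"
    using assms by (simp add: powr_def Ln_of_nat)
  also have "\<dots> = of_real (exp (Re (- Complex 2 t * of_real (ln (real n))))) * cis (Im (- Complex 2 t * of_real (ln (real n))))"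
    by (rule exp_eq_polar)
  finally show ?thesis using assms by (simp add: powr_def)
qed

text \<open>On the line \<open>Re s = 2\<close> both series converge absolutely and uniformly in
  \<open>t\<close>. In the expansion of \<open>exp (D t)\<close> the powers from the square on have
  frequencies \<open>ln (m * n)\<close> with \<open>m, n \<ge> 2\<close>, never \<open>ln p\<close>;
  so \<open>ln p\<close> enters only through the linear term, with coefficient \<open>b p\<close>,
  whereas in the Dirichlet series its coefficient is \<open>a p\<close>. The factor
  \<open>w p\<close>, common to both, is nonzero.\<close>

lemma coefficient_at_prime:
  assumes F: "dirichlet_series F a" and E: "euler_product F b" and p: "prime p"
  shows "a p = b p"
proof -
  define w where "w n = complex_of_real (real n powr - 2)" for n
  define I where "I = {p::nat. prime p} \<times> {1::nat..}"
  define q where "q = (\<lambda>(p::nat, k::nat). p ^ k)"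
  define \<Omega> where "\<Omega> = {1..} - {p}"
  have p0: "p > 0" using p by (simp add: prime_gt_0_nat)
  have \<Omega>0: "0 \<notin> \<Omega>" by (simp add: \<Omega>_def)
  have term1: "a n * of_nat n powr (- Complex 2 t) = a n * w n * cis (- (t * ln (real n)))" if "n \<in> {1..}" for n t
    using that by (simp add: of_nat_powr_vertical_line w_def)
  have "(\<lambda>n. norm (a n * of_nat n powr (- Complex 2 0))) summable_on {1..}"
    using F unfolding dirichlet_series_def by (metis complex.sel(1) one_less_numeral_iff semiring_norm(76))
  then have sa: "(\<lambda>n. norm (a n * w n)) summable_on {1..}"
    by (rule summable_on_cong[THEN iffD1, rotated]) (simp add: term1 norm_mult)
  have Fs: "F (Complex 2 t) = (\<Sum>\<^sub>\<infinity>n\<in>{1..}. a n * w n * cis (- (t * ln (real n))))" for t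
  proof -
    have "((\<lambda>n. a n * of_nat n powr (- Complex 2 t)) has_sum F (Complex 2 t)) {1..}"
      using F unfolding dirichlet_series_def by simp
    from infsumI[OF this] show ?thesis using term1 by (metis (no_types, lifting) infsum_cong)
  qed
  have q0: "q i \<ge> 2" if "i \<in> I" for i
  proof -
    obtain r k where i: "i = (r, k)" "prime r" "k \<ge> 1" using \<open>i \<in> I\<close> by (auto simp: I_def)
    have "2 \<le> r" using i prime_ge_2_nat by blast
    also have "r \<le> r ^ k" using i \<open>2 \<le> r\<close> by (intro self_le_power) auto
    finally show ?thesis by (simp add: i q_def)
  qed
  have qp: "i = (p, 1)" if "i \<in> I" "q i = p" for i
  proof -
    obtain r k where i: "i = (r, k)" "prime r" "k \<ge> 1" using \<open>i \<in> I\<close> by (auto simp: I_def)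
    then have "prime (r ^ k)" using that p by (simp add: q_def)
    then have "k = 1" using prime_power_iff by blast
    then show ?thesis using that i by (simp add: q_def)
  qed
  define u where "u i = b (q i) * w (q i)" for i
  define D where "D t = (\<Sum>\<^sub>\<infinity>i\<in>I. u i * cis (- (t * ln (real (q i)))))" for t
  have term2: "(case i of (p, k) \<Rightarrow> b (p ^ k) * of_nat p powr (- (of_nat k * Complex 2 t))) = u i * cis (- (t * ln (real (q i))))" if "i \<in> I" for i t
  proof -
    obtain r k where i: "i = (r, k)" "prime r" "k \<ge> 1" using \<open>i \<in> I\<close> by (auto simp: I_def)
    then have "r > 0" by (simp add: prime_gt_0_nat)
    then show ?thesis
      using of_nat_powr_power[of r k "Complex 2 t"] of_nat_powr_vertical_line[of "r ^ k" t]
      by (simp add: i q_def u_def w_def)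
  qed
  have Es: "(\<lambda>(p, k). norm (b (p ^ k) * of_nat p powr (- (of_nat k * s)))) summable_on I"
    "F s = exp (\<Sum>\<^sub>\<infinity>(p, k)\<in>I. b (p ^ k) * of_nat p powr (- (of_nat k * s)))" if "Re s > 1" for s
    using E that unfolding euler_product_def I_def by auto
  have su: "(\<lambda>i. norm (u i)) summable_on I"
  proof -
    have "(\<lambda>i. norm (case i of (p, k) \<Rightarrow> b (p ^ k) * of_nat p powr (- (of_nat k * Complex 2 0)))) summable_on I"
      using Es(1)[of "Complex 2 0"] by (simp add: split_def)
    then show ?thesis
      by (rule summable_on_cong[THEN iffD1, rotated]) (simp add: term2 norm_mult)
  qed
  have FD: "F (Complex 2 t) = exp (D t)" for t
    unfolding D_def using Es(2)[of "Complex 2 t"] infsum_cong[of I, OF term2] by simp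
  have ap1: "almost_periodic \<Omega> (\<lambda>t. F (Complex 2 t) - a p * w p * cis (- (t * ln (real p))))"
  proof -
    have "F (Complex 2 t) - a p * w p * cis (- (t * ln (real p))) = (\<Sum>\<^sub>\<infinity>n\<in>\<Omega>. a n * w n * cis (- (t * ln (real n))))" for t
    proof -
      have s: "(\<lambda>n. a n * w n * cis (- (t * ln (real n)))) summable_on {1..}"
        by (rule abs_summable_summable) (use sa in \<open>simp add: norm_mult\<close>)
      show ?thesis
        unfolding \<Omega>_def using infsum_Diff[OF s, of "{p}"] p0 by (simp add: Fs Suc_le_eq)
    qed
    moreover have "almost_periodic \<Omega> (\<lambda>t. \<Sum>\<^sub>\<infinity>n\<in>\<Omega>. a n * w n * cis (- (t * ln (real n))))"
      by (rule almost_periodic_infsum) (auto intro: summable_on_subset_banach[OF sa] simp: \<Omega>_def)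
    ultimately show ?thesis by simp
  qed
  have apD: "almost_periodic {2..} D"
    unfolding D_def by (rule almost_periodic_infsum[OF su]) (use q0 in auto)
  have apD': "almost_periodic \<Omega> (\<lambda>t. D t - b p * w p * cis (- (t * ln (real p))))"
  proof -
    have pI: "(p, 1) \<in> I" using p by (simp add: I_def)
    have "D t - b p * w p * cis (- (t * ln (real p))) = (\<Sum>\<^sub>\<infinity>i\<in>I - {(p, 1)}. u i * cis (- (t * ln (real (q i)))))" for t
    proof -
      have s: "(\<lambda>i. u i * cis (- (t * ln (real (q i))))) summable_on I"
        by (rule abs_summable_summable) (use su in \<open>simp add: norm_mult\<close>)
      show ?thesis
        using infsum_Diff[OF s, of "{(p, 1)}"] pI by (simp add: D_def u_def q_def)
    qed
    moreover have "almost_periodic \<Omega> (\<lambda>t. \<Sum>\<^sub>\<infinity>i\<in>I - {(p, 1)}. u i * cis (- (t * ln (real (q i)))))"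
    proof (rule almost_periodic_infsum)
      show "(\<lambda>i. norm (u i)) summable_on I - {(p, 1)}" by (rule summable_on_subset_banach[OF su]) auto
      show "q i \<in> \<Omega>" if "i \<in> I - {(p, 1)}" for i
        using q0[of i] qp[of i] that by (auto simp: \<Omega>_def)
    qed
    ultimately show ?thesis by simp
  qed
  define C where "C = {m * n | m n :: nat. m \<ge> 2 \<and> n \<ge> 2}"
  have C0: "0 \<notin> C" by (auto simp: C_def)
  have C\<Omega>: "C \<subseteq> \<Omega>"
    using p by (auto simp: C_def \<Omega>_def prime_product Suc_le_eq dest!: prime_product)
  have pow: "almost_periodic C (\<lambda>t. D t ^ (k + 2))" for k
  proof (induction k)
    case 0
    have "almost_periodic C (\<lambda>t. D t * D t)"
      by (rule almost_periodic_mult[OF apD apD]) (auto simp: C_def)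
    then show ?case by (simp add: power2_eq_square)
  next
    case (Suc k)
    have "almost_periodic C (\<lambda>t. D t ^ (k + 2) * D t)"
    proof (rule almost_periodic_mult[OF Suc apD])
      fix m n assume "m \<in> C" "n \<in> {2::nat..}"
      then obtain x y where xy: "m = x * y" "x \<ge> 2" "y \<ge> 2" by (auto simp: C_def)
      have "m * n = x * (y * n)" by (simp add: xy)
      moreover have "2 \<le> y * n" using xy \<open>n \<in> {2..}\<close> mult_le_mono[of 2 y 1 n] by simp
      ultimately show "m * n \<in> C" using xy(2) unfolding C_def by blast
    qed (use C0 in auto)
    then show ?case by (simp add: mult.commute)
  qed
  obtain B where B: "\<And>t. norm (D t) \<le> B" using almost_periodic_bounded[OF apD] by blast
  have B0: "B \<ge> 0" using B norm_ge_zero order_trans by blast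
  have ap2: "almost_periodic \<Omega> (\<lambda>t. exp (D t) - b p * w p * cis (- (t * ln (real p))))"
  proof (rule almost_periodic.lim)
    fix \<epsilon> :: real assume "\<epsilon> > 0"
    have "(\<lambda>n. exp B * B * (inverse (fact n) * B ^ n)) \<longlonglongrightarrow> exp B * B * 0"
      by (intro tendsto_mult tendsto_const summable_LIMSEQ_zero[OF summable_exp])
    then have "\<forall>\<^sub>F n in sequentially. exp B * B * (inverse (fact n) * B ^ n) < \<epsilon>"
      using \<open>\<epsilon> > 0\<close> by (auto dest: order_tendstoD)
    then obtain n where n: "exp B * B * (inverse (fact n) * B ^ n) < \<epsilon>" "n \<ge> 1"
      unfolding eventually_sequentially by (meson le_cases order_trans le_refl nat_le_linear)
    define g where "g t = (\<Sum>k\<le>n. D t ^ k / fact k) - b p * w p * cis (- (t * ln (real p)))" for t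
    have eq: "g t = 1 + (D t - b p * w p * cis (- (t * ln (real p)))) + (\<Sum>k\<in>{..n} - {0, 1}. 1 / fact k * D t ^ k)" for t
      using n(2) sum.subset_diff[of "{0, 1}" "{..n}" "\<lambda>k. D t ^ k / fact k"] by (simp add: g_def)
    \<comment> \<open>The constant term has frequency \<open>ln 1 = 0\<close>, which is allowed
      since \<open>p > 1\<close>.\<close>
    have "almost_periodic \<Omega> (\<lambda>t. 1 * cis (- (t * ln (real 1))))"
      using prime_gt_1_nat[OF p] by (intro almost_periodic.base) (simp add: \<Omega>_def)
    then have one: "almost_periodic \<Omega> (\<lambda>t. 1)" by simp
    have "almost_periodic \<Omega> (\<lambda>t. 1 / fact k * D t ^ k)" if "k \<in> {..n} - {0, 1}" for k
    proof -
      have "k = (k - 2) + 2" using that by auto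
      then have "almost_periodic C (\<lambda>t. D t ^ k)" using pow[of "k - 2"] by simp
      then show ?thesis by (intro almost_periodic_scale \<Omega>0 almost_periodic_mono[OF _ C\<Omega>])
    qed
    then have "almost_periodic \<Omega> g"
      unfolding eq[abs_def] by (intro almost_periodic.add one apD' almost_periodic_sum)
    moreover have "norm ((exp (D t) - b p * w p * cis (- (t * ln (real p)))) - g t) \<le> \<epsilon>" for t
    proof -
      have "norm ((exp (D t) - b p * w p * cis (- (t * ln (real p)))) - g t) = norm (exp (D t) - (\<Sum>k\<le>n. D t ^ k / fact k))"
        by (simp add: g_def)
      also have "\<dots> \<le> exp (norm (D t)) * (norm (D t) ^ Suc n) / fact n" by (rule Taylor_exp_field)
      also have "\<dots> \<le> exp B * B ^ Suc n / fact n"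
        using B[of t] by (intro divide_right_mono mult_mono power_mono) auto
      also have "\<dots> = exp B * B * (inverse (fact n) * B ^ n)" by (simp add: divide_inverse)
      finally show ?thesis using n by simp
    qed
    ultimately show "\<exists>g. almost_periodic \<Omega> g \<and> (\<forall>t. norm (exp (D t) - b p * w p * cis (- (t * ln (real p))) - g t) \<le> \<epsilon>)" by blast
  qed
  have "almost_periodic \<Omega> (\<lambda>t. (F (Complex 2 t) - a p * w p * cis (- (t * ln (real p)))) + - (exp (D t) - b p * w p * cis (- (t * ln (real p)))))"
    by (intro almost_periodic.add ap1 almost_periodic_uminus ap2)
  then have "almost_periodic \<Omega> (\<lambda>t. ((b p - a p) * w p) * cis (- (t * ln (real p))))"
    by (simp add: FD algebra_simps)
  then have "(b p - a p) * w p = 0"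
    by (rule almost_periodic_single_frequency) (use p0 in \<open>auto simp: \<Omega>_def\<close>)
  then show ?thesis using p0 by (simp add: w_def)
qed

section \<open>Orthogonality and good primes in every direction\<close>

definition coeff_dot :: "('N::finite \<Rightarrow> nat \<Rightarrow> complex) \<Rightarrow> nat \<Rightarrow> complex ^ 'N \<Rightarrow> complex" where
  "coeff_dot b q y = (\<Sum>j\<in>UNIV. b j q * cnj (y $ j))"

lemma continuous_coeff_dot: "continuous_on UNIV (coeff_dot b q)"
  unfolding coeff_dot_def by (intro continuous_intros)

text \<open>
  If \<open>coeff_dot a p y\<close> were small for almost all primes, then Mertens' bound would contradict the
  \<open>ln (ln x)\<close> growth of \<open>\<Sum> \<bar>coeff_dot a p y\<bar>\<^sup>2 / p\<close> given by orthogonality.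
\<close>

lemma infinitely_many_good_primes:
  fixes a :: "'N::finite \<Rightarrow> nat \<Rightarrow> complex"
  assumes "orthogonal_family a"
  obtains c where "c > 0" "\<And>y P0. norm y = 1 \<Longrightarrow> \<exists>p\<ge>P0. prime p \<and> norm (coeff_dot a p y) \<ge> c"
proof -
  from assms[unfolded orthogonal_family_def] obtain m :: "'N \<Rightarrow> 'N \<Rightarrow> real" where
    M: "(\<forall>i. m i i > 0) \<and> (\<forall>i j. i \<noteq> j \<longrightarrow> m i j = 0) \<and>
        (\<forall>i j. \<exists>\<epsilon> :: real \<Rightarrow> complex. \<epsilon> \<in> o(\<lambda>_. 1) \<and>
           (\<forall>\<^sub>F x in at_top. (\<Sum>p | prime p \<and> real p \<le> x. a i p * cnj (a j p) / of_nat p)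
                = (of_real (m i j) + \<epsilon> x) * of_real (ln (ln x))))" by (elim exE)
  then have m: "\<And>i. m i i > 0" "\<And>i j. i \<noteq> j \<Longrightarrow> m i j = 0" by blast+
  have asym: "\<And>i j. \<exists>\<epsilon> :: real \<Rightarrow> complex. \<epsilon> \<in> o(\<lambda>_. 1) \<and>
           (\<forall>\<^sub>F x in at_top. (\<Sum>p | prime p \<and> real p \<le> x. a i p * cnj (a j p) / of_nat p)
                = (of_real (m i j) + \<epsilon> x) * of_real (ln (ln x)))"
    using M by (elim conjE allE)
  define m0 where "m0 = Min (range (\<lambda>i. m i i))"
  have m0: "m0 > 0" "m0 \<le> m i i" for i
    using m(1) by (auto simp: m0_def)
  \<comment> \<open>If \<open>coeff_dot\<close> stayed below \<open>c\<close>, the bound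
    \<open>12 * ln (ln x)\<close> for the prime reciprocals would give a limit of at most
    \<open>12 * c\<^sup>2 = m0 / 2\<close>, half of what orthogonality guarantees.\<close>
  define c where "c = sqrt (m0 / 24)"
  have c: "c > 0" "c\<^sup>2 = m0 / 24" using m0(1) by (auto simp: c_def)
  have "\<exists>p\<ge>P0. prime p \<and> norm (coeff_dot a p y) \<ge> c" if y: "norm y = 1" for y P0
  proof (rule ccontr)
    assume neg: "\<not> ?thesis"
    have small: "norm (coeff_dot a p y) < c" if "prime p" "p \<ge> P0" for p 
    proof (rule ccontr)
      assume "\<not> norm (coeff_dot a p y) < c"
      then have "p \<ge> P0 \<and> prime p \<and> c \<le> norm (coeff_dot a p y)" using that by simp
      with neg show False by blast
    qed
    define P where "P x = {p::nat. prime p \<and> real p \<le> x}" for x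
    have fP: "finite (P x)" for x
    proof (rule finite_subset)
      show "P x \<subseteq> {..nat \<lfloor>x\<rfloor>}" by (auto simp: P_def le_nat_floor)
    qed simp
    define T where "T x = (\<Sum>p\<in>P x. (norm (coeff_dot a p y))\<^sup>2 / real p)" for x
    define L where "L x = ln (ln x)" for x :: real
    have Linf: "filterlim L at_top at_top"
      unfolding L_def by (intro filterlim_compose[OF ln_at_top] ln_at_top)
    have Lpos: "\<forall>\<^sub>F x in at_top. L x > 0" using Linf by (simp add: filterlim_at_top_dense)
    have pair: "((\<lambda>x. (\<Sum>p\<in>P x. a i p * cnj (a j p) / of_nat p) / of_real (L x)) \<longlongrightarrow> of_real (m i j)) at_top" for i j
    proof -
      obtain \<epsilon> :: "real \<Rightarrow> complex" where e: "\<epsilon> \<in> o(\<lambda>_. 1)"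
        "\<forall>\<^sub>F x in at_top. (\<Sum>p | prime p \<and> real p \<le> x. a i p * cnj (a j p) / of_nat p) = (of_real (m i j) + \<epsilon> x) * of_real (ln (ln x))"
        using asym[of i j] by blast
      have "(\<epsilon> \<longlongrightarrow> 0) at_top" using smalloD_tendsto[OF e(1)] by simp
      then have "((\<lambda>x. of_real (m i j) + \<epsilon> x) \<longlongrightarrow> of_real (m i j) + 0) at_top" by (intro tendsto_intros)
      moreover have "\<forall>\<^sub>F x in at_top. of_real (m i j) + \<epsilon> x = (\<Sum>p\<in>P x. a i p * cnj (a j p) / of_nat p) / of_real (L x)"
        using e(2) Lpos by eventually_elim (simp add: P_def L_def)
      ultimately show ?thesis by (simp add: Lim_transform_eventually)
    qed
    have Teq: "complex_of_real (T x) / of_real (L x) = (\<Sum>i\<in>UNIV. \<Sum>j\<in>UNIV. cnj (y $ i) * y $ j * ((\<Sum>p\<in>P x. a i p * cnj (a j p) / of_nat p) / of_real (L x)))" for x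
    proof -
      have "complex_of_real ((norm (coeff_dot a p y))\<^sup>2) = (\<Sum>i\<in>UNIV. \<Sum>j\<in>UNIV. cnj (y $ i) * y $ j * (a i p * cnj (a j p)))" for p
        unfolding complex_norm_square coeff_dot_def cnj_sum sum_product by (intro sum.cong refl) (simp add: mult_ac)
      then have "complex_of_real (T x) = (\<Sum>p\<in>P x. \<Sum>i\<in>UNIV. \<Sum>j\<in>UNIV. cnj (y $ i) * y $ j * (a i p * cnj (a j p) / of_nat p))"
        by (simp add: T_def sum_divide_distrib)
      also have "\<dots> = (\<Sum>i\<in>UNIV. \<Sum>j\<in>UNIV. \<Sum>p\<in>P x. cnj (y $ i) * y $ j * (a i p * cnj (a j p) / of_nat p))"
        by (subst sum.swap) (intro sum.cong refl sum.swap)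
      finally show ?thesis by (simp add: sum_distrib_left sum_divide_distrib)
    qed
    \<comment> \<open>The off-diagonal limits vanish, so the limiting quadratic form is diagonal and
      on unit vectors at least the smallest entry \<open>m0\<close>.\<close>
    define M where "M = (\<Sum>i\<in>UNIV. (norm (y $ i))\<^sup>2 * m i i)"
    have "((\<lambda>x. complex_of_real (T x) / of_real (L x)) \<longlongrightarrow> (\<Sum>i\<in>UNIV. \<Sum>j\<in>UNIV. cnj (y $ i) * y $ j * of_real (m i j))) at_top"
      unfolding Teq by (intro tendsto_sum tendsto_mult tendsto_const pair)
    also have "(\<Sum>i\<in>UNIV. \<Sum>j\<in>UNIV. cnj (y $ i) * y $ j * of_real (m i j)) = of_real M"
    proof -
      have "(\<Sum>j\<in>UNIV. cnj (y $ i) * y $ j * of_real (m i j)) = of_real ((norm (y $ i))\<^sup>2 * m i i)" for i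
      proof -
        have "(\<Sum>j\<in>UNIV. cnj (y $ i) * y $ j * of_real (m i j)) = (\<Sum>j\<in>UNIV. if j = i then cnj (y $ i) * y $ i * of_real (m i i) else 0)"
          using m(2) by (intro sum.cong) auto
        also have "\<dots> = cnj (y $ i) * y $ i * of_real (m i i)" by simp
        finally show ?thesis by (simp add: complex_norm_square mult.commute del: of_real_power)
      qed
      then show ?thesis by (simp add: M_def)
    qed
    finally have "((\<lambda>x. complex_of_real (T x / L x)) \<longlongrightarrow> complex_of_real M) at_top" by simp
    then have lim: "((\<lambda>x. T x / L x) \<longlongrightarrow> M) at_top" by (simp only: tendsto_of_real_iff)
    have "M \<ge> m0"
    proof -
      have "(norm y)\<^sup>2 = (\<Sum>i\<in>UNIV. (norm (y $ i))\<^sup>2)"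
        by (simp add: norm_vec_def L2_set_def sum_nonneg)
      then have "m0 = (\<Sum>i\<in>UNIV. (norm (y $ i))\<^sup>2 * m0)"
        using y by (simp add: sum_distrib_right[symmetric])
      also have "\<dots> \<le> M" unfolding M_def by (intro sum_mono mult_left_mono m0) auto
      finally show ?thesis .
    qed
    define K where "K = (\<Sum>p\<in>{p. prime p \<and> p < P0}. (norm (coeff_dot a p y))\<^sup>2 / real p)"
    have up: "T x / L x \<le> K / L x + m0 / 2" if x: "x > 0" "ln x \<ge> 2" "L x > 0" for x
    proof -
      have "T x \<le> (\<Sum>p\<in>{p. prime p \<and> p < P0} \<union> P x. if p < P0 then (norm (coeff_dot a p y))\<^sup>2 / real p else c\<^sup>2 * (1 / real p))"
        unfolding T_def
      proof (rule order_trans[OF sum_mono[where g = "\<lambda>p. if p < P0 then (norm (coeff_dot a p y))\<^sup>2 / real p else c\<^sup>2 * (1 / real p)"] sum_mono2])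
        fix p assume "p \<in> P x"
        then have "(norm (coeff_dot a p y))\<^sup>2 \<le> c\<^sup>2" if "\<not> p < P0"
          using small[of p] that by (intro power_mono) (auto simp: P_def)
        then show "(norm (coeff_dot a p y))\<^sup>2 / real p \<le> (if p < P0 then (norm (coeff_dot a p y))\<^sup>2 / real p else c\<^sup>2 * (1 / real p))"
          by (auto intro: divide_right_mono)
      qed (auto simp: fP)
      also have "\<dots> \<le> (\<Sum>p\<in>{p. prime p \<and> p < P0}. (norm (coeff_dot a p y))\<^sup>2 / real p) + (\<Sum>p\<in>P x. c\<^sup>2 * (1 / real p))"
      proof -
        let ?g = "\<lambda>p. if p < P0 then (norm (coeff_dot a p y))\<^sup>2 / real p else c\<^sup>2 * (1 / real p)"
        have "sum ?g ({p. prime p \<and> p < P0} \<union> P x) = sum ?g {p. prime p \<and> p < P0} + sum ?g (P x - {p. prime p \<and> p < P0})"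
          using sum.union_disjoint[of "{p. prime p \<and> p < P0}" "P x - {p. prime p \<and> p < P0}" ?g] fP by (simp add: Un_Diff_cancel)
        also have "sum ?g {p. prime p \<and> p < P0} = (\<Sum>p\<in>{p. prime p \<and> p < P0}. (norm (coeff_dot a p y))\<^sup>2 / real p)"
          by (intro sum.cong) auto
        also have "sum ?g (P x - {p. prime p \<and> p < P0}) = (\<Sum>p\<in>P x - {p. prime p \<and> p < P0}. c\<^sup>2 * (1 / real p))"
          by (intro sum.cong) (auto simp: P_def)
        also have "\<dots> \<le> (\<Sum>p\<in>P x. c\<^sup>2 * (1 / real p))" by (intro sum_mono2 fP) auto
        finally show ?thesis by simp
      qed
      also have "(\<Sum>p\<in>P x. c\<^sup>2 * (1 / real p)) = c\<^sup>2 * (\<Sum>p\<in>P x. 1 / real p)" by (simp add: sum_distrib_left)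
      also have "\<dots> \<le> c\<^sup>2 * (12 * L x)"
        using sum_prime_reciprocals_le[OF x(1,2)] by (intro mult_left_mono) (auto simp: P_def L_def)
      finally have "T x \<le> K + m0 / 2 * L x" by (simp add: K_def c(2))
      then show ?thesis using x(3) by (simp add: field_simps)
    qed
    have "\<forall>\<^sub>F x::real in at_top. ln x \<ge> 2" using ln_at_top by (simp add: filterlim_at_top)
    with Lpos eventually_gt_at_top[of 0]
    have ev: "\<forall>\<^sub>F x in at_top. T x / L x \<le> K / L x + m0 / 2"
      by eventually_elim (rule up)
    have "((\<lambda>x. K / L x + m0 / 2) \<longlongrightarrow> 0 + m0 / 2) at_top"
      by (intro tendsto_add tendsto_const tendsto_divide_0[OF tendsto_const] filterlim_at_top_imp_at_infinity Linf)
    from tendsto_le[OF trivial_limit_at_top_linorder this lim ev]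
    show False using \<open>M \<ge> m0\<close> m0(1) by simp
  qed
  with c(1) show ?thesis by (rule that)
qed

section \<open>Local factors on a vertical line\<close>

lemma nth_prime_prime: "prime (nth_prime m)"
  using enumerate_in_set[OF primes_infinite] by (simp add: nth_prime_def)

text \<open>A linear lower bound suffices, since it is later raised to a power below
  \<open>- (1 / 2)\<close> and squared. Truncated subtraction makes \<open>nth_prime 0\<close> equal
  to \<open>nth_prime 1\<close>, so the index 0 needs no exception.\<close>

lemma nth_prime_ge: "nth_prime m \<ge> Suc m"
proof -
  have "enumerate {p::nat. prime p} n \<ge> n + 2" for n
  proof (induction n)
    case 0
    have "prime (enumerate {p::nat. prime p} 0)" using enumerate_in_set[OF primes_infinite, of 0] by simp
    from prime_ge_2_nat[OF this] show ?case by simp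
  next
    case (Suc n)
    then show ?case using enumerate_step[OF primes_infinite, of n] by simp
  qed
  from this[of "m - 1"] show ?thesis by (cases m) (simp_all add: nth_prime_def)
qed

lemma nth_prime_surj:
  assumes "prime p" obtains m where "m \<ge> 1" "nth_prime m = p"
proof -
  obtain n where "enumerate {p::nat. prime p} n = p"
    using enumerate_Ex[OF primes_infinite, of p] assms by auto
  then have "nth_prime (Suc n) = p" by (simp add: nth_prime_def)
  then show ?thesis using that[of "Suc n"] by simp
qed

text \<open>Weakening \<open>c\<close> to \<open>c / 2\<close> pays for openness: the
  \<open>R\<close> indices chosen for one direction keep working in a neighbourhood.
  \<open>R\<close> fixes the number of decaying factors and \<open>P0\<close> keeps the primes large
  enough for the first Fourier coefficient to dominate.\<close>

lemma good_indices:
  fixes b :: "'N::finite \<Rightarrow> nat \<Rightarrow> complex"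
  assumes "c > 0" and good: "\<And>y P0. norm y = 1 \<Longrightarrow> \<exists>p\<ge>P0. prime p \<and> norm (coeff_dot b p y) \<ge> c"
  shows "\<exists>n. \<forall>y. norm y = 1 \<longrightarrow> (\<exists>S\<subseteq>{1..n}. card S = R \<and>
     (\<forall>m\<in>S. nth_prime m \<ge> P0 \<and> norm (coeff_dot b (nth_prime m) y) \<ge> c / 2))"
proof -
  define Sph where "Sph = sphere (0 :: complex ^ 'N) 1"
  define Q where "Q y = {m. m \<ge> 1 \<and> nth_prime m \<ge> P0 \<and> norm (coeff_dot b (nth_prime m) y) \<ge> c}" for y
  have "infinite (Q y)" if y: "y \<in> Sph" for y
  proof
    assume f: "finite (Q y)"
    \<comment> \<open>The inserted 0 keeps \<open>Max\<close> meaningful when \<open>Q y\<close> is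
      empty.\<close>
    define B where "B = Max (insert 0 (nth_prime ` Q y))"
    obtain p where p: "p \<ge> max P0 (Suc B)" "prime p" "norm (coeff_dot b p y) \<ge> c"
      using good[of y "max P0 (Suc B)"] y by (auto simp: Sph_def)
    obtain m where m: "m \<ge> 1" "nth_prime m = p" using nth_prime_surj[OF p(2)] .
    then have "m \<in> Q y" using p by (simp add: Q_def)
    then have "p \<le> B" unfolding B_def using m f by (intro Max_ge) auto
    then show False using p by simp
  qed
  then have "\<exists>S. finite S \<and> card S = R \<and> S \<subseteq> Q y" if "y \<in> Sph" for y
    using infinite_arbitrarily_large that by blast
  then obtain S where S: "\<And>y. y \<in> Sph \<Longrightarrow> finite (S y) \<and> card (S y) = R \<and> S y \<subseteq> Q y" by metis
  define U where "U y = (\<Inter>m\<in>S y. {z. norm (coeff_dot b (nth_prime m) z) > c / 2})" for y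
  have U: "open (U y)" "y \<in> U y" if "y \<in> Sph" for y
  proof -
    show "open (U y)" unfolding U_def
    proof (intro open_INT ballI)
      fix m
      have "open ((\<lambda>z. norm (coeff_dot b (nth_prime m) z)) -` {c / 2<..})"
        by (intro open_vimage continuous_intros continuous_coeff_dot)
      then show "open {z. norm (coeff_dot b (nth_prime m) z) > c / 2}" by (simp add: vimage_def)
    qed (use S[OF that] in auto)
    show "y \<in> U y" using S[OF that] \<open>c > 0\<close> by (force simp: U_def Q_def)
  qed
  have "compact Sph" by (simp add: Sph_def)
  moreover have "Sph \<subseteq> (\<Union>y\<in>Sph. U y)" using U(2) by auto
  ultimately obtain D where D: "D \<subseteq> Sph" "finite D" "Sph \<subseteq> (\<Union>y\<in>D. U y)"
    using compactE_image[of Sph Sph U] U(1) by blast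
  define n where "n = Max (insert 0 (\<Union>y\<in>D. S y))"
  have fin: "finite (\<Union>y\<in>D. S y)" using D S by blast
  have "\<exists>S\<subseteq>{1..n}. card S = R \<and> (\<forall>m\<in>S. nth_prime m \<ge> P0 \<and> norm (coeff_dot b (nth_prime m) y) \<ge> c / 2)"
    if "norm y = 1" for y
  proof -
    have "y \<in> Sph" using that by (simp add: Sph_def)
    then obtain z where z: "z \<in> D" "y \<in> U z" using D(3) by blast
    then have zS: "finite (S z) \<and> card (S z) = R \<and> S z \<subseteq> Q z" using S D(1) by blast
    have "m \<in> {1..n} \<and> nth_prime m \<ge> P0 \<and> norm (coeff_dot b (nth_prime m) y) \<ge> c / 2" if "m \<in> S z" for m
    proof -
      have "m \<le> n" unfolding n_def using fin z that by (intro Max_ge) auto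
      moreover have "m \<in> Q z" using zS that by blast
      moreover have "norm (coeff_dot b (nth_prime m) y) > c / 2" using z(2) that by (auto simp: U_def)
      ultimately show ?thesis by (simp add: Q_def)
    qed
    then show ?thesis using zS by (intro exI[of _ "S z"]) auto
  qed
  then show ?thesis by blast
qed

text \<open>The Fourier coefficients of \<open>\<theta> \<mapsto> log_local b p (\<sigma> + 2 \<pi> i \<theta> / ln p)\<close>.\<close>

definition local_coeff :: "(nat \<Rightarrow> complex) \<Rightarrow> nat \<Rightarrow> real \<Rightarrow> nat \<Rightarrow> complex" where
  "local_coeff b p \<sigma> k = b (p ^ Suc k) * complex_of_real (real p powr (- (real (Suc k) * \<sigma>)))"

text \<open>The scaling by \<open>2 * pi / ln p\<close> in \<open>s_point\<close> makes the powers
  of \<open>p\<close> exponentials of period 1 in \<open>t\<close>, which is why the local factors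
  become trigonometric series on the unit interval.\<close>

lemma prime_powr_line:
  assumes "prime p"
  shows "of_nat p powr (- (of_nat k * Complex \<sigma> (2 * pi * t / ln (real p))))
     = complex_of_real (real p powr (- (real k * \<sigma>))) * cis (- (2 * pi * real k * t))"
proof -
  have p: "p > 1" using assms by (rule prime_gt_1_nat)
  define s where "s = Complex \<sigma> (2 * pi * t / ln (real p))"
  have "of_nat p powr (- (of_nat k * s)) = exp (- (of_nat k * s) * of_real (ln (real p)))"
    using p by (simp add: powr_def Ln_of_nat)
  also have "\<dots> = of_real (exp (Re (- (of_nat k * s) * of_real (ln (real p))))) * cis (Im (- (of_nat k * s) * of_real (ln (real p))))"
    by (rule exp_eq_polar)
  also have "Re (- (of_nat k * s) * of_real (ln (real p))) = - (real k * \<sigma>) * ln (real p)"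
    by (simp add: s_def)
  also have "Im (- (of_nat k * s) * of_real (ln (real p))) = - (2 * pi * real k * t)"
    using p by (simp add: s_def)
  finally show ?thesis using p by (simp add: powr_def s_def)
qed

lemma log_local_eq_trig_series:
  assumes "prime p"
  shows "log_local b p (Complex \<sigma> (2 * pi * t / ln (real p))) = trig_series (local_coeff b p \<sigma>) t"
  unfolding log_local_def trig_series_def local_coeff_def
  using prime_powr_line[OF assms] by (simp add: mult.assoc del: of_nat_Suc power_Suc)

text \<open>The local logarithm is a power series in \<open>p powr (- s)\<close>. The bound on
  \<open>b\<close> with exponent below \<open>1 / 2\<close> gives convergence at the radius
  \<open>p powr (- (1 / 2))\<close>, that is, analyticity for \<open>Re s > 1 / 2\<close>, where the
  series may be differentiated termwise.\<close>

lemma logderiv_local_eq_trig_series: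
  assumes p: "prime p" and "\<sigma> > 1 / 2" and \<theta>: "\<theta> < 1 / 2"
    and b: "\<And>k. k \<ge> 1 \<Longrightarrow> norm (b (p ^ k)) \<le> C * real p powr (real k * \<theta>)"
  shows "deriv (local_factor b p) (Complex \<sigma> (2 * pi * t / ln (real p))) / local_factor b p (Complex \<sigma> (2 * pi * t / ln (real p)))
     = trig_series (\<lambda>k. - (ln (real p) * real (Suc k)) * local_coeff b p \<sigma> k) t"
proof -
  have p1: "real p > 1" using prime_gt_1_nat[OF p] by simp
  \<comment> \<open>The local logarithm starts at the first power of \<open>p\<close>, whereas
    \<open>b (p ^ 0)\<close> is arbitrary, so the constant term is set to 0.\<close>
  define c where "c n = (if n = 0 then 0 else b (p ^ n))" for n
  define P where "P z = (\<Sum>n. c n * z ^ n)" for z :: complex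
  define K where "K = complex_of_real (real p powr (- (1 / 2)))"
  have sK: "summable (\<lambda>n. c n * K ^ n)"
  proof (rule summable_comparison_test')
    show "summable (\<lambda>n. \<bar>C\<bar> * (real p powr (\<theta> - 1 / 2)) ^ n)"
      using p1 \<theta> by (intro summable_mult summable_geometric) (simp add: powr_less_one)
    fix n :: nat assume "n \<ge> 1"
    then have "norm (c n * K ^ n) \<le> C * real p powr (real n * \<theta>) * (real p powr (- (1 / 2))) ^ n"
      using b[of n] by (auto simp: c_def K_def norm_mult norm_power intro!: mult_right_mono)
    also have "\<dots> \<le> \<bar>C\<bar> * real p powr (real n * \<theta>) * (real p powr (- (1 / 2))) ^ n"
      by (intro mult_right_mono) auto
    also have "\<dots> = \<bar>C\<bar> * (real p powr (\<theta> - 1 / 2)) ^ n"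
      using p1 by (simp add: powr_power powr_add[symmetric] algebra_simps)
    finally show "norm (c n * K ^ n) \<le> \<bar>C\<bar> * (real p powr (\<theta> - 1 / 2)) ^ n" .
  qed
  have sz: "norm (of_nat p powr (- s) :: complex) < norm K" if "Re s > 1 / 2" for s
    using that p1 by (simp add: K_def norm_powr_real_powr)
  have logP: "log_local b p s = P (of_nat p powr (- s))" if "Re s > 1 / 2" for s
  proof -
    define z where "z = (of_nat p powr (- s) :: complex)"
    have "summable (\<lambda>n. c n * z ^ n)"
      using powser_inside[OF sK] sz[OF that] by (simp add: z_def)
    then have "P z = (\<Sum>k. c (Suc k) * z ^ Suc k)"
      unfolding P_def using suminf_split_head[of "\<lambda>n. c n * z ^ n"] by (simp add: c_def)
    moreover have "z ^ Suc k = of_nat p powr (- (of_nat (Suc k) * s))" for k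
    proof -
      have "z ^ Suc k = exp (of_nat (Suc k) * (- s * Ln (of_nat p)))"
        using p1 unfolding exp_of_nat_mult by (simp add: z_def powr_def)
      then show ?thesis using p1 by (simp add: powr_def algebra_simps)
    qed
    ultimately show ?thesis by (simp add: log_local_def c_def z_def del: power_Suc of_nat_Suc)
  qed
  define s where "s = Complex \<sigma> (2 * pi * t / ln (real p))"
  define z where "z = (of_nat p powr (- s) :: complex)"
  have s: "Re s > 1 / 2" using assms(2) by (simp add: s_def)
  have dP: "(P has_field_derivative (\<Sum>n. diffs c n * z ^ n)) (at z)"
    unfolding P_def by (rule termdiffs_strong[OF sK]) (use sz[OF s] in \<open>simp add: z_def\<close>)
  have dz: "((\<lambda>s. of_nat p powr (- s)) has_field_derivative - (z * of_real (ln (real p)))) (at s)"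
  proof -
    have eq: "(of_nat p powr (- s') :: complex) = exp (- s' * of_real (ln (real p)))" for s'
      using p1 by (simp add: powr_def Ln_of_nat)
    show ?thesis unfolding z_def eq by (auto intro!: derivative_eq_intros)
  qed
  have "((\<lambda>s. P (of_nat p powr (- s))) has_field_derivative (\<Sum>n. diffs c n * z ^ n) * - (z * of_real (ln (real p)))) (at s)"
    by (rule DERIV_chain2[OF dP[unfolded z_def] dz, folded z_def])
  then have dL: "(log_local b p has_field_derivative (\<Sum>n. diffs c n * z ^ n) * - (z * of_real (ln (real p)))) (at s)"
  proof (rule has_field_derivative_transform_within_open)
    show "open {s. Re s > 1 / 2}" by (rule open_halfspace_Re_gt)
  qed (use s logP in auto)
  have "(local_factor b p has_field_derivative exp (log_local b p s) * ((\<Sum>n. diffs c n * z ^ n) * - (z * of_real (ln (real p))))) (at s)"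
    unfolding local_factor_def by (rule DERIV_chain2[OF DERIV_exp dL])
  then have "deriv (local_factor b p) s / local_factor b p s = (\<Sum>n. diffs c n * z ^ n) * - (z * of_real (ln (real p)))"
    by (simp add: DERIV_imp_deriv local_factor_def)
  also have "\<dots> = (\<Sum>n. (diffs c n * z ^ n) * - (z * of_real (ln (real p))))"
  proof -
    have "summable (\<lambda>n. diffs c n * z ^ n)"
      by (rule termdiff_converges[of _ "norm K"]) (use sz[OF s] powser_inside[OF sK] in \<open>auto simp: z_def\<close>)
    then show ?thesis by (rule suminf_mult2)
  qed
  also have "(\<lambda>n. (diffs c n * z ^ n) * - (z * of_real (ln (real p)))) = (\<lambda>k. (- (ln (real p) * real (Suc k)) * local_coeff b p \<sigma> k) * cis (- (2 * pi * real (Suc k) * t)))"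
  proof
    fix n
    have "z ^ Suc n = exp (of_nat (Suc n) * (- s * Ln (of_nat p)))"
      using p1 unfolding exp_of_nat_mult by (simp add: z_def powr_def)
    then have "z ^ Suc n = of_nat p powr (- (of_nat (Suc n) * s))" using p1 by (simp add: powr_def algebra_simps)
    then have zn: "z ^ Suc n = complex_of_real (real p powr (- (real (Suc n) * \<sigma>))) * cis (- (2 * pi * real (Suc n) * t))"
      using prime_powr_line[OF p, of "Suc n" \<sigma> t] by (simp add: s_def del: of_nat_Suc)
    have "(diffs c n * z ^ n) * - (z * of_real (ln (real p))) = - (of_real (ln (real p)) * of_nat (Suc n)) * b (p ^ Suc n) * z ^ Suc n"
      by (simp add: diffs_def c_def mult_ac del: of_nat_Suc)
    then show "(diffs c n * z ^ n) * - (z * of_real (ln (real p))) = (- (ln (real p) * real (Suc n)) * local_coeff b p \<sigma> n) * cis (- (2 * pi * real (Suc n) * t))"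
      unfolding zn by (simp add: local_coeff_def mult_ac del: of_nat_Suc power_Suc)
  qed
  finally show ?thesis by (simp add: s_def trig_series_def)
qed

section \<open>Weighted distributions as images of the cube\<close>

lemma cube_measure_eq_density:
  assumes "finite I"
  shows "cube_measure I = density (PiM I (\<lambda>_. lborel)) (indicator (I \<rightarrow>\<^sub>E {0..<1}))"
proof (rule cube.PiM_eqI[OF assms, symmetric])
  interpret product_sigma_finite "\<lambda>_::nat. lborel :: real measure" ..
  have Q: "(I \<rightarrow>\<^sub>E {0..<1::real}) \<in> sets (PiM I (\<lambda>_. lborel))"
    using assms by (intro sets_PiM_I_finite) auto
  show "sets (density (PiM I (\<lambda>_. lborel)) (indicator (I \<rightarrow>\<^sub>E {0..<1}))) = sets (PiM I (\<lambda>_. unit_measure))"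
    by (simp, intro sets_PiM_cong) auto
  fix A :: "nat \<Rightarrow> real set" assume A: "\<And>i. i \<in> I \<Longrightarrow> A i \<in> sets unit_measure"
  then have A': "Pi\<^sub>E I A \<in> sets (PiM I (\<lambda>_. lborel))"
    using assms by (intro sets_PiM_I_finite) auto
  have "emeasure (density (PiM I (\<lambda>_. lborel)) (indicator (I \<rightarrow>\<^sub>E {0..<1}))) (Pi\<^sub>E I A)
      = (\<integral>\<^sup>+\<theta>. indicator (\<Pi>\<^sub>E i\<in>I. A i \<inter> {0..<1}) \<theta> \<partial>PiM I (\<lambda>_. lborel))"
    using Q by (subst emeasure_density[OF _ A']) (auto simp: indicator_def PiE_iff intro!: nn_integral_cong)
  also have "\<dots> = emeasure (PiM I (\<lambda>_. lborel)) (\<Pi>\<^sub>E i\<in>I. A i \<inter> {0..<1})"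
    using assms A by (intro nn_integral_indicator sets_PiM_I_finite) auto
  also have "\<dots> = (\<Prod>i\<in>I. emeasure lborel (A i \<inter> {0..<1}))"
    using assms A by (intro emeasure_PiM) auto
  also have "\<dots> = (\<Prod>i\<in>I. emeasure unit_measure (A i))"
  proof (intro prod.cong refl)
    fix i assume "i \<in> I"
    then have [measurable]: "A i \<in> sets borel" using A by simp
    have "emeasure unit_measure (A i) = (\<integral>\<^sup>+t. indicator (A i \<inter> {0..<1}) t \<partial>lborel)"
    proof -
      have "emeasure unit_measure (A i) = (\<integral>\<^sup>+t. ennreal (indicator {0..<1} t) * indicator (A i) t \<partial>lborel)"
        unfolding unit_measure_def by (subst emeasure_density) auto
      also have "\<dots> = (\<integral>\<^sup>+t. indicator (A i \<inter> {0..<1}) t \<partial>lborel)"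
        by (rule nn_integral_cong) (auto simp: indicator_def)
      finally show ?thesis .
    qed
    then show "emeasure lborel (A i \<inter> {0..<1}) = emeasure unit_measure (A i)" by simp
  qed
  finally show "emeasure (density (PiM I (\<lambda>_. lborel)) (indicator (I \<rightarrow>\<^sub>E {0..<1}))) (Pi\<^sub>E I A) = (\<Prod>i\<in>I. emeasure unit_measure (A i))" .
qed

text \<open>The restriction to the cube moves from \<open>W\<close> into the measure. What was given
  by \<open>measure_of\<close> becomes an image measure, so that integrals against it reduce to
  integrals over the cube.\<close>

lemma weighted_distribution_eq_distr:
  fixes b :: "'N::finite \<Rightarrow> nat \<Rightarrow> complex"
  assumes w [measurable]: "w \<in> borel_measurable (PiM {1..n} (\<lambda>_. lborel))"
  shows "weighted_distribution b n \<sigma> w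
     = distr (density (cube_measure {1..n}) (\<lambda>\<theta>. ennreal (w \<theta>))) borel (vec_log_Fn b n \<sigma>)"
    and "w \<in> borel_measurable (cube_measure {1..n})"
    and "vec_log_Fn b n \<sigma> \<in> measurable (cube_measure {1..n}) borel"
proof -
  let ?P = "PiM {1..n} (\<lambda>_. lborel) :: (nat \<Rightarrow> real) measure"
  let ?Q = "{1..n} \<rightarrow>\<^sub>E {0..<1::real}"
  have Q [measurable]: "?Q \<in> sets ?P" by (intro sets_PiM_I_finite) auto
  have cm: "cube_measure {1..n} = density ?P (indicator ?Q)" by (rule cube_measure_eq_density) simp
  have sc: "sets (cube_measure {1..n}) = sets ?P" unfolding cm by simp
  show wm [measurable]: "w \<in> borel_measurable (cube_measure {1..n})"
    using w by (simp cong: measurable_cong_sets add: measurable_cong_sets[OF sc refl])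
  show vm [measurable]: "vec_log_Fn b n \<sigma> \<in> measurable (cube_measure {1..n}) borel"
    using vec_log_Fn_measurable[of b n \<sigma>] by (simp add: measurable_cong_sets[OF sc refl])
  show "weighted_distribution b n \<sigma> w
     = distr (density (cube_measure {1..n}) (\<lambda>\<theta>. ennreal (w \<theta>))) borel (vec_log_Fn b n \<sigma>)"
  proof (rule measure_eqI)
    have "sigma_sets UNIV (sets borel) = sets (borel :: (complex ^ 'N) measure)"
      using sets.sigma_sets_eq[of "borel :: (complex ^ 'N) measure"] by simp
    then show s: "sets (weighted_distribution b n \<sigma> w) = sets (distr (density (cube_measure {1..n}) (\<lambda>\<theta>. ennreal (w \<theta>))) borel (vec_log_Fn b n \<sigma>))"
      unfolding weighted_distribution_def by (simp add: sets_measure_of)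
    fix E assume "E \<in> sets (weighted_distribution b n \<sigma> w)"
    then have E [measurable]: "E \<in> sets borel" using s by simp
    have pre: "vec_log_Fn b n \<sigma> -` E \<inter> space (cube_measure {1..n}) \<in> sets (cube_measure {1..n})"
      by (rule measurable_sets[OF vm E])
    have "emeasure (distr (density (cube_measure {1..n}) (\<lambda>\<theta>. ennreal (w \<theta>))) borel (vec_log_Fn b n \<sigma>)) E
       = (\<integral>\<^sup>+\<theta>. ennreal (w \<theta>) * indicator (vec_log_Fn b n \<sigma> -` E \<inter> space (cube_measure {1..n})) \<theta> \<partial>cube_measure {1..n})"
    proof -
      have "vec_log_Fn b n \<sigma> \<in> measurable (density (cube_measure {1..n}) (\<lambda>\<theta>. ennreal (w \<theta>))) borel"
        using vm by (simp only: measurable_density_eq1)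
      from emeasure_distr[OF this E] show ?thesis
        unfolding space_density by (simp only: emeasure_density[OF measurable_compose[OF wm measurable_ennreal] pre])
    qed
    also have "\<dots> = (\<integral>\<^sup>+\<theta>. indicator ?Q \<theta> * (ennreal (w \<theta>) * indicator (vec_log_Fn b n \<sigma> -` E \<inter> space ?P) \<theta>) \<partial>?P)"
    proof -
      have sp: "space (cube_measure {1..n}) = space ?P" using sc by (rule sets_eq_imp_space_eq)
      have "vec_log_Fn b n \<sigma> -` E \<inter> space ?P \<in> sets ?P" using pre sc sp by simp
      then have "(\<lambda>\<theta>. ennreal (w \<theta>) * indicator (vec_log_Fn b n \<sigma> -` E \<inter> space ?P) \<theta>) \<in> borel_measurable ?P"
        by (rule borel_measurable_times_ennreal[OF measurable_compose[OF w measurable_ennreal] borel_measurable_indicator])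
      from nn_integral_density[OF borel_measurable_indicator[OF Q] this]
      show ?thesis unfolding sp unfolding cm .
    qed
    also have "\<dots> = (\<integral>\<^sup>+\<theta>\<in>W b n \<sigma> E. ennreal (w \<theta>) \<partial>?P)"
      by (intro nn_integral_cong) (auto simp: W_def indicator_def)
    finally show "emeasure (weighted_distribution b n \<sigma> w) E = emeasure (distr (density (cube_measure {1..n}) (\<lambda>\<theta>. ennreal (w \<theta>))) borel (vec_log_Fn b n \<sigma>)) E"
      by (simp add: emeasure_weighted_distribution[OF w E])
  qed
qed

lemma char_fun_weighted_distribution:
  fixes b :: "'N::finite \<Rightarrow> nat \<Rightarrow> complex"
  assumes w: "w \<in> borel_measurable (PiM {1..n} (\<lambda>_. lborel))" and w0: "\<And>\<theta>. w \<theta> \<ge> 0"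
    and i: "integrable (cube_measure {1..n}) w"
  shows "finite_borel_measure (weighted_distribution b n \<sigma> w)"
    and "char_fun (weighted_distribution b n \<sigma> w) y = (LINT \<theta>|cube_measure {1..n}. cis (vec_log_Fn b n \<sigma> \<theta> \<bullet> y) * w \<theta>)"
proof -
  note eq = weighted_distribution_eq_distr(1)[OF w, of b \<sigma>]
  note vm = weighted_distribution_eq_distr(3)[OF w, of b \<sigma>]
  note wm = weighted_distribution_eq_distr(2)[OF w]
  note [measurable] = wm vm
  show "finite_borel_measure (weighted_distribution b n \<sigma> w)"
    unfolding finite_borel_measure_def
  proof
    have "(\<integral>\<^sup>+\<theta>. ennreal (w \<theta>) \<partial>cube_measure {1..n}) < \<infinity>"
      using i w0 by (simp add: integrable_iff_bounded)
    then have "finite_measure (density (cube_measure {1..n}) (\<lambda>\<theta>. ennreal (w \<theta>)))"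
    proof (intro finite_measureI)
      assume *: "(\<integral>\<^sup>+\<theta>. ennreal (w \<theta>) \<partial>cube_measure {1..n}) < \<infinity>"
      have "emeasure (density (cube_measure {1..n}) (\<lambda>\<theta>. ennreal (w \<theta>))) (space (cube_measure {1..n}))
         = (\<integral>\<^sup>+\<theta>. ennreal (w \<theta>) * indicator (space (cube_measure {1..n})) \<theta> \<partial>cube_measure {1..n})"
        by (rule emeasure_density[OF measurable_compose[OF wm measurable_ennreal] sets.top])
      also have "\<dots> = (\<integral>\<^sup>+\<theta>. ennreal (w \<theta>) \<partial>cube_measure {1..n})"
        by (rule nn_integral_cong) (simp add: indicator_def)
      finally show "emeasure (density (cube_measure {1..n}) (\<lambda>\<theta>. ennreal (w \<theta>))) (space (density (cube_measure {1..n}) (\<lambda>\<theta>. ennreal (w \<theta>)))) \<noteq> \<infinity>"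
        unfolding space_density using * by (simp only:)
    qed
    then show "finite_measure (weighted_distribution b n \<sigma> w)"
      unfolding eq by (rule finite_measure.finite_measure_distr) (use vm in measurable)
    show "sets (weighted_distribution b n \<sigma> w) = sets borel" unfolding eq by simp
  qed
  have "char_fun (weighted_distribution b n \<sigma> w) y = (LINT \<theta>|density (cube_measure {1..n}) (\<lambda>\<theta>. ennreal (w \<theta>)). cis (vec_log_Fn b n \<sigma> \<theta> \<bullet> y))"
  proof -
    have 1: "vec_log_Fn b n \<sigma> \<in> measurable (density (cube_measure {1..n}) (\<lambda>\<theta>. ennreal (w \<theta>))) borel"
      using vm by (simp only: measurable_density_eq1)
    have 2: "(\<lambda>x. cis (x \<bullet> y)) \<in> borel_measurable borel" by measurable
    show ?thesis unfolding char_fun_def eq by (rule integral_distr[OF 1 2])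
  qed
  also have "\<dots> = (LINT \<theta>|cube_measure {1..n}. w \<theta> *\<^sub>R cis (vec_log_Fn b n \<sigma> \<theta> \<bullet> y))"
  proof (rule integral_density[OF _ wm])
    have "(\<lambda>x. cis (x \<bullet> y)) \<in> borel_measurable borel" by measurable
    then show "(\<lambda>\<theta>. cis (vec_log_Fn b n \<sigma> \<theta> \<bullet> y)) \<in> borel_measurable (cube_measure {1..n})"
      by (rule measurable_compose[OF vm])
  qed (simp add: w0)
  finally show "char_fun (weighted_distribution b n \<sigma> w) y = (LINT \<theta>|cube_measure {1..n}. cis (vec_log_Fn b n \<sigma> \<theta> \<bullet> y) * w \<theta>)"
    by (simp add: scaleR_conv_of_real mult.commute)
qed

section \<open>Fourier coefficients of the local factors, uniformly in the real part\<close>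

definition poly_geom_sum :: real where
  "poly_geom_sum = (\<Sum>k. real (Suc (Suc k)) ^ 3 * (3 / 4) ^ k)"

lemma summable_poly_geom: "summable (\<lambda>k. real (Suc (Suc k)) ^ 3 * (3 / 4 :: real) ^ k)"
proof (rule summable_comparison_test_bigo)
  show "summable (\<lambda>k. norm ((9 / 10 :: real) ^ k))" by (simp add: summable_geometric)
  show "(\<lambda>k. real (Suc (Suc k)) ^ 3 * (3 / 4 :: real) ^ k) \<in> O(\<lambda>k. (9 / 10) ^ k)" by real_asymp
qed

lemma poly_geom_sum_pos: "poly_geom_sum > 0"
  unfolding poly_geom_sum_def by (intro suminf_pos summable_poly_geom) simp

locale euler_family =
  fixes b :: "'N::finite \<Rightarrow> nat \<Rightarrow> complex" and \<eta> C :: real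
  assumes \<eta>: "\<eta> < 1 / 2" and C: "C \<ge> 0"
    and b_bound: "\<And>j p k. prime p \<Longrightarrow> k \<ge> 1 \<Longrightarrow> norm (b j (p ^ k)) \<le> C * real p powr (real k * \<eta>)"
begin

text \<open>One definition for two purposes: \<open>w j = cnj (y $ j)\<close> yields the phase in
  direction \<open>y\<close>, and the weight vector yields, after multiplication by the frequencies,
  the combined logarithmic derivative.\<close>

definition dir_coeff :: "('N \<Rightarrow> complex) \<Rightarrow> nat \<Rightarrow> real \<Rightarrow> nat \<Rightarrow> complex" where
  "dir_coeff w p \<sigma> k = (\<Sum>j\<in>UNIV. w j * local_coeff (b j) p \<sigma> k)"

definition dir_deriv_coeff :: "('N \<Rightarrow> complex) \<Rightarrow> nat \<Rightarrow> real \<Rightarrow> nat \<Rightarrow> complex" where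
  "dir_deriv_coeff w p \<sigma> k = - (ln (real p) * real (Suc k)) * dir_coeff w p \<sigma> k"

definition phase_fn :: "complex ^ 'N \<Rightarrow> real \<Rightarrow> nat \<Rightarrow> real \<Rightarrow> real" where
  "phase_fn y \<sigma> m t = Re (trig_series (dir_coeff (\<lambda>j. cnj (y $ j)) (nth_prime m) \<sigma>) t)"

definition amp_fn :: "('N \<Rightarrow> complex) \<Rightarrow> real \<Rightarrow> nat \<Rightarrow> real \<Rightarrow> complex" where
  "amp_fn w \<sigma> m t = trig_series (dir_deriv_coeff w (nth_prime m) \<sigma>) t"

definition weight :: "('N \<Rightarrow> complex) \<Rightarrow> nat \<Rightarrow> real \<Rightarrow> (nat \<Rightarrow> real) \<Rightarrow> real" where
  "weight w n \<sigma> \<theta> = (norm (\<Sum>j\<in>UNIV. w j * logderiv_Fn (b j) n \<sigma> \<theta>))\<^sup>2"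

definition B :: real where "B = real CARD('N) * C"

lemma B_nonneg: "B \<ge> 0" using C by (simp add: B_def)

text \<open>One factor \<open>p powr (1 - \<sigma>)\<close> is retained, because the bound has to be
  compared with a first coefficient of size \<open>p powr (- \<sigma>)\<close>; the other such
  factors are at most 1.\<close>

lemma norm_local_coeff_le:
  assumes p: "prime p" and "\<sigma> \<ge> 1"
  shows "norm (local_coeff (b j) p \<sigma> k) \<le> C * real p powr (real (Suc k) * (\<eta> - 1) + (1 - \<sigma>))"
proof -
  have p1: "real p > 1" using prime_gt_1_nat[OF p] by simp
  have "norm (local_coeff (b j) p \<sigma> k) \<le> C * real p powr (real (Suc k) * \<eta>) * real p powr (- (real (Suc k) * \<sigma>))"
    unfolding local_coeff_def norm_mult using b_bound[OF p, of "Suc k" j] by (simp add: mult_right_mono del: of_nat_Suc power_Suc)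
  also have "\<dots> = C * real p powr (real (Suc k) * \<eta> - real (Suc k) * \<sigma>)"
    by (simp add: powr_add[symmetric] del: of_nat_Suc)
  also have "\<dots> \<le> C * real p powr (real (Suc k) * (\<eta> - 1) + (1 - \<sigma>))"
  proof (intro mult_left_mono powr_mono C)
    have "real (Suc k) * (1 - \<sigma>) \<le> 1 * (1 - \<sigma>)"
      using assms(2) by (intro mult_right_mono_neg) auto
    then show "real (Suc k) * \<eta> - real (Suc k) * \<sigma> \<le> real (Suc k) * (\<eta> - 1) + (1 - \<sigma>)"
      by (simp add: algebra_simps)
  qed (use p1 in auto)
  finally show ?thesis .
qed

lemma norm_dir_coeff_le:
  assumes p: "prime p" and "\<sigma> \<ge> 1" and w: "\<And>j. norm (w j) \<le> M"
  shows "norm (dir_coeff w p \<sigma> k) \<le> M * B * real p powr (real (Suc k) * (\<eta> - 1) + (1 - \<sigma>))"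
proof -
  have "norm (dir_coeff w p \<sigma> k) \<le> (\<Sum>j\<in>(UNIV :: 'N set). M * (C * real p powr (real (Suc k) * (\<eta> - 1) + (1 - \<sigma>))))"
    unfolding dir_coeff_def
  proof (rule order_trans[OF norm_sum sum_mono])
    fix j
    have "M \<ge> 0" using w norm_ge_zero order_trans by blast
    then show "norm (w j * local_coeff (b j) p \<sigma> k) \<le> M * (C * real p powr (real (Suc k) * (\<eta> - 1) + (1 - \<sigma>)))"
      unfolding norm_mult by (intro mult_mono w norm_local_coeff_le assms) auto
  qed
  then show ?thesis by (simp add: B_def mult_ac)
qed

text \<open>The ratio \<open>3 / 4\<close> exceeds \<open>2 powr (- (1 / 2))\<close> and so serves
  all primes at once; it is the ratio in \<open>poly_geom_sum\<close>.\<close>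

lemma prime_powr_le_geom:
  assumes "prime p"
  shows "real p powr (real k * (\<eta> - 1)) \<le> (3 / 4) ^ k"
proof -
  have p2: "real p \<ge> 2" using prime_ge_2_nat[OF assms] by simp
  have "real p powr (\<eta> - 1) \<le> real p powr (- (1 / 2))" using p2 \<eta> by (intro powr_mono) auto
  also have "\<dots> \<le> 2 powr (- (1 / 2))" using p2 by (intro powr_mono2') auto
  also have "\<dots> \<le> 3 / 4"
  proof -
    have "(4 / 3 :: real) \<le> sqrt 2" by (rule real_le_rsqrt) (simp add: power2_eq_square)
    then show ?thesis by (simp add: powr_minus powr_half_sqrt field_simps)
  qed
  finally have "(real p powr (\<eta> - 1)) ^ k \<le> (3 / 4) ^ k" by (intro power_mono) auto
  then show ?thesis using p2 by (simp add: powr_power mult.commute)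
qed

lemma norm_dir_coeff_le':
  assumes p: "prime p" and "\<sigma> \<ge> 1" and w: "\<And>j. norm (w j) \<le> M"
  shows "real (Suc k) ^ 3 * norm (dir_coeff w p \<sigma> k) \<le> M * B * real p powr (\<eta> - 1) * (real (Suc (Suc k)) ^ 3 * (3 / 4) ^ k)"
proof -
  have M: "M \<ge> 0" using w norm_ge_zero order_trans by blast
  have p1: "real p > 1" using prime_gt_1_nat[OF p] by simp
  have "norm (dir_coeff w p \<sigma> k) \<le> M * B * real p powr (real (Suc k) * (\<eta> - 1) + (1 - \<sigma>))"
    by (rule norm_dir_coeff_le[OF assms])
  also have "\<dots> \<le> M * B * real p powr ((\<eta> - 1) + real k * (\<eta> - 1))"
    using M B_nonneg p1 assms(2) by (intro mult_left_mono powr_mono) (auto simp: algebra_simps)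
  also have "\<dots> = M * B * real p powr (\<eta> - 1) * real p powr (real k * (\<eta> - 1))"
    by (simp add: powr_add)
  also have "\<dots> \<le> M * B * real p powr (\<eta> - 1) * (3 / 4) ^ k"
    using M B_nonneg by (intro mult_left_mono prime_powr_le_geom p) auto
  finally have "real (Suc k) ^ 3 * norm (dir_coeff w p \<sigma> k) \<le> real (Suc (Suc k)) ^ 3 * (M * B * real p powr (\<eta> - 1) * (3 / 4) ^ k)"
    by (intro mult_mono power_mono) auto
  then show ?thesis by (simp add: mult_ac del: of_nat_Suc)
qed

lemma dir_coeff_summable:
  assumes p: "prime p" and "\<sigma> \<ge> 1"
  shows "summable (\<lambda>k. real (Suc k) ^ 3 * norm (dir_coeff w p \<sigma> k))"
    and "summable (\<lambda>k. norm (dir_coeff w p \<sigma> k))" and "summable (\<lambda>k. norm (dir_deriv_coeff w p \<sigma> k))"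
proof -
  define M where "M = Max (range (\<lambda>j. norm (w j)))"
  have w: "norm (w j) \<le> M" for j unfolding M_def by (intro Max_ge) auto
  show s: "summable (\<lambda>k. real (Suc k) ^ 3 * norm (dir_coeff w p \<sigma> k))"
    by (rule summable_comparison_test'[OF summable_mult[OF summable_poly_geom, of "M * B * real p powr (\<eta> - 1)"]])
       (use norm_dir_coeff_le'[OF assms w] in \<open>simp del: of_nat_Suc\<close>)
  have le: "1 \<le> real (Suc k) ^ 3" "real (Suc k) \<le> real (Suc k) ^ 3" for k by (simp, rule self_le_power) auto
  show "summable (\<lambda>k. norm (dir_coeff w p \<sigma> k))"
    by (rule summable_comparison_test'[OF s]) (use mult_right_mono[OF le(1) norm_ge_zero] in \<open>simp del: of_nat_Suc\<close>)
  have "summable (\<lambda>k. \<bar>ln (real p)\<bar> * (real (Suc k) ^ 3 * norm (dir_coeff w p \<sigma> k)))" using s by (rule summable_mult)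
  then show "summable (\<lambda>k. norm (dir_deriv_coeff w p \<sigma> k))"
    by (rule summable_comparison_test')
       (use mult_left_mono[OF mult_right_mono[OF le(2) norm_ge_zero] abs_ge_zero] in \<open>simp add: dir_deriv_coeff_def norm_mult mult.assoc del: of_nat_Suc\<close>)
qed

lemma dir_series_bounds:
  assumes p: "prime p" and "\<sigma> \<ge> 1" and w: "\<And>j. norm (w j) \<le> M"
  shows "norm (trig_series (dir_coeff w p \<sigma>) t) \<le> M * B * poly_geom_sum * real p powr (\<eta> - 1)"
    and "norm (trig_series (dir_deriv_coeff w p \<sigma>) t) \<le> M * B * poly_geom_sum * (ln (real p) * real p powr (\<eta> - 1))"
proof -
  note s = dir_coeff_summable[OF p assms(2), of w]
  have p1: "real p > 1" using prime_gt_1_nat[OF p] by simp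
  have S: "(\<Sum>k. real (Suc k) ^ 3 * norm (dir_coeff w p \<sigma> k)) \<le> M * B * poly_geom_sum * real p powr (\<eta> - 1)"
  proof -
    have "(\<Sum>k. real (Suc k) ^ 3 * norm (dir_coeff w p \<sigma> k)) \<le> (\<Sum>k. M * B * real p powr (\<eta> - 1) * (real (Suc (Suc k)) ^ 3 * (3 / 4) ^ k))"
      by (intro suminf_le norm_dir_coeff_le'[OF assms] s(1) summable_mult summable_poly_geom)
    also have "\<dots> = M * B * real p powr (\<eta> - 1) * poly_geom_sum"
      unfolding poly_geom_sum_def by (rule suminf_mult[OF summable_poly_geom])
    finally show ?thesis by (simp add: mult_ac)
  qed
  have le: "1 \<le> real (Suc k) ^ 3" "real (Suc k) \<le> real (Suc k) ^ 3" for k by (simp, rule self_le_power) auto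
  have "norm (trig_series (dir_coeff w p \<sigma>) t) \<le> (\<Sum>k. norm (dir_coeff w p \<sigma> k))"
    by (rule norm_trig_series_le[OF s(2)])
  also have "\<dots> \<le> (\<Sum>k. real (Suc k) ^ 3 * norm (dir_coeff w p \<sigma> k))"
    by (intro suminf_le s) (use mult_right_mono[OF le(1) norm_ge_zero] in \<open>simp del: of_nat_Suc\<close>)
  finally show "norm (trig_series (dir_coeff w p \<sigma>) t) \<le> M * B * poly_geom_sum * real p powr (\<eta> - 1)" using S by simp
  have l: "ln (real p) \<ge> 0" using p1 by simp
  have "norm (trig_series (dir_deriv_coeff w p \<sigma>) t) \<le> (\<Sum>k. norm (dir_deriv_coeff w p \<sigma> k))"
    by (rule norm_trig_series_le[OF s(3)])
  also have "\<dots> \<le> (\<Sum>k. ln (real p) * (real (Suc k) ^ 3 * norm (dir_coeff w p \<sigma> k)))"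
    by (intro suminf_le s summable_mult)
       (use mult_left_mono[OF mult_right_mono[OF le(2) norm_ge_zero] l] l in \<open>simp add: dir_deriv_coeff_def norm_mult mult.assoc del: of_nat_Suc\<close>)
  also have "\<dots> = ln (real p) * (\<Sum>k. real (Suc k) ^ 3 * norm (dir_coeff w p \<sigma> k))"
    by (rule suminf_mult[OF s(1)])
  also have "\<dots> \<le> ln (real p) * (M * B * poly_geom_sum * real p powr (\<eta> - 1))"
    using S l by (rule mult_left_mono)
  finally show "norm (trig_series (dir_deriv_coeff w p \<sigma>) t) \<le> M * B * poly_geom_sum * (ln (real p) * real p powr (\<eta> - 1))"
    by (simp add: mult_ac)
qed

lemma local_coeff_summable:
  assumes "prime p" "\<sigma> \<ge> 1" shows "summable (\<lambda>k. norm (local_coeff (b j) p \<sigma> k))"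
    "summable (\<lambda>k. norm (- (ln (real p) * real (Suc k)) * local_coeff (b j) p \<sigma> k))"
proof -
  have "dir_coeff (\<lambda>i. if i = j then 1 else 0) p \<sigma> = local_coeff (b j) p \<sigma>"
  proof
    fix k
    have "dir_coeff (\<lambda>i. if i = j then 1 else 0) p \<sigma> k = (\<Sum>i\<in>UNIV. if i = j then local_coeff (b i) p \<sigma> k else 0)"
      unfolding dir_coeff_def by (intro sum.cong) auto
    then show "dir_coeff (\<lambda>i. if i = j then 1 else 0) p \<sigma> k = local_coeff (b j) p \<sigma> k" by simp
  qed
  then show "summable (\<lambda>k. norm (local_coeff (b j) p \<sigma> k))"
    "summable (\<lambda>k. norm (- (ln (real p) * real (Suc k)) * local_coeff (b j) p \<sigma> k))"
    using dir_coeff_summable(2,3)[OF assms, of "\<lambda>i. if i = j then 1 else 0"] by (simp_all add: dir_deriv_coeff_def)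
qed

lemma trig_series_lincomb:
  assumes "\<And>j. summable (\<lambda>k. norm (c j k))"
  shows "trig_series (\<lambda>k. \<Sum>j\<in>(UNIV :: 'N set). w j * c j k) t = (\<Sum>j\<in>UNIV. w j * trig_series (c j) t)"
proof -
  have "trig_series (\<lambda>k. \<Sum>j\<in>(UNIV :: 'N set). w j * c j k) t = (\<Sum>k. \<Sum>j\<in>UNIV. w j * (c j k * cis (- (2 * pi * real (Suc k) * t))))"
    by (simp add: trig_series_def sum_distrib_right mult.assoc del: of_nat_Suc)
  also have "\<dots> = (\<Sum>j\<in>UNIV. \<Sum>k. w j * (c j k * cis (- (2 * pi * real (Suc k) * t))))"
    by (intro suminf_sum summable_mult summable_trig_series assms)
  also have "\<dots> = (\<Sum>j\<in>UNIV. w j * trig_series (c j) t)"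
    unfolding trig_series_def by (intro sum.cong refl suminf_mult summable_trig_series assms)
  finally show ?thesis .
qed

text \<open>The real inner product with \<open>y\<close> is the real part of the sum against
  \<open>cnj (y $ j)\<close>. Interchanging the sums over functions and primes displays it as a sum
  of terms each depending on one coordinate.\<close>

lemma vec_log_Fn_inner:
  assumes "\<sigma> \<ge> 1"
  shows "vec_log_Fn b n \<sigma> \<theta>' \<bullet> y = (\<Sum>m\<in>{1..n}. phase_fn y \<sigma> m (\<theta>' m))"
proof -
  have "vec_log_Fn b n \<sigma> \<theta>' \<bullet> y = Re (\<Sum>j\<in>UNIV. cnj (y $ j) * log_Fn (b j) n \<sigma> \<theta>')"
    by (simp add: inner_vec_def vec_log_Fn_def inner_complex_def mult.commute)
  also have "(\<Sum>j\<in>UNIV. cnj (y $ j) * log_Fn (b j) n \<sigma> \<theta>') = (\<Sum>m=1..n. \<Sum>j\<in>UNIV. cnj (y $ j) * trig_series (local_coeff (b j) (nth_prime m) \<sigma>) (\<theta>' m))"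
    unfolding log_Fn_def s_point_def log_local_eq_trig_series[OF nth_prime_prime] sum_distrib_left by (rule sum.swap)
  also have "\<dots> = (\<Sum>m=1..n. trig_series (dir_coeff (\<lambda>j. cnj (y $ j)) (nth_prime m) \<sigma>) (\<theta>' m))"
    unfolding dir_coeff_def
    by (intro sum.cong refl trig_series_lincomb[symmetric] local_coeff_summable nth_prime_prime assms)
  finally show ?thesis by (simp add: phase_fn_def)
qed

lemma logderiv_Fn_lincomb:
  assumes "\<sigma> \<ge> 1"
  shows "(\<Sum>j\<in>UNIV. w j * logderiv_Fn (b j) n \<sigma> \<theta>') = (\<Sum>m\<in>{1..n}. amp_fn w \<sigma> m (\<theta>' m))"
proof -
  have eq: "logderiv_Fn (b j) n \<sigma> \<theta>' = (\<Sum>m=1..n. trig_series (\<lambda>k. - (ln (real (nth_prime m)) * real (Suc k)) * local_coeff (b j) (nth_prime m) \<sigma> k) (\<theta>' m))" for j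
    unfolding logderiv_Fn_def s_point_def
    by (intro sum.cong refl logderiv_local_eq_trig_series[where \<theta> = \<eta> and C = C] nth_prime_prime \<eta> b_bound) (use assms in auto)
  have "(\<Sum>j\<in>UNIV. w j * logderiv_Fn (b j) n \<sigma> \<theta>') = (\<Sum>m=1..n. \<Sum>j\<in>UNIV. w j * trig_series (\<lambda>k. - (ln (real (nth_prime m)) * real (Suc k)) * local_coeff (b j) (nth_prime m) \<sigma> k) (\<theta>' m))"
    unfolding eq sum_distrib_left by (rule sum.swap)
  also have "\<dots> = (\<Sum>m=1..n. trig_series (\<lambda>k. \<Sum>j\<in>UNIV. w j * (- (ln (real (nth_prime m)) * real (Suc k)) * local_coeff (b j) (nth_prime m) \<sigma> k)) (\<theta>' m))"
    by (intro sum.cong refl trig_series_lincomb[symmetric] local_coeff_summable nth_prime_prime assms)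
  also have "\<dots> = (\<Sum>m\<in>{1..n}. amp_fn w \<sigma> m (\<theta>' m))"
    by (simp add: amp_fn_def dir_deriv_coeff_def[abs_def] dir_coeff_def sum_distrib_left mult_ac del: of_nat_Suc)
  finally show ?thesis .
qed

end

section \<open>Uniform decay and summable increments of the Fourier transforms\<close>

locale good_euler_family = euler_family b \<eta> C
  for b :: "'N::finite \<Rightarrow> nat \<Rightarrow> complex" and \<eta> C :: real +
  fixes c0 :: real
  assumes c0: "c0 > 0"
    and good: "\<And>y P0. norm y = 1 \<Longrightarrow> \<exists>p\<ge>P0. prime p \<and> norm (coeff_dot b p y) \<ge> c0"
begin

text \<open>The midpoint of \<open>1 / 2\<close> and \<open>1 - \<eta>\<close>: above
  \<open>1 / 2\<close>, so that the squares of \<open>a\<close> are summable, and below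
  \<open>1 - \<eta>\<close>, which leaves a power to absorb \<open>ln p\<close>.\<close>

definition gam :: real where "gam = (3 / 2 - \<eta>) / 2"
definition K :: real where "K = B * poly_geom_sum * (1 + 2 / (1 / 2 - \<eta>))"
definition a :: "nat \<Rightarrow> real" where "a m = real (Suc m) powr (- gam)"
definition V :: real where "V = 1 + (\<Sum>m. (2 * K * a m)\<^sup>2)"

lemma K_nonneg: "K \<ge> 0"
  using \<eta> B_nonneg poly_geom_sum_pos by (auto simp: K_def intro!: mult_nonneg_nonneg add_nonneg_nonneg)

lemma a_nonneg: "a m \<ge> 0" by (simp add: a_def)

lemma summable_a: "summable (\<lambda>m. (a m)\<^sup>2)"
proof -
  have "summable (\<lambda>m. real m powr (- (2 * gam)))"
    using \<eta> by (subst summable_real_powr_iff) (simp add: gam_def)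
  then have "summable (\<lambda>m. real (Suc m) powr (- (2 * gam)))" by (subst summable_Suc_iff)
  moreover have "(a m)\<^sup>2 = real (Suc m) powr (- (2 * gam))" for m
    unfolding a_def by (simp add: powr_power mult.commute)
  ultimately show ?thesis by simp
qed

text \<open>The exponent \<open>1 - \<eta>\<close> splits as \<open>\<epsilon> + gam\<close>. The
  part \<open>\<epsilon>\<close> absorbs \<open>ln p\<close> at the cost
  \<open>1 / \<epsilon>\<close>, the source of the constant in \<open>K\<close>; the part
  \<open>gam\<close> gives \<open>a m\<close>.\<close>

lemma prime_powr_le_a:
  fixes m :: nat
  defines "p \<equiv> nth_prime m"
  shows "real p powr (\<eta> - 1) \<le> (1 + 2 / (1 / 2 - \<eta>)) * a m"
    and "ln (real p) * real p powr (\<eta> - 1) \<le> (1 + 2 / (1 / 2 - \<eta>)) * a m"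
proof -
  define \<epsilon> where "\<epsilon> = (1 / 2 - \<eta>) / 2"
  have \<epsilon>: "\<epsilon> > 0" using \<eta> by (simp add: \<epsilon>_def)
  have p1: "real p \<ge> 1" using prime_ge_1_nat[OF nth_prime_prime[of m]] by (simp add: p_def)
  have sp: "real p powr (\<eta> - 1) = real p powr (- \<epsilon>) * real p powr (- gam)"
  proof -
    have "\<eta> - 1 = - \<epsilon> + - gam" by (simp add: \<epsilon>_def gam_def field_simps)
    then show ?thesis by (simp only: powr_add)
  qed
  have g0: "gam > 0" using \<eta> by (simp add: gam_def)
  have "real p powr (- gam) \<le> a m"
    unfolding a_def using nth_prime_ge[of m] g0 by (intro powr_mono2') (auto simp: p_def)
  then have q: "real p powr (- gam) \<le> a m" .
  have e1: "real p powr (- \<epsilon>) \<le> 1" using p1 \<epsilon> powr_mono[of "- \<epsilon>" 0 "real p"] by simp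
  have e2: "ln (real p) * real p powr (- \<epsilon>) \<le> 1 / \<epsilon>"
  proof -
    have "ln (real p) * real p powr (- \<epsilon>) \<le> real p powr \<epsilon> / \<epsilon> * real p powr (- \<epsilon>)"
      by (intro mult_right_mono ln_powr_bound p1 \<epsilon>) simp
    also have "\<dots> = 1 / \<epsilon>" using p1 by (simp add: powr_minus field_simps)
    finally show ?thesis .
  qed
  have L: "1 + 2 / (1 / 2 - \<eta>) = 1 + 1 / \<epsilon>" by (simp add: \<epsilon>_def)
  have "real p powr (\<eta> - 1) \<le> 1 * a m"
    unfolding sp using e1 q by (intro mult_mono) auto
  also have "\<dots> \<le> (1 + 1 / \<epsilon>) * a m" using \<epsilon> by (intro mult_right_mono a_nonneg) simp
  finally show "real p powr (\<eta> - 1) \<le> (1 + 2 / (1 / 2 - \<eta>)) * a m" unfolding L .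
  have "ln (real p) * real p powr (\<eta> - 1) = (ln (real p) * real p powr (- \<epsilon>)) * real p powr (- gam)"
    unfolding sp by simp
  also have "\<dots> \<le> (1 / \<epsilon>) * a m" using e2 q \<epsilon> by (intro mult_mono) auto
  also have "\<dots> \<le> (1 + 1 / \<epsilon>) * a m" by (intro mult_right_mono a_nonneg) simp
  finally show "ln (real p) * real p powr (\<eta> - 1) \<le> (1 + 2 / (1 / 2 - \<eta>)) * a m" unfolding L .
qed

lemma independent:
  assumes \<sigma>: "\<sigma> \<ge> 1" and w: "\<And>j. norm (w j) \<le> 2"
  shows "independent_terms (phase_fn y \<sigma>) (amp_fn w \<sigma>) (\<lambda>m. norm y * K * a m) (\<lambda>m. 2 * K * a m) V"
proof
  note pp = nth_prime_prime
  fix m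
  have ct: "continuous_on UNIV (trig_series (dir_coeff (\<lambda>j. cnj (y $ j)) (nth_prime m) \<sigma>))"
    by (intro continuous_trig_series dir_coeff_summable pp \<sigma>)
  show "phase_fn y \<sigma> m \<in> borel_measurable borel"
    unfolding phase_fn_def[abs_def] by (intro borel_measurable_continuous_onI continuous_intros ct)
  show "amp_fn w \<sigma> m \<in> borel_measurable borel"
    unfolding amp_fn_def[abs_def]
    by (intro borel_measurable_continuous_onI continuous_trig_series dir_coeff_summable pp \<sigma>)
  have Bp: "B * poly_geom_sum \<ge> 0" using B_nonneg poly_geom_sum_pos by simp
  show "\<bar>phase_fn y \<sigma> m t\<bar> \<le> norm y * K * a m" for t
  proof -
    have "\<bar>phase_fn y \<sigma> m t\<bar> \<le> norm (trig_series (dir_coeff (\<lambda>j. cnj (y $ j)) (nth_prime m) \<sigma>) t)"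
      unfolding phase_fn_def by (rule abs_Re_le_cmod)
    also have "\<dots> \<le> norm y * B * poly_geom_sum * real (nth_prime m) powr (\<eta> - 1)"
      by (rule dir_series_bounds[OF pp \<sigma>]) (simp add: Finite_Cartesian_Product.norm_nth_le)
    also have "\<dots> \<le> norm y * B * poly_geom_sum * ((1 + 2 / (1 / 2 - \<eta>)) * a m)"
      using Bp by (intro mult_left_mono prime_powr_le_a) (simp add: mult.assoc)
    finally show ?thesis by (simp add: K_def mult_ac)
  qed
  show "norm (amp_fn w \<sigma> m t) \<le> 2 * K * a m" for t
  proof -
    have "norm (amp_fn w \<sigma> m t) \<le> 2 * B * poly_geom_sum * (ln (real (nth_prime m)) * real (nth_prime m) powr (\<eta> - 1))"
      unfolding amp_fn_def by (rule dir_series_bounds[OF pp \<sigma> w])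
    also have "\<dots> \<le> 2 * B * poly_geom_sum * ((1 + 2 / (1 / 2 - \<eta>)) * a m)"
      using Bp by (intro mult_left_mono prime_powr_le_a) (simp add: mult.assoc)
    finally show ?thesis by (simp add: K_def mult_ac)
  qed
  have "(LINT t|unit_measure. phase_fn y \<sigma> m t) = Re (LINT t|unit_measure. trig_series (dir_coeff (\<lambda>j. cnj (y $ j)) (nth_prime m) \<sigma>) t)"
    unfolding phase_fn_def by (rule integral_Re[OF unit_integrable_continuous[OF ct]])
  then show "(LINT t|unit_measure. phase_fn y \<sigma> m t) = 0"
    by (simp add: unit_integral_trig_series[OF dir_coeff_summable(2)[OF pp \<sigma>]])
  show "(LINT t|unit_measure. amp_fn w \<sigma> m t) = 0"
    unfolding amp_fn_def by (rule unit_integral_trig_series[OF dir_coeff_summable(3)[OF pp \<sigma>]])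
next
  fix I :: "nat set" assume "finite I"
  have "summable (\<lambda>m. (2 * K * a m)\<^sup>2)"
    using summable_mult[OF summable_a, of "(2 * K)\<^sup>2"] by (simp add: power_mult_distrib)
  from sum_le_suminf[OF this \<open>finite I\<close>] show "1 + (\<Sum>m\<in>I. (2 * K * a m)\<^sup>2) \<le> V"
    by (simp add: V_def)
qed

definition \<mu> :: "nat \<Rightarrow> real \<times> ('N \<Rightarrow> complex) \<Rightarrow> (complex ^ 'N) measure" where
  "\<mu> n s = weighted_distribution b n (fst s) (weight (snd s) n (fst s))"

definition index_set :: "real \<Rightarrow> (real \<times> ('N \<Rightarrow> complex)) set" where
  "index_set M = {(\<sigma>, w). 1 \<le> \<sigma> \<and> \<sigma> \<le> M \<and> (\<forall>j. norm (w j) \<le> 2)}"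

text \<open>By linearity the weight is the squared modulus of \<open>amp\<close> and the exponent in
  the Fourier integral is the sum in \<open>phase\<close>, so the transform is the second moment of
  the abstract setting.\<close>

lemma
  assumes \<sigma>: "\<sigma> \<ge> 1" and w: "\<And>j. norm (w j) \<le> 2"
  shows finite_\<mu>: "finite_borel_measure (\<mu> n (\<sigma>, w))"
    and char_fun_\<mu>: "char_fun (\<mu> n (\<sigma>, w)) y = independent_terms.moment2 (phase_fn y \<sigma>) (amp_fn w \<sigma>) {1..n}"
proof -
  interpret t: independent_terms "phase_fn y \<sigma>" "amp_fn w \<sigma>" "\<lambda>m. norm y * K * a m" "\<lambda>m. 2 * K * a m" V
    by (rule independent[OF \<sigma> w])
  have weq: "weight w n \<sigma> \<theta> = (norm (t.amp {1..n} \<theta>))\<^sup>2" for \<theta>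
    by (simp add: weight_def logderiv_Fn_lincomb[OF \<sigma>] t.amp_def)
  have wm: "weight w n \<sigma> \<in> borel_measurable (PiM {1..n} (\<lambda>_. lborel))"
  proof -
    have "(\<lambda>\<theta>. amp_fn w \<sigma> m (\<theta> m)) \<in> borel_measurable (PiM {1..n} (\<lambda>_. lborel))" if "m \<in> {1..n}" for m
      using that by (intro measurable_compose[OF measurable_component_singleton]) auto
    then have "t.amp {1..n} \<in> borel_measurable (PiM {1..n} (\<lambda>_. lborel))"
      unfolding t.amp_def[abs_def] by (rule borel_measurable_sum)
    then show ?thesis unfolding weq[abs_def] by measurable
  qed
  have wi: "integrable (cube_measure {1..n}) (weight w n \<sigma>)"
  proof (rule t.cube_integrable[where B = "(\<Sum>m\<in>{1..n}. 2 * K * a m)\<^sup>2"])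
    show "weight w n \<sigma> \<in> borel_measurable (cube_measure {1..n})"
      by (rule weighted_distribution_eq_distr(2)[OF wm])
    show "norm (weight w n \<sigma> \<theta>) \<le> (\<Sum>m\<in>{1..n}. 2 * K * a m)\<^sup>2" for \<theta>
      unfolding weq using t.norm_amp_le[of "{1..n}" \<theta>] by (simp add: power_mono)
  qed
  note c = char_fun_weighted_distribution[OF wm _ wi, of b \<sigma>]
  show "finite_borel_measure (\<mu> n (\<sigma>, w))"
    unfolding \<mu>_def fst_conv snd_conv by (rule c(1)) (simp add: weight_def)
  have "char_fun (\<mu> n (\<sigma>, w)) y = (LINT \<theta>|cube_measure {1..n}. cis (vec_log_Fn b n \<sigma> \<theta> \<bullet> y) * weight w n \<sigma> \<theta>)"
    unfolding \<mu>_def fst_conv snd_conv by (rule c(2)) (simp add: weight_def)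
  then show "char_fun (\<mu> n (\<sigma>, w)) y = t.moment2 {1..n}"
    by (simp only: t.moment2_def t.phase_def weq vec_log_Fn_inner[OF \<sigma>])
qed

text \<open>
  At a prime with \<open>\<bar>coeff_dot b p y\<bar>\<close> of size \<open>\<bar>y\<bar>\<close> the first Fourier coefficient dominates, uniformly
  in \<open>\<sigma> \<ge> 1\<close>, once \<open>p ^ (2 \<eta> - 1)\<close> is small.
\<close>

lemma eventually_first_coefficient_dominates:
  obtains P0 where "\<And>p. prime p \<Longrightarrow> p \<ge> P0 \<Longrightarrow> B * poly_geom_sum * real p powr (2 * \<eta> - 1) \<le> c0 / 20"
proof -
  have lim: "(\<lambda>p. B * poly_geom_sum * real p powr (2 * \<eta> - 1)) \<longlonglongrightarrow> B * poly_geom_sum * 0"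
    using \<eta> by (intro tendsto_mult tendsto_const tendsto_neg_powr filterlim_real_sequentially) auto
  have "\<forall>\<^sub>F p in sequentially. B * poly_geom_sum * real p powr (2 * \<eta> - 1) < c0 / 20"
    by (rule order_tendstoD(2)[OF lim]) (use c0 in simp)
  then obtain P0 where "\<forall>p\<ge>P0. B * poly_geom_sum * real p powr (2 * \<eta> - 1) < c0 / 20"
    by (auto simp: eventually_sequentially)
  then show ?thesis using that[of P0] by (simp add: less_imp_le)
qed

text \<open>Dividing by the modulus \<open>A\<close> of the first coefficient puts the phase into
  the normal form of \<open>trig_series_oscillation\<close>. If \<open>A < 1\<close>, the trivial
  bound 1 is already better than \<open>36000 / sqrt A\<close>. The bound \<open>M\<close> enters
  only at the end, through \<open>p powr (- \<sigma>) \<ge> p powr (- M)\<close>.\<close>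

lemma local_decay:
  assumes p: "p = nth_prime m" and dom: "B * poly_geom_sum * real p powr (2 * \<eta> - 1) \<le> c0 / 20"
    and \<sigma>: "1 \<le> \<sigma>" "\<sigma> \<le> M" and y: "y \<noteq> 0" and cd: "norm (coeff_dot b p y) \<ge> c0 / 2 * norm y"
  shows "norm (LINT t|unit_measure. cis (phase_fn y \<sigma> m t)) \<le> 36000 * sqrt (real p powr M / (c0 / 2)) / sqrt (norm y)"
proof -
  have pp: "prime p" using p nth_prime_prime by simp
  have p1: "real p > 1" using prime_gt_1_nat[OF pp] by simp
  define w where "w j = cnj (y $ j)" for j
  have w_eq: "w = (\<lambda>j. cnj (y $ j))" by (simp add: w_def fun_eq_iff)
  have w: "norm (w j) \<le> norm y" for j by (simp add: w_def Finite_Cartesian_Product.norm_nth_le)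
  define c where "c = dir_coeff w p \<sigma>"
  define A where "A = norm (c 0)"
  have c0eq: "c 0 = coeff_dot b p y * complex_of_real (real p powr (- \<sigma>))"
    unfolding coeff_dot_def sum_distrib_right
    by (simp add: c_def dir_coeff_def local_coeff_def w_def mult_ac)
  then have Aeq: "A = norm (coeff_dot b p y) * real p powr (- \<sigma>)" by (simp add: A_def norm_mult)
  have Alow: "A \<ge> c0 / 2 * norm y * real p powr (- \<sigma>)"
    unfolding Aeq using cd by (intro mult_right_mono) auto
  have Apos: "A > 0"
  proof -
    have "c0 / 2 * norm y * real p powr (- \<sigma>) > 0" using c0 y p1 by simp
    then show ?thesis using Alow by linarith
  qed
  have "c0 / 2 * norm y * real p powr (- M) \<le> c0 / 2 * norm y * real p powr (- \<sigma>)"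
    using c0 p1 \<sigma> by (intro mult_left_mono powr_mono) auto
  then have AM: "c0 / 2 * norm y * real p powr (- M) \<le> A" using Alow by linarith
  have sc: "summable (\<lambda>k. real (Suc k) ^ 3 * norm (c k))" "summable (\<lambda>k. norm (c k))"
    unfolding c_def by (rule dir_coeff_summable[OF pp \<sigma>(1)])+
  define \<beta> where "\<beta> k = of_real (1 / A) * c k" for k
  have nb: "norm (\<beta> k) = norm (c k) / A" for k using Apos by (simp add: \<beta>_def norm_mult norm_divide)
  have tb: "A * Re (trig_series \<beta> t) = phase_fn y \<sigma> m t" for t
    unfolding \<beta>_def[abs_def] trig_series_scaleR[OF sc(2)] using Apos by (simp add: phase_fn_def c_def w_eq p)
  have bound: "norm (LINT t|unit_measure. cis (phase_fn y \<sigma> m t)) \<le> 36000 / sqrt A"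
  proof (cases "A \<ge> 1")
    case True
    have "norm (LINT t|unit_measure. cis (A * Re (trig_series \<beta> t))) \<le> 36000 / sqrt A"
    proof (rule trig_series_oscillation[OF _ _ _ True])
      show "norm (\<beta> 0) = 1" using Apos by (simp add: nb A_def)
      have sb: "summable (\<lambda>k. real (Suc k) ^ 3 * norm (\<beta> k))"
        using summable_divide[OF sc(1), of A] by (simp add: nb)
      then show "summable (\<lambda>k. real (Suc k) ^ 3 * norm (\<beta> k))" .
      \<comment> \<open>The later coefficients carry \<open>p powr (- \<sigma>)\<close> just as
        \<open>A\<close> does, so the quotient does not depend on \<open>\<sigma>\<close>. The lower
        bound \<open>c0 / 2\<close> for \<open>A\<close> against \<open>c0 / 20\<close> in
        \<open>dom\<close> leaves \<open>1 / 10\<close>.\<close>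
      define Z where "Z = norm y * B * real p powr (2 * \<eta> - 1) * real p powr (- \<sigma>) / A"
      have le: "real (Suc (Suc k)) ^ 3 * norm (\<beta> (Suc k)) \<le> Z * (real (Suc (Suc k)) ^ 3 * (3 / 4) ^ k)" for k
      proof -
        have "norm (c (Suc k)) \<le> norm y * B * real p powr (real (Suc (Suc k)) * (\<eta> - 1) + (1 - \<sigma>))"
          unfolding c_def by (rule norm_dir_coeff_le[OF pp \<sigma>(1) w])
        also have "real (Suc (Suc k)) * (\<eta> - 1) + (1 - \<sigma>) = (2 * \<eta> - 1) + (- \<sigma>) + real k * (\<eta> - 1)"
          by (simp add: algebra_simps)
        also have "real p powr \<dots> = real p powr (2 * \<eta> - 1) * real p powr (- \<sigma>) * real p powr (real k * (\<eta> - 1))"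
          by (simp only: powr_add)
        also have "norm y * B * (real p powr (2 * \<eta> - 1) * real p powr (- \<sigma>) * real p powr (real k * (\<eta> - 1)))
            \<le> norm y * B * (real p powr (2 * \<eta> - 1) * real p powr (- \<sigma>) * (3 / 4) ^ k)"
          using B_nonneg by (intro mult_left_mono prime_powr_le_geom pp) auto
        finally have "norm (c (Suc k)) / A \<le> norm y * B * (real p powr (2 * \<eta> - 1) * real p powr (- \<sigma>) * (3 / 4) ^ k) / A"
          using Apos by (intro divide_right_mono) auto
        then have "norm (\<beta> (Suc k)) \<le> Z * (3 / 4) ^ k" by (simp add: nb Z_def mult_ac)
        then have "real (Suc (Suc k)) ^ 3 * norm (\<beta> (Suc k)) \<le> real (Suc (Suc k)) ^ 3 * (Z * (3 / 4) ^ k)"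
          by (rule mult_left_mono) simp
        then show ?thesis by (simp add: mult_ac del: of_nat_Suc)
      qed
      have "(\<Sum>k. real (Suc (Suc k)) ^ 3 * norm (\<beta> (Suc k))) \<le> (\<Sum>k. Z * (real (Suc (Suc k)) ^ 3 * (3 / 4) ^ k))"
        using sb by (intro suminf_le le summable_mult summable_poly_geom) (subst (asm) summable_Suc_iff[symmetric])
      also have "\<dots> = Z * poly_geom_sum"
        unfolding poly_geom_sum_def by (rule suminf_mult[OF summable_poly_geom])
      also have "\<dots> = (B * poly_geom_sum * real p powr (2 * \<eta> - 1)) * (norm y * real p powr (- \<sigma>)) / A"
        by (simp add: Z_def mult_ac)
      also have "\<dots> \<le> (c0 / 20) * (norm y * real p powr (- \<sigma>)) / A"
        using dom Apos by (intro divide_right_mono mult_right_mono) auto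
      also have "\<dots> \<le> 1 / 10"
        using Alow Apos by (simp add: field_simps)
      finally show "(\<Sum>k. real (Suc (Suc k)) ^ 3 * norm (\<beta> (Suc k))) \<le> 1 / 10" .
    qed
    then show ?thesis by (simp only: tb)
  next
    case False
    have "norm (LINT t|unit_measure. cis (phase_fn y \<sigma> m t)) \<le> 1"
      by (rule unit_integral_norm_le) simp
    also have "1 \<le> 36000 / sqrt A"
    proof -
      have "sqrt A \<le> 1" using False Apos by simp
      then have "1 * sqrt A \<le> 36000" by linarith
      then show ?thesis using Apos by (simp only: pos_le_divide_eq real_sqrt_gt_zero)
    qed
    finally show ?thesis .
  qed
  also have "36000 / sqrt A \<le> 36000 / sqrt (c0 / 2 * norm y * real p powr (- M))"
    using AM c0 y p1 by (intro divide_left_mono real_sqrt_le_mono mult_pos_pos real_sqrt_gt_zero) (auto simp: Apos)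
  also have "\<dots> = 36000 * sqrt (real p powr M / (c0 / 2)) / sqrt (norm y)"
  proof -
    have "c0 / 2 * norm y * real p powr (- M) = norm y / (real p powr M / (c0 / 2))"
      using c0 p1 by (simp add: powr_minus field_simps)
    then have "36000 / sqrt (c0 / 2 * norm y * real p powr (- M)) = 36000 / (sqrt (norm y) / sqrt (real p powr M / (c0 / 2)))"
      by (simp only: real_sqrt_divide[of "norm y"])
    then show ?thesis by (rule trans) (rule divide_divide_eq_right)
  qed
  finally show ?thesis .
qed

lemma char_fun_decay:
  "\<exists>n0. \<forall>M. \<exists>D. \<forall>n\<ge>n0. \<forall>s\<in>index_set M. \<forall>y. (1 + norm y) ^ k * norm (char_fun (\<mu> n s) y) \<le> D"
proof -
  \<comment> \<open>Each good prime contributes \<open>norm y powr (- (1 / 2))\<close>. Two of them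
    may be spent on the amplitude, and the remaining \<open>2 * k\<close> give the power
    \<open>k\<close>.\<close>
  define R where "R = 2 * k + 2"
  obtain P0 where P0: "\<And>p. prime p \<Longrightarrow> p \<ge> P0 \<Longrightarrow> B * poly_geom_sum * real p powr (2 * \<eta> - 1) \<le> c0 / 20"
    using eventually_first_coefficient_dominates by blast
  obtain n0 where n0: "\<And>y. norm y = 1 \<Longrightarrow> \<exists>S\<subseteq>{1..n0}. card S = R \<and>
     (\<forall>m\<in>S. nth_prime m \<ge> P0 \<and> norm (coeff_dot b (nth_prime m) y) \<ge> c0 / 2)"
    using good_indices[OF c0 good, of R P0] by blast
  have "\<exists>D. \<forall>n\<ge>n0. \<forall>s\<in>index_set M. \<forall>y. (1 + norm y) ^ k * norm (char_fun (\<mu> n s) y) \<le> D" for M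
  proof -
    \<comment> \<open>A sum in place of the maximum over the indices up to \<open>n0\<close>; it
      depends on \<open>M\<close> but not on \<open>n\<close>, \<open>\<sigma>\<close> or
      \<open>y\<close>. The added 1 makes it positive.\<close>
    define Q where "Q = (\<Sum>m\<in>{1..n0}. 36000 * sqrt (real (nth_prime m) powr M / (c0 / 2))) + 1"
    have Qm: "36000 * sqrt (real (nth_prime m) powr M / (c0 / 2)) \<le> Q" if "m \<in> {1..n0}" for m
      using member_le_sum[of m "{1..n0}" "\<lambda>m. 36000 * sqrt (real (nth_prime m) powr M / (c0 / 2))"] that c0
      by (simp add: Q_def)
    have Q1: "Q \<ge> 1" unfolding Q_def using c0 by (simp add: sum_nonneg)
    define E where "E = (1 + real R)\<^sup>2 * V\<^sup>2"
    have "(1 + norm y) ^ k * norm (char_fun (\<mu> n s) y) \<le> 2 ^ k * V + (2 * Q\<^sup>2) ^ k * E"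
      if n: "n \<ge> n0" and s: "s \<in> index_set M" for n s y
    proof -
      obtain \<sigma> w where sw: "s = (\<sigma>, w)" "1 \<le> \<sigma>" "\<sigma> \<le> M" "\<And>j. norm (w j) \<le> 2"
        using s by (auto simp: index_set_def)
      interpret t: independent_terms "phase_fn y \<sigma>" "amp_fn w \<sigma>" "\<lambda>m. norm y * K * a m" "\<lambda>m. 2 * K * a m" V
        by (rule independent[OF sw(2,4)])
      have ch: "char_fun (\<mu> n s) y = t.moment2 {1..n}" unfolding sw(1) by (rule char_fun_\<mu>[OF sw(2,4)])
      have V0: "V \<ge> 1" by (rule t.V1)
      have E0: "E \<ge> 0" by (simp add: E_def)
      show ?thesis
      proof (cases "norm y \<le> 1")
        case True
        have "(1 + norm y) ^ k * norm (char_fun (\<mu> n s) y) \<le> 2 ^ k * V"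
          unfolding ch using True by (intro mult_mono power_mono t.norm_moment_le) auto
        then show ?thesis using E0 by (smt (verit) mult_nonneg_nonneg zero_le_power zero_le_power2)
      next
        case False
        then have y0: "y \<noteq> 0" "norm y > 0" by auto
        define u where "u = y /\<^sub>R norm y"
        have "norm u = 1" using y0 by (simp add: u_def)
        then obtain S where S: "S \<subseteq> {1..n0}" "card S = R"
          "\<And>m. m \<in> S \<Longrightarrow> nth_prime m \<ge> P0 \<and> norm (coeff_dot b (nth_prime m) u) \<ge> c0 / 2"
          using n0[of u] by blast
        have cdu: "coeff_dot b q y = of_real (norm y) * coeff_dot b q u" for q
        proof -
          have "u $ j = inverse (norm y) *\<^sub>R (y $ j)" for j by (simp add: u_def)
          then have "y $ j = of_real (norm y) * u $ j" for j
            using y0 by (simp add: scaleR_conv_of_real)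
          then have "cnj (y $ j) = of_real (norm y) * cnj (u $ j)" for j
            by (metis complex_cnj_complex_of_real complex_cnj_mult)
          then show ?thesis by (simp add: coeff_dot_def sum_distrib_left mult_ac)
        qed
        \<comment> \<open>The minimum ensures \<open>\<kappa> \<le> 1\<close>, as
          \<open>moment_decay\<close> requires; it loses nothing because the local factors have
          modulus at most 1 anyway.\<close>
        define \<kappa> where "\<kappa> = min 1 (Q / sqrt (norm y))"
        have \<kappa>: "0 < \<kappa>" "\<kappa> \<le> 1" using Q1 y0 by (auto simp: \<kappa>_def)
        have loc: "norm (t.local0 m) \<le> \<kappa>" if "m \<in> S" for m
        proof -
          have "norm (coeff_dot b (nth_prime m) y) = norm y * norm (coeff_dot b (nth_prime m) u)"
            unfolding cdu by (simp add: norm_mult)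
          also have "\<dots> \<ge> norm y * (c0 / 2)" using S(3)[OF that] by (intro mult_left_mono) auto
          finally have cd: "norm (coeff_dot b (nth_prime m) y) \<ge> c0 / 2 * norm y" by (simp add: mult.commute)
          have "norm (t.local0 m) \<le> 36000 * sqrt (real (nth_prime m) powr M / (c0 / 2)) / sqrt (norm y)"
            unfolding t.local0_def
            using local_decay[OF refl P0[OF nth_prime_prime] sw(2,3) y0(1) cd] S(3)[OF that] by blast
          also have "\<dots> \<le> Q / sqrt (norm y)" using Qm[of m] S(1) that y0 by (intro divide_right_mono) auto
          finally show ?thesis using t.norm_local_le(1)[of m] by (simp add: \<kappa>_def)
        qed
        have sub: "S \<subseteq> {1..n}" using S(1) n by auto
        have fS: "finite S" using S(1) finite_subset by blast
        have *: "\<kappa>\<^sup>2 * norm (t.moment2 (({1..n} - S) \<union> S)) \<le> \<kappa> ^ card S * ((1 + card S)\<^sup>2 * V\<^sup>2)"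
          using t.moment_decay[of "{1..n} - S" \<kappa> S] \<kappa> fS loc by auto
        have eq: "({1..n} - S) \<union> S = {1..n}" using sub by auto
        have "\<kappa>\<^sup>2 * norm (t.moment2 {1..n}) \<le> \<kappa>\<^sup>2 * (\<kappa> ^ (2 * k) * E)"
        proof -
          have "\<kappa> ^ card S = \<kappa>\<^sup>2 * \<kappa> ^ (2 * k)" by (simp add: S(2) R_def power_add power2_eq_square mult_ac)
          moreover have "real ((1 + card S)\<^sup>2) * V\<^sup>2 = E" by (simp add: S(2) E_def)
          ultimately show ?thesis using * eq by (simp only: mult.assoc)
        qed
        then have m2: "norm (t.moment2 {1..n}) \<le> \<kappa> ^ (2 * k) * E"
          using \<kappa>(1) by simp
        also have "\<dots> \<le> (Q / sqrt (norm y)) ^ (2 * k) * E"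
          using \<kappa> E0 by (intro mult_right_mono power_mono) (auto simp: \<kappa>_def)
        also have "(Q / sqrt (norm y)) ^ (2 * k) = (Q\<^sup>2 / norm y) ^ k"
          using y0 by (simp add: power_mult power_divide)
        finally have "(1 + norm y) ^ k * norm (t.moment2 {1..n}) \<le> (2 * norm y) ^ k * ((Q\<^sup>2 / norm y) ^ k * E)"
          using False by (intro mult_mono power_mono) auto
        also have "\<dots> = ((2 * norm y) * (Q\<^sup>2 / norm y)) ^ k * E"
          by (simp only: power_mult_distrib mult.assoc)
        also have "(2 * norm y) * (Q\<^sup>2 / norm y) = 2 * Q\<^sup>2" using y0 by simp
        finally show ?thesis unfolding ch using V0 by (smt (verit) mult_nonneg_nonneg zero_le_power)
      qed
    qed
    then show ?thesis by blast
  qed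
  then show ?thesis by blast
qed

sublocale char_fun_family \<mu> index_set "\<lambda>n. V * (2 * K)\<^sup>2 * (a (Suc n))\<^sup>2"
proof
  show "finite_borel_measure (\<mu> n s)" if "s \<in> index_set M" for M s n
    using that finite_\<mu> by (auto simp: index_set_def)
  show "\<exists>n0. \<forall>M. \<exists>C. \<forall>n\<ge>n0. \<forall>s\<in>index_set M. \<forall>y. (1 + norm y) ^ k * norm (char_fun (\<mu> n s) y) \<le> C" for k
    by (rule char_fun_decay)
  have V1: "V \<ge> 1"
    using independent[of 1 "\<lambda>_. 0" 0] independent_terms.V1 by fastforce
  show "norm (char_fun (\<mu> (Suc n) s) y - char_fun (\<mu> n s) y) \<le> (1 + norm y)\<^sup>2 * (V * (2 * K)\<^sup>2 * (a (Suc n))\<^sup>2)"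
    if "s \<in> index_set M" for M s n y
  proof -
    obtain \<sigma> w where sw: "s = (\<sigma>, w)" "1 \<le> \<sigma>" "\<sigma> \<le> M" "\<And>j. norm (w j) \<le> 2"
      using \<open>s \<in> index_set M\<close> by (auto simp: index_set_def)
    interpret t: independent_terms "phase_fn y \<sigma>" "amp_fn w \<sigma>" "\<lambda>m. norm y * K * a m" "\<lambda>m. 2 * K * a m" V
      by (rule independent[OF sw(2,4)])
    have "norm (t.moment2 (insert (Suc n) {1..n}) - t.moment2 {1..n}) \<le> V * (norm y * K * a (Suc n) + 2 * K * a (Suc n))\<^sup>2"
      by (rule t.moment2_step) auto
    also have "norm y * K * a (Suc n) + 2 * K * a (Suc n) = (norm y + 2) * (K * a (Suc n))"
      by (simp add: algebra_simps)
    also have "V * ((norm y + 2) * (K * a (Suc n)))\<^sup>2 \<le> V * ((2 * (1 + norm y)) * (K * a (Suc n)))\<^sup>2"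
      using V1 K_nonneg a_nonneg by (intro mult_left_mono power_mono mult_right_mono) auto
    also have "V * ((2 * (1 + norm y)) * (K * a (Suc n)))\<^sup>2 = (1 + norm y)\<^sup>2 * (V * (2 * K)\<^sup>2 * (a (Suc n))\<^sup>2)"
      by (simp only: power_mult_distrib mult_ac)
    finally show ?thesis
      unfolding sw(1) char_fun_\<mu>[OF sw(2,4)] by (simp only: atLeastAtMostSuc_conv Suc_le_mono le0 One_nat_def)
  qed
  show "summable (\<lambda>n. V * (2 * K)\<^sup>2 * (a (Suc n))\<^sup>2)"
    using summable_a by (intro summable_mult) (subst summable_Suc_iff)
  show "V * (2 * K)\<^sup>2 * (a (Suc n))\<^sup>2 \<ge> 0" for n using V1 by simp
qed

section \<open>The required distributions as members of the family\<close>

definition single :: "'N \<Rightarrow> 'N \<Rightarrow> complex" where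
  "single j = (\<lambda>i. if i = j then 1 else 0)"

lemma sum_single: "(\<Sum>i\<in>UNIV. single j i * f i) = f j"
proof -
  have "(\<Sum>i\<in>UNIV. single j i * f i) = (\<Sum>i\<in>UNIV. if i = j then f i else 0)"
    by (intro sum.cong) (auto simp: single_def)
  then show ?thesis by simp
qed

lemma lambda1_eq: "lambda1 b n \<sigma> j = \<mu> n (\<sigma>, single j)"
  by (simp add: lambda1_def \<mu>_def weight_def[abs_def] sum_single)

lemma lambda2_eq: "lambda2 b n \<sigma> j l \<tau> = \<mu> n (\<sigma>, \<lambda>i. single j i + \<tau> * single l i)"
  by (simp add: lambda2_def \<mu>_def weight_def[abs_def] distrib_right sum.distrib sum_single mult.assoc sum_distrib_left[symmetric])

lemma index_set_single: "1 \<le> \<sigma> \<Longrightarrow> \<sigma> \<le> M \<Longrightarrow> (\<sigma>, single j) \<in> index_set M"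
  by (auto simp: index_set_def single_def)

lemma index_set_pair:
  assumes "1 \<le> \<sigma>" "\<sigma> \<le> M" "\<tau> \<in> {1, -1, \<i>, -\<i>}"
  shows "(\<sigma>, \<lambda>i. single j i + \<tau> * single l i) \<in> index_set M"
proof -
  have "norm (single j i + \<tau> * single l i) \<le> 1 + 1" for i
    using assms(3) by (intro norm_triangle_mono) (auto simp: single_def norm_mult)
  then show ?thesis using assms(1,2) by (simp add: index_set_def)
qed

lemma uniform_limit_dens_slice:
  assumes vs: "set vs \<subseteq> Basis" and w: "\<And>\<sigma>. 1 \<le> \<sigma> \<Longrightarrow> \<sigma> \<le> M \<Longrightarrow> (\<sigma>, w) \<in> index_set M"
  shows "uniform_limit ({1..M} \<times> UNIV) (\<lambda>n (\<sigma>, x). iter_partial vs (dens n (\<sigma>, w)) x)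
     (\<lambda>(\<sigma>, x). iter_partial vs (lim_dens (\<sigma>, w)) x) sequentially"
  unfolding uniform_limit_iff
proof (intro allI impI)
  fix \<epsilon> :: real assume "\<epsilon> > 0"
  from iter_partial_dens_uniform_limit[OF vs, of M, unfolded uniform_limit_iff, rule_format, OF this]
  show "\<forall>\<^sub>F n in sequentially. \<forall>z\<in>{1..M} \<times> UNIV. dist (case z of (\<sigma>, x) \<Rightarrow> iter_partial vs (dens n (\<sigma>, w)) x)
      (case z of (\<sigma>, x) \<Rightarrow> iter_partial vs (lim_dens (\<sigma>, w)) x) < \<epsilon>"
  proof eventually_elim
    case (elim n)
    show ?case
    proof
      fix z :: "real \<times> (complex ^ 'N)" assume "z \<in> {1..M} \<times> UNIV"
      then obtain \<sigma> x where z: "z = (\<sigma>, x)" "1 \<le> \<sigma>" "\<sigma> \<le> M" by auto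
      then have "((\<sigma>, w), x) \<in> index_set M \<times> UNIV" using w by auto
      from elim[rule_format, OF this] show "dist (case z of (\<sigma>, x) \<Rightarrow> iter_partial vs (dens n (\<sigma>, w)) x)
      (case z of (\<sigma>, x) \<Rightarrow> iter_partial vs (lim_dens (\<sigma>, w)) x) < \<epsilon>" by (simp add: z(1))
    qed
  qed
qed

end

theorem theorem10:
  fixes F :: "'N::finite \<Rightarrow> complex \<Rightarrow> complex"
    and a b :: "'N \<Rightarrow> nat \<Rightarrow> complex"
  assumes "\<And>j. dirichlet_series (F j) (a j)"
    and "\<And>j. euler_product (F j) (b j)"
    and "orthogonal_family a"
  shows "\<exists>(G :: nat \<Rightarrow> real \<Rightarrow> 'N \<Rightarrow> complex ^ 'N \<Rightarrow> real)
          (H :: nat \<Rightarrow> real \<Rightarrow> 'N \<Rightarrow> 'N \<Rightarrow> complex \<Rightarrow> complex ^ 'N \<Rightarrow> real)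
          (L1 :: real \<Rightarrow> 'N \<Rightarrow> (complex ^ 'N) measure)
          (L2 :: real \<Rightarrow> 'N \<Rightarrow> 'N \<Rightarrow> complex \<Rightarrow> (complex ^ 'N) measure)
          (Glim :: real \<Rightarrow> 'N \<Rightarrow> complex ^ 'N \<Rightarrow> real)
          (Hlim :: real \<Rightarrow> 'N \<Rightarrow> 'N \<Rightarrow> complex \<Rightarrow> complex ^ 'N \<Rightarrow> real).

     (\<exists>n0\<ge>1. \<forall>n\<ge>n0. \<forall>\<sigma>\<ge>1.
        (\<forall>j. has_density (lambda1 b n \<sigma> j) (G n \<sigma> j) \<and>
             continuous_on UNIV (G n \<sigma> j)) \<and>
        (\<forall>j l. \<forall>\<tau>\<in>{1, -1, \<i>, -\<i>}. j \<noteq> l \<longrightarrow>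
             has_density (lambda2 b n \<sigma> j l \<tau>) (H n \<sigma> j l \<tau>) \<and>
             continuous_on UNIV (H n \<sigma> j l \<tau>))) \<and>
     (\<forall>k. \<exists>nk\<ge>1. \<forall>n\<ge>nk. \<forall>\<sigma>\<ge>1.
        (\<forall>j. C_diff k (G n \<sigma> j)) \<and>
        (\<forall>j l. \<forall>\<tau>\<in>{1, -1, \<i>, -\<i>}. j \<noteq> l \<longrightarrow> C_diff k (H n \<sigma> j l \<tau>))) \<and>
     (\<forall>\<sigma>\<ge>1.
        (\<forall>j. converges_weakly (\<lambda>n. lambda1 b n \<sigma> j) (L1 \<sigma> j) \<and>
             has_density (L1 \<sigma> j) (Glim \<sigma> j) \<and>
             (\<forall>k. C_diff k (Glim \<sigma> j))) \<and>
        (\<forall>j l. \<forall>\<tau>\<in>{1, -1, \<i>, -\<i>}. j \<noteq> l \<longrightarrow>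
             converges_weakly (\<lambda>n. lambda2 b n \<sigma> j l \<tau>) (L2 \<sigma> j l \<tau>) \<and>
             has_density (L2 \<sigma> j l \<tau>) (Hlim \<sigma> j l \<tau>) \<and>
             (\<forall>k. C_diff k (Hlim \<sigma> j l \<tau>)))) \<and>
     (\<forall>M>1. \<forall>vs. set vs \<subseteq> Basis \<longrightarrow>
        (\<forall>j. uniform_limit ({1..M} \<times> UNIV)
               (\<lambda>n (\<sigma>, x). iter_partial vs (G n \<sigma> j) x)
               (\<lambda>(\<sigma>, x). iter_partial vs (Glim \<sigma> j) x) sequentially) \<and>
        (\<forall>j l. \<forall>\<tau>\<in>{1, -1, \<i>, -\<i>}. j \<noteq> l \<longrightarrow>
             uniform_limit ({1..M} \<times> UNIV)
               (\<lambda>n (\<sigma>, x). iter_partial vs (H n \<sigma> j l \<tau>) x)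
               (\<lambda>(\<sigma>, x). iter_partial vs (Hlim \<sigma> j l \<tau>) x) sequentially))"
proof -
  have "\<forall>j. \<exists>\<theta> C. \<theta> < (1 / 2 :: real) \<and> (\<forall>p k. prime p \<longrightarrow> k \<ge> 1 \<longrightarrow> norm (b j (p ^ k)) \<le> C * real p powr (real k * \<theta>))"
    using assms(2) unfolding euler_product_def by blast
  then obtain \<theta> C :: "'N \<Rightarrow> real" where bd: "\<And>j. \<theta> j < 1 / 2"
      "\<And>j p k. prime p \<Longrightarrow> k \<ge> 1 \<Longrightarrow> norm (b j (p ^ k)) \<le> C j * real p powr (real k * \<theta> j)"
    unfolding choice_iff by blast
  \<comment> \<open>Condition (II) gives a separate exponent and constant for each of the finitely
    many functions. They are merged into common ones; absolute values are taken because the given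
    constants are not assumed nonnegative.\<close>
  define \<eta> where "\<eta> = Max (range \<theta>)"
  define C' where "C' = (\<Sum>j\<in>UNIV. \<bar>C j\<bar>)"
  have \<eta>: "\<eta> < 1 / 2" "\<theta> j \<le> \<eta>" for j
    unfolding \<eta>_def using bd(1) by (subst Max_less_iff; auto) (rule Max_ge; simp)
  have C': "\<bar>C j\<bar> \<le> C'" for j
    unfolding C'_def by (rule member_le_sum) auto
  have bd': "norm (b j (p ^ k)) \<le> C' * real p powr (real k * \<eta>)" if "prime p" "k \<ge> 1" for j p k
  proof -
    have "norm (b j (p ^ k)) \<le> C j * real p powr (real k * \<theta> j)" by (rule bd(2)[OF that])
    also have "\<dots> \<le> C' * real p powr (real k * \<eta>)"
      using C'[of j] \<eta>(2)[of j] prime_ge_1_nat[OF that(1)] by (intro mult_mono powr_mono mult_left_mono) auto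
    finally show ?thesis .
  qed
  have ab: "a j p = b j p" if "prime p" for j p
    by (rule coefficient_at_prime[OF assms(1,2) that])
  obtain c0 where c0: "c0 > 0" "\<And>y P0. norm y = 1 \<Longrightarrow> \<exists>p\<ge>P0. prime p \<and> norm (coeff_dot a p y) \<ge> c0"
    using infinitely_many_good_primes[OF assms(3)] by metis
  have good: "\<exists>p\<ge>P0. prime p \<and> norm (coeff_dot b p y) \<ge> c0" if "norm y = 1" for y :: "complex ^ 'N" and P0
  proof -
    obtain p where "p \<ge> P0" "prime p" "norm (coeff_dot a p y) \<ge> c0" using c0(2)[OF \<open>norm y = 1\<close>] by blast
    moreover from this have "coeff_dot a p y = coeff_dot b p y" by (simp add: coeff_dot_def ab)
    ultimately show ?thesis by auto
  qed
  interpret good_euler_family b \<eta> C' c0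
    by standard (use \<eta>(1) bd' c0(1) good C' abs_ge_zero order_trans in \<open>blast+\<close>)
  define pair where "pair j l \<tau> = (\<lambda>i. single j i + \<tau> * single l i)" for j l :: 'N and \<tau>
  note eqs = lambda1_eq lambda2_eq[folded pair_def]
  \<comment> \<open>For a fixed \<open>\<sigma>\<close> the bound \<open>M\<close> is taken to be
    \<open>\<sigma>\<close> itself. The thresholds for \<open>n\<close> do not depend on
    \<open>M\<close>, so they remain valid for all \<open>\<sigma> \<ge> 1\<close>.\<close>
  note inS = index_set_single[OF _ order_refl] index_set_pair[OF _ order_refl, folded pair_def]
  show ?thesis
  proof (rule exI[of _ "\<lambda>n \<sigma> j. dens n (\<sigma>, single j)"],
      rule exI[of _ "\<lambda>n \<sigma> j l \<tau>. dens n (\<sigma>, pair j l \<tau>)"],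
      rule exI[of _ "\<lambda>\<sigma> j. density lborel (\<lambda>x. ennreal (lim_dens (\<sigma>, single j) x))"],
      rule exI[of _ "\<lambda>\<sigma> j l \<tau>. density lborel (\<lambda>x. ennreal (lim_dens (\<sigma>, pair j l \<tau>) x))"],
      rule exI[of _ "\<lambda>\<sigma> j. lim_dens (\<sigma>, single j)"],
      rule exI[of _ "\<lambda>\<sigma> j l \<tau>. lim_dens (\<sigma>, pair j l \<tau>)"],
      unfold eqs, intro conjI)
    show "\<exists>n0\<ge>1. \<forall>n\<ge>n0. \<forall>\<sigma>\<ge>1.
        (\<forall>j. has_density (\<mu> n (\<sigma>, single j)) (dens n (\<sigma>, single j)) \<and> continuous_on UNIV (dens n (\<sigma>, single j))) \<and>
        (\<forall>j l. \<forall>\<tau>\<in>{1, -1, \<i>, -\<i>}. j \<noteq> l \<longrightarrow>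
           has_density (\<mu> n (\<sigma>, pair j l \<tau>)) (dens n (\<sigma>, pair j l \<tau>)) \<and> continuous_on UNIV (dens n (\<sigma>, pair j l \<tau>)))"
    proof -
      obtain n0 where "n0 \<ge> 1" and n0: "\<And>n M s. n \<ge> n0 \<Longrightarrow> s \<in> index_set M \<Longrightarrow> has_density (\<mu> n s) (dens n s) \<and> continuous_on UNIV (dens n s)"
        using has_density_dens by blast
      from \<open>n0 \<ge> 1\<close> show ?thesis
        by (intro exI[of _ n0] conjI[OF \<open>n0 \<ge> 1\<close>] allI impI ballI conjI) (simp_all add: n0[OF _ inS(1)] n0[OF _ inS(2)])
    qed
    show "\<forall>k. \<exists>nk\<ge>1. \<forall>n\<ge>nk. \<forall>\<sigma>\<ge>1. (\<forall>j. C_diff k (dens n (\<sigma>, single j))) \<and>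
        (\<forall>j l. \<forall>\<tau>\<in>{1, -1, \<i>, -\<i>}. j \<noteq> l \<longrightarrow> C_diff k (dens n (\<sigma>, pair j l \<tau>)))"
    proof
      fix k
      obtain n0 where "n0 \<ge> 1" and n0: "\<And>n M s. n \<ge> n0 \<Longrightarrow> s \<in> index_set M \<Longrightarrow> C_diff k (dens n s)"
        using C_diff_dens by blast
      then show "\<exists>nk\<ge>1. \<forall>n\<ge>nk. \<forall>\<sigma>\<ge>1. (\<forall>j. C_diff k (dens n (\<sigma>, single j))) \<and>
        (\<forall>j l. \<forall>\<tau>\<in>{1, -1, \<i>, -\<i>}. j \<noteq> l \<longrightarrow> C_diff k (dens n (\<sigma>, pair j l \<tau>)))"
        by (intro exI[of _ n0] conjI[OF \<open>n0 \<ge> 1\<close>] allI impI ballI conjI) (simp_all add: n0[OF _ inS(1)] n0[OF _ inS(2)])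
    qed
    show "\<forall>\<sigma>\<ge>1. (\<forall>j. converges_weakly (\<lambda>n. \<mu> n (\<sigma>, single j)) (density lborel (\<lambda>x. ennreal (lim_dens (\<sigma>, single j) x))) \<and>
          has_density (density lborel (\<lambda>x. ennreal (lim_dens (\<sigma>, single j) x))) (lim_dens (\<sigma>, single j)) \<and>
          (\<forall>k. C_diff k (lim_dens (\<sigma>, single j)))) \<and>
        (\<forall>j l. \<forall>\<tau>\<in>{1, -1, \<i>, -\<i>}. j \<noteq> l \<longrightarrow>
          converges_weakly (\<lambda>n. \<mu> n (\<sigma>, pair j l \<tau>)) (density lborel (\<lambda>x. ennreal (lim_dens (\<sigma>, pair j l \<tau>) x))) \<and>
          has_density (density lborel (\<lambda>x. ennreal (lim_dens (\<sigma>, pair j l \<tau>) x))) (lim_dens (\<sigma>, pair j l \<tau>)) \<and>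
          (\<forall>k. C_diff k (lim_dens (\<sigma>, pair j l \<tau>))))"
      by (intro allI impI ballI conjI lim_dens_properties[OF inS(1)] lim_dens_properties[OF inS(2)]
          C_diff_lim_dens[OF inS(1)] C_diff_lim_dens[OF inS(2)])
    show "\<forall>M>1. \<forall>vs. set vs \<subseteq> Basis \<longrightarrow>
        (\<forall>j. uniform_limit ({1..M} \<times> UNIV) (\<lambda>n (\<sigma>, x). iter_partial vs (dens n (\<sigma>, single j)) x)
               (\<lambda>(\<sigma>, x). iter_partial vs (lim_dens (\<sigma>, single j)) x) sequentially) \<and>
        (\<forall>j l. \<forall>\<tau>\<in>{1, -1, \<i>, -\<i>}. j \<noteq> l \<longrightarrow>
             uniform_limit ({1..M} \<times> UNIV) (\<lambda>n (\<sigma>, x). iter_partial vs (dens n (\<sigma>, pair j l \<tau>)) x)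
               (\<lambda>(\<sigma>, x). iter_partial vs (lim_dens (\<sigma>, pair j l \<tau>)) x) sequentially)"
      by (intro allI impI ballI conjI uniform_limit_dens_slice)
         (auto simp: index_set_single intro: index_set_pair[folded pair_def])
  qed
qed

end
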